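(* Let $\mathcal{H}$ be a finite central irreducible real hyperplane arrangement with base region $B$. The map $\mathsf{Pow}$ is a poset embedding (isomorphism onto its image with the induced order) from the poset of regions $\mathrm{Weak}(\mathcal{H},B)$ into the interval $[\mathbbm{1},\Delta^2]$ of the pure shard monoid $\mathbf{P}^+(\mathcal{H},B)$.
   Context: Regions are the connected components of $\mathbb{R}^n\setminus\bigcup\mathcal{H}$; $\mathrm{inv}(C,C')$ = hyperplanes separating $C,C'$; $\mathrm{inv}(C)=\mathrm{inv}(B,C)$; $-C$ is the region with $\mathrm{inv}(C,-C)=\mathcal{H}$; $\mathrm{Weak}(\mathcal{H},B)$ orders regions by inclusion of $\mathrm{inv}$. Irreducible: no linear automorphism and partition of $\mathcal{H}$ into two nonempty parts whose transformed normals are mutually orthogonal. Salvetti complex: vertices are regions; one directed edge $D\to D'$ per ordered pair of regions separated by exactly one hyperplane; for a cover $C'\lessdot C$, $e$ is the edge $C'\to C$, $e^*$ the edge $C\to C'$. Positive galleries are directed edge paths, minimal if of length $|\mathrm{inv}(D,D')|$. For every codimension-2 face $F$ and region $C$ with $F\subseteq\overline C$, a 2-cell is glued along the two positive minimal galleries from $C$ to the region opposite $C$ about $F$ through regions whose closures contain $F$. $\pi_1(\mathrm{Sal}(\mathcal{H}),B)$ is the fundamental group; $\mathrm{gal}(D,D')$ is any positive minimal gallery (all homotopic). $\ell_e:=\mathrm{gal}(B,C')\,e\,e^*\,\mathrm{gal}(B,C')^{-1}$. Shards: a full rank-2 subarrangement is the set $\mathcal A$ of all hyperplanes containing a given codimension-2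 subspace (when $|\mathcal A|\ge2$); $H\in\mathcal A$ is basic if it meets the boundary of the region of $\mathcal A$ containing $B$ in dimension $n-1$; $H$ cuts $H'$ if they lie in such $\mathcal A$ with $H$ basic and $H'$ not; shards of $H$ are closures of connected components of $H$ minus the hyperplanes cutting $H$. For an edge $e\colon C'\to C$ with $C'\lessdot C$, $\Sigma(e)$ is the shard containing $\overline{C'}\cap\overline C$. The loop $\ell_e$ depends only on $\Sigma(e)$ and is written $\ell_{\Sigma(e)}$. The pure shard monoid $\mathbf{P}^+(\mathcal{H},B)$ is the submonoid generated by all $\ell_e$, ordered by $p\le p'$ iff $p'=pq$ for some $q$ in the monoid; $\Delta^2:=\mathrm{gal}(B,-B)\,\mathrm{gal}(-B,B)$. For $C\in\mathcal{R}$ and a positive minimal gallery $B=C_0\xrightarrow{e_1}C_1\xrightarrow{e_2}\cdots\xrightarrow{e_k}C_k=C$, $\mathsf{Pow}(C):=\ell_{\Sigma(e_k)}\ell_{\Sigma(e_{k-1})}\cdots\ell_{\Sigma(e_1)}$ (independent of the gallery). *)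

theory Defs
  imports "HOL-Analysis.Analysis" "HOL-Algebra.Group" "HOL-Algebra.Order"
begin

section \<open>Central arrangements and their regions\<close>

definition normal_to :: "'a::euclidean_space \<Rightarrow> 'a set \<Rightarrow> bool" where
  "normal_to a H \<longleftrightarrow> a \<noteq> 0 \<and> H = {x. a \<bullet> x = 0}"

text \<open>Central: all hyperplanes are linear.\<close>

definition central_arrangement :: "'a::euclidean_space set set \<Rightarrow> bool" where
  "central_arrangement \<H> \<longleftrightarrow> finite \<H> \<and> (\<forall>H\<in>\<H>. \<exists>a. normal_to a H)"

text \<open>Transforming the normals by \<open>T\<close> amounts to transforming the hyperplanes by the inverse
  adjoint of \<open>T\<close>, which is again a linear automorphism.\<close>

definition irreducible_arrangement :: "'a::euclidean_space set set \<Rightarrow> bool" where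
  "irreducible_arrangement \<H> \<longleftrightarrow>
     \<not> (\<exists>(T :: 'a \<Rightarrow> 'a) \<H>1 \<H>2. linear T \<and> bij T \<and>
          \<H>1 \<noteq> {} \<and> \<H>2 \<noteq> {} \<and> \<H>1 \<union> \<H>2 = \<H> \<and> \<H>1 \<inter> \<H>2 = {} \<and>
          (\<forall>H1\<in>\<H>1. \<forall>H2\<in>\<H>2. \<forall>a b. normal_to a H1 \<and> normal_to b H2 \<longrightarrow> T a \<bullet> T b = 0))"

definition regions :: "'a::euclidean_space set set \<Rightarrow> 'a set set" where
  "regions \<H> = components (UNIV - \<Union>\<H>)"

text \<open>\<open>sep \<H> C D\<close> is $\mathrm{inv}(C,D)$.\<close>

definition sep :: "'a::euclidean_space set set \<Rightarrow> 'a set \<Rightarrow> 'a set \<Rightarrow> 'a set set" where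
  "sep \<H> C D = {H \<in> \<H>. \<exists>a. normal_to a H \<and> (\<forall>x\<in>C. a \<bullet> x < 0) \<and> (\<forall>x\<in>D. 0 < a \<bullet> x)}"

definition opposite_region :: "'a::euclidean_space set set \<Rightarrow> 'a set \<Rightarrow> 'a set" where
  "opposite_region \<H> C = (THE D. D \<in> regions \<H> \<and> sep \<H> C D = \<H>)"

definition weak_poset :: "'a::euclidean_space set set \<Rightarrow> 'a set \<Rightarrow> 'a set gorder" where
  "weak_poset \<H> B =
     \<lparr>carrier = regions \<H>, eq = (=), le = (\<lambda>C D. sep \<H> B C \<subseteq> sep \<H> B D)\<rparr>"

text \<open>\<open>covers \<H> B C' C\<close>: in the poset of regions, \<open>C'\<close> is covered by \<open>C\<close>.\<close>

definition covers :: "'a::euclidean_space set set \<Rightarrow> 'a set \<Rightarrow> 'a set \<Rightarrow> 'a set \<Rightarrow> bool" where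
  "covers \<H> B C' C \<longleftrightarrow> C' \<in> regions \<H> \<and> C \<in> regions \<H> \<and> sep \<H> B C' \<subset> sep \<H> B C \<and>
     \<not> (\<exists>D\<in>regions \<H>. sep \<H> B C' \<subset> sep \<H> B D \<and> sep \<H> B D \<subset> sep \<H> B C)"

text \<open>Faces are taken to be closed.  For \<open>DIM('a) = 1\<close> the empty set has affine dimension
  \<open>DIM('a) - 2\<close>, but it is not a face of the arrangement.\<close>

definition codim2_faces :: "'a::euclidean_space set set \<Rightarrow> 'a set set" where
  "codim2_faces \<H> = {F. F \<noteq> {} \<and> (\<exists>D\<in>regions \<H>. F face_of closure D) \<and>
                         aff_dim F = int DIM('a) - 2}"

definition opposite_about :: "'a::euclidean_space set set \<Rightarrow> 'a set \<Rightarrow> 'a set \<Rightarrow> 'a set" where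
  "opposite_about \<H> F C = (THE D. D \<in> regions \<H> \<and> sep \<H> C D = {H \<in> \<H>. F \<subseteq> H})"


section \<open>Galleries\<close>

text \<open>There is exactly one directed edge per ordered pair of adjacent regions, so a directed edge
  path is given by the nonempty list of regions that it visits.\<close>

definition adjacent :: "'a::euclidean_space set set \<Rightarrow> 'a set \<Rightarrow> 'a set \<Rightarrow> bool" where
  "adjacent \<H> C D \<longleftrightarrow> C \<in> regions \<H> \<and> D \<in> regions \<H> \<and> card (sep \<H> C D) = 1"

definition gallery ::
  "'a::euclidean_space set set \<Rightarrow> 'a set \<Rightarrow> 'a set \<Rightarrow> 'a set list \<Rightarrow> bool" where
  "gallery \<H> C D g \<longleftrightarrow> g \<noteq> [] \<and> set g \<subseteq> regions \<H> \<and> successively (adjacent \<H>) g \<and>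
     hd g = C \<and> last g = D"

definition minimal_gallery ::
  "'a::euclidean_space set set \<Rightarrow> 'a set \<Rightarrow> 'a set \<Rightarrow> 'a set list \<Rightarrow> bool" where
  "minimal_gallery \<H> C D g \<longleftrightarrow> gallery \<H> C D g \<and> length g - 1 = card (sep \<H> C D)"

definition gal :: "'a::euclidean_space set set \<Rightarrow> 'a set \<Rightarrow> 'a set \<Rightarrow> 'a set list" where
  "gal \<H> C D = (SOME g. minimal_gallery \<H> C D g)"


section \<open>The Salvetti complex\<close>

text \<open>
  The complex is realised as a subspace of the product space \<open>'a set cell \<Rightarrow> real\<close>, by iterated
  coning: a vertex is a coordinate point, a closed edge is the cone over its two ends with apex a
  coordinate point of its own (so the two opposite edges between adjacent regions meet only in
  their ends), and a closed 2-cell is the cone, with apex again a new coordinate point, over the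
  union of the galleries along which it is glued.  These are two galleries with the same ends and
  no other common vertex, so their union is an embedded circle, the cone over it is a closed disc,
  and the resulting finite complex is homeomorphic to the abstractly glued one.
\<close>

datatype 'r cell = Vertex 'r | Edge 'r 'r | Two_cell 'r 'r

definition cell_pt :: "'r cell \<Rightarrow> 'r cell \<Rightarrow> real" where
  "cell_pt c = (\<lambda>i. if i = c then 1 else 0)"

definition seg :: "('i \<Rightarrow> real) \<Rightarrow> ('i \<Rightarrow> real) \<Rightarrow> real \<Rightarrow> 'i \<Rightarrow> real" where
  "seg x y = (\<lambda>t i. (1 - t) * x i + t * y i)"

definition edge_path :: "'r \<Rightarrow> 'r \<Rightarrow> real \<Rightarrow> 'r cell \<Rightarrow> real" where
  "edge_path C D = seg (cell_pt (Vertex C)) (cell_pt (Edge C D)) +++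
                   seg (cell_pt (Edge C D)) (cell_pt (Vertex D))"

fun gallery_path :: "'r list \<Rightarrow> real \<Rightarrow> 'r cell \<Rightarrow> real" where
  "gallery_path [] = undefined"
| "gallery_path [C] = (\<lambda>_. cell_pt (Vertex C))"
| "gallery_path (C # D # g) = edge_path C D +++ gallery_path (D # g)"

definition two_cell_galleries ::
  "'a::euclidean_space set set \<Rightarrow> 'a set \<Rightarrow> 'a set \<Rightarrow> 'a set list set" where
  "two_cell_galleries \<H> C F =
     {g. minimal_gallery \<H> C (opposite_about \<H> F C) g \<and> (\<forall>D\<in>set g. F \<subseteq> closure D)}"

definition two_cell ::
  "'a::euclidean_space set set \<Rightarrow> 'a set \<Rightarrow> 'a set \<Rightarrow> ('a set cell \<Rightarrow> real) set" where
  "two_cell \<H> C F =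
     {seg x (cell_pt (Two_cell C F)) t | x t.
        x \<in> (\<Union>g\<in>two_cell_galleries \<H> C F. path_image (gallery_path g)) \<and> 0 \<le> t \<and> t \<le> 1}"

definition salvetti :: "'a::euclidean_space set set \<Rightarrow> ('a set cell \<Rightarrow> real) set" where
  "salvetti \<H> =
     {cell_pt (Vertex C) | C. C \<in> regions \<H>} \<union>
     \<Union>{path_image (edge_path C D) | C D. adjacent \<H> C D} \<union>
     \<Union>{two_cell \<H> C F | C F. C \<in> regions \<H> \<and> F \<in> codim2_faces \<H> \<and> F \<subseteq> closure C}"


section \<open>The fundamental group\<close>

definition homotopy_class :: "'p::topological_space set \<Rightarrow> (real \<Rightarrow> 'p) \<Rightarrow> (real \<Rightarrow> 'p) set" where
  "homotopy_class S p = {q. homotopic_paths S p q}"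

definition fundamental_group ::
  "'p::topological_space set \<Rightarrow> 'p \<Rightarrow> (real \<Rightarrow> 'p) set monoid" where
  "fundamental_group S b =
     \<lparr>carrier = {homotopy_class S p | p.
        path p \<and> path_image p \<subseteq> S \<and> pathstart p = b \<and> pathfinish p = b},
      mult = (\<lambda>X Y. {r. \<exists>p\<in>X. \<exists>q\<in>Y. homotopic_paths S (p +++ q) r}),
      one = homotopy_class S (\<lambda>_. b)\<rparr>"

type_synonym 'a sal_elem = "(real \<Rightarrow> 'a set cell \<Rightarrow> real) set"

definition sal_group ::
  "'a::euclidean_space set set \<Rightarrow> 'a set \<Rightarrow> 'a sal_elem monoid" where
  "sal_group \<H> B = fundamental_group (salvetti \<H>) (cell_pt (Vertex B))"

text \<open>For \<open>e\<close> the edge from \<open>C'\<close> to \<open>C\<close>, this is $\ell_e$.\<close>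

definition edge_loop ::
  "'a::euclidean_space set set \<Rightarrow> 'a set \<Rightarrow> 'a set \<Rightarrow> 'a set \<Rightarrow> 'a sal_elem" where
  "edge_loop \<H> B C' C =
     homotopy_class (salvetti \<H>)
       (gallery_path (gal \<H> B C') +++ edge_path C' C +++ edge_path C C' +++
        reversepath (gallery_path (gal \<H> B C')))"

definition full_twist :: "'a::euclidean_space set set \<Rightarrow> 'a set \<Rightarrow> 'a sal_elem" where
  "full_twist \<H> B =
     homotopy_class (salvetti \<H>)
       (gallery_path (gal \<H> B (opposite_region \<H> B)) +++
        gallery_path (gal \<H> (opposite_region \<H> B) B))"


section \<open>Shards\<close>

definition rank2_subarrangements :: "'a::euclidean_space set set \<Rightarrow> 'a set set set" where
  "rank2_subarrangements \<H> =
     {{H \<in> \<H>. L \<subseteq> H} | L. subspace L \<and> dim L + 2 = DIM('a) \<and> 2 \<le> card {H \<in> \<H>. L \<subseteq> H}}"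

definition basic :: "'a::euclidean_space set set \<Rightarrow> 'a set \<Rightarrow> 'a set \<Rightarrow> bool" where
  "basic \<A> B H \<longleftrightarrow> H \<in> \<A> \<and>
     (\<exists>R\<in>regions \<A>. B \<subseteq> R \<and> aff_dim (H \<inter> frontier R) = int DIM('a) - 1)"

definition cuts :: "'a::euclidean_space set set \<Rightarrow> 'a set \<Rightarrow> 'a set \<Rightarrow> 'a set \<Rightarrow> bool" where
  "cuts \<H> B H H' \<longleftrightarrow>
     (\<exists>\<A>\<in>rank2_subarrangements \<H>. H \<in> \<A> \<and> H' \<in> \<A> \<and> basic \<A> B H \<and> \<not> basic \<A> B H')"

definition shards :: "'a::euclidean_space set set \<Rightarrow> 'a set \<Rightarrow> 'a set set" where
  "shards \<H> B =
     (\<Union>H\<in>\<H>. closure ` components (H - \<Union>{H' \<in> \<H>. cuts \<H> B H' H}))"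

definition shard_of_edge ::
  "'a::euclidean_space set set \<Rightarrow> 'a set \<Rightarrow> 'a set \<Rightarrow> 'a set \<Rightarrow> 'a set" where
  "shard_of_edge \<H> B C' C = (THE S. S \<in> shards \<H> B \<and> closure C' \<inter> closure C \<subseteq> S)"

definition shard_loop ::
  "'a::euclidean_space set set \<Rightarrow> 'a set \<Rightarrow> 'a set \<Rightarrow> 'a sal_elem" where
  "shard_loop \<H> B S =
     (THE l. \<exists>C' C. covers \<H> B C' C \<and> shard_of_edge \<H> B C' C = S \<and> l = edge_loop \<H> B C' C)"


section \<open>The pure shard monoid and the map Pow\<close>

definition pure_shard_monoid ::
  "'a::euclidean_space set set \<Rightarrow> 'a set \<Rightarrow> 'a sal_elem monoid" where
  "pure_shard_monoid \<H> B =
     (sal_group \<H> B)\<lparr>carrier :=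
        (\<lambda>M. submonoid M (sal_group \<H> B)) hull {edge_loop \<H> B C' C | C' C. covers \<H> B C' C}\<rparr>"

definition pure_shard_poset ::
  "'a::euclidean_space set set \<Rightarrow> 'a set \<Rightarrow> 'a sal_elem gorder" where
  "pure_shard_poset \<H> B = (let P = pure_shard_monoid \<H> B in
     \<lparr>carrier = carrier P, eq = (=), le = (\<lambda>p p'. \<exists>q\<in>carrier P. p' = p \<otimes>\<^bsub>P\<^esub> q)\<rparr>)"

definition pure_shard_interval ::
  "'a::euclidean_space set set \<Rightarrow> 'a set \<Rightarrow> 'a sal_elem gorder" where
  "pure_shard_interval \<H> B = (pure_shard_poset \<H> B)
     \<lparr>carrier := at_least_at_most (pure_shard_poset \<H> B)
                  \<one>\<^bsub>pure_shard_monoid \<H> B\<^esub> (full_twist \<H> B)\<rparr>"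

text \<open>The shard loop of the first edge of the gallery is the rightmost factor.\<close>

fun gallery_pow ::
  "'a::euclidean_space set set \<Rightarrow> 'a set \<Rightarrow> 'a set list \<Rightarrow> 'a sal_elem" where
  "gallery_pow \<H> B (C' # C # g) =
     gallery_pow \<H> B (C # g) \<otimes>\<^bsub>pure_shard_monoid \<H> B\<^esub>
     shard_loop \<H> B (shard_of_edge \<H> B C' C)"
| "gallery_pow \<H> B _ = \<one>\<^bsub>pure_shard_monoid \<H> B\<^esub>"

definition region_pow :: "'a::euclidean_space set set \<Rightarrow> 'a set \<Rightarrow> 'a set \<Rightarrow> 'a sal_elem" where
  "region_pow \<H> B C = gallery_pow \<H> B (gal \<H> B C)"

end

theory Submission
  imports Defs "HOL-Complex_Analysis.Winding_Numbers"
begin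

text \<open>
  Telescoping shows that \<open>Pow(C)\<close> is the round trip \<open>gal(B,C) gal(C,B)\<close>, once it is known that
  positive minimal galleries with the same ends are homotopic and that the loop of an edge depends
  only on its shard.  For the former, push the start point of a ray inside a region: for a generic
  motion, the first wall of the ray changes at points on a flat of codimension two only, where a
  2-cell is available.  For the latter, move generically inside a hyperplane \<open>H\<close>: at a flat of
  codimension two that is not cut, \<open>H\<close> is basic, and the two edges are conjugate by a minimal gallery
  that continues a minimal gallery from \<open>B\<close>.

  If \<open>C\<close> is covered by \<open>D\<close>, sliding the edge \<open>C \<rightarrow> D\<close> along a minimal gallery from \<open>C\<close> through \<open>B\<close> to
  \<open>-D\<close> gives \<open>Pow(D) = Pow(C) l\<close>, where \<open>l\<close> is the loop of the edge \<open>-D \<rightarrow> -C\<close>; hence \<open>Pow\<close> is order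
  preserving, and the full twist is \<open>Pow(-B)\<close>.  Conversely, for each hyperplane \<open>H\<close> the complex has a
  map to the punctured plane whose winding number is positive on loops of edges across \<open>H\<close> and zero on
  the loops of all other edges.  It is nonnegative on the pure shard monoid, and positive on \<open>Pow(C)\<close>
  if and only if \<open>H\<close> separates \<open>B\<close> from \<open>C\<close>.
\<close>


section \<open>Classes of paths\<close>

text \<open>Only two features of the complex matter. Paths with the same ends in the base of a cone
  are homotopic in the cone; this gives all relations. A linear map is controlled on a cone by its
  values on the base and at the apex; this gives the invariants. The rest is combinatorics of sign
  vectors. Since galleries and edges are not loops, products are taken in the fundamental groupoid,
  and the group appears only when the monoid does.

  Genericity means that one end of a segment avoids finitely many hyperplanes. The vectors to avoid
  are chosen so that three hyperplanes met at one parameter of the segment must have dependent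
  normals; hence each change of wall happens at codimension two, where a single 2-cell or a single
  rank 2 subarrangement decides.

  The winding numbers have a second task: they show that the unit is the only invertible element of
  the monoid. Without this, divisibility would not be antisymmetric and the interval would not be a
  poset.\<close>

definition path_mult ::
    "'p::topological_space set \<Rightarrow> (real \<Rightarrow> 'p) set \<Rightarrow> (real \<Rightarrow> 'p) set \<Rightarrow> (real \<Rightarrow> 'p) set"
  where "path_mult S X Y =
    {r. \<exists>p\<in>X. \<exists>q\<in>Y. path p \<and> path q \<and> pathfinish p = pathstart q \<and> homotopic_paths S (p +++ q) r}"

definition path_in :: "'p::topological_space set \<Rightarrow> 'p \<Rightarrow> 'p \<Rightarrow> (real \<Rightarrow> 'p) \<Rightarrow> bool" where
  "path_in S a b p \<longleftrightarrow> path p \<and> path_image p \<subseteq> S \<and> pathstart p = a \<and> pathfinish p = b"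

lemma path_multI:
  "homotopic_paths S (p +++ q) r \<Longrightarrow> p \<in> X \<Longrightarrow> q \<in> Y \<Longrightarrow> path p \<Longrightarrow> path q \<Longrightarrow>
   pathfinish p = pathstart q \<Longrightarrow> r \<in> path_mult S X Y"
  by (auto simp: path_mult_def)

lemma path_in_join: "path_in S a b p \<Longrightarrow> path_in S b c q \<Longrightarrow> path_in S a c (p +++ q)"
  by (auto simp: path_in_def path_image_join)

lemma path_in_reversepath: "path_in S a b p \<Longrightarrow> path_in S b a (reversepath p)"
  by (auto simp: path_in_def)

lemma path_in_const: "a \<in> S \<Longrightarrow> path_in S a a (\<lambda>_. a)"
  by (auto simp: path_in_def path_def path_image_def pathstart_def pathfinish_def)

lemma path_in_homotopic: "path_in S a b p \<Longrightarrow> homotopic_paths S p q \<Longrightarrow> path_in S a b q"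
  unfolding path_in_def
  by (metis homotopic_paths_imp_path homotopic_paths_imp_pathfinish homotopic_paths_imp_pathstart
      homotopic_paths_imp_subset)

lemma homotopy_class_eq_iff:
  assumes "path_in S a b p"
  shows "homotopy_class S p = homotopy_class S q \<longleftrightarrow> homotopic_paths S p q"
proof
  assume "homotopy_class S p = homotopy_class S q"
  moreover have "p \<in> homotopy_class S p"
    using assms by (simp add: homotopy_class_def path_in_def)
  ultimately show "homotopic_paths S p q"
    by (simp add: homotopy_class_def homotopic_paths_sym_eq)
next
  assume "homotopic_paths S p q"
  then show "homotopy_class S p = homotopy_class S q"
    unfolding homotopy_class_def
    by (intro Collect_cong iffI)
      (erule homotopic_paths_trans[OF homotopic_paths_sym] homotopic_paths_trans; assumption)+
qed

lemma homotopic_paths_path_inD: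
  assumes "homotopic_paths S (p +++ q) r" "path p" "path q" "pathfinish p = pathstart q"
  shows "path_in S (pathstart p) (pathstart q) p" "path_in S (pathstart q) (pathfinish q) q"
proof -
  have "path_image p \<subseteq> S" "path_image q \<subseteq> S"
    using homotopic_paths_imp_subset[OF assms(1)] assms(2-) by (auto simp: path_image_join)
  then show "path_in S (pathstart p) (pathstart q) p" "path_in S (pathstart q) (pathfinish q) q"
    using assms by (auto simp: path_in_def)
qed

lemma homotopic_paths_assoc_in:
  "path_in S a b p \<Longrightarrow> path_in S b c q \<Longrightarrow> path_in S c d r \<Longrightarrow>
   homotopic_paths S ((p +++ q) +++ r) (p +++ (q +++ r))"
  unfolding path_in_def by (intro homotopic_paths_sym[OF homotopic_paths_assoc]) auto

text \<open>The conditions on the end points belong to \<open>path_mult\<close>, so incomposable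
  factors give the empty set and associativity needs no hypotheses. Products of classes can then be
  regrouped by plain rewriting.\<close>

lemma path_mult_assoc: "path_mult S (path_mult S X Y) Z = path_mult S X (path_mult S Y Z)"
proof (intro Set.set_eqI iffI)
  fix r assume "r \<in> path_mult S (path_mult S X Y) Z"
  then obtain u z p q where z: "z \<in> Z" "path z" "pathfinish u = pathstart z"
      and r: "homotopic_paths S (u +++ z) r"
      and pq: "p \<in> X" "q \<in> Y" "path p" "path q" "pathfinish p = pathstart q"
      and u: "homotopic_paths S (p +++ q) u" and pu: "path u"
    by (auto simp: path_mult_def)
  have uz: "path_in S (pathstart u) (pathstart z) u" "path_in S (pathstart z) (pathfinish z) z"
    using homotopic_paths_path_inD[OF r pu z(2,3)] .
  have fin: "pathfinish q = pathstart z"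
    using homotopic_paths_imp_pathfinish[OF u] z pq by simp
  note 1 = homotopic_paths_path_inD[OF u pq(3-5)]
  have "homotopic_paths S ((p +++ q) +++ z) (u +++ z)"
    using u uz fin by (intro homotopic_paths_join) (auto simp: path_in_def)
  then have "homotopic_paths S (p +++ (q +++ z)) r"
    using homotopic_paths_assoc_in[OF 1(1) 1(2)[unfolded fin] uz(2)] r
    by (meson homotopic_paths_sym homotopic_paths_trans)
  moreover have "q +++ z \<in> path_mult S Y Z"
    using pq z fin path_in_join[OF 1(2)[unfolded fin] uz(2)]
    by (intro path_multI[of _ q z]) (auto simp: path_in_def)
  ultimately show "r \<in> path_mult S X (path_mult S Y Z)"
    using pq z fin by - (rule path_multI[of _ p "q +++ z"], auto)
next
  fix r assume "r \<in> path_mult S X (path_mult S Y Z)"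
  then obtain u p q z where z: "p \<in> X" "path p" "pathfinish p = pathstart u"
      and r: "homotopic_paths S (p +++ u) r"
      and pq: "q \<in> Y" "z \<in> Z" "path q" "path z" "pathfinish q = pathstart z"
      and u: "homotopic_paths S (q +++ z) u" and pu: "path u"
    by (auto simp: path_mult_def)
  have uz: "path_in S (pathstart p) (pathstart u) p" "path_in S (pathstart u) (pathfinish u) u"
    using homotopic_paths_path_inD[OF r z(2) pu z(3)] .
  have st: "pathstart u = pathstart q"
    using homotopic_paths_imp_pathstart[OF u] by simp
  note 1 = homotopic_paths_path_inD[OF u pq(3-5)]
  have "homotopic_paths S (p +++ (q +++ z)) (p +++ u)"
    using u uz st by (intro homotopic_paths_join) (auto simp: path_in_def)
  then have "homotopic_paths S ((p +++ q) +++ z) r"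
    using homotopic_paths_assoc_in[OF uz(1)[unfolded st] 1] r
    by (meson homotopic_paths_sym homotopic_paths_trans)
  moreover have "p +++ q \<in> path_mult S X Y"
    using pq z st path_in_join[OF uz(1)[unfolded st] 1(1)]
    by (intro path_multI[of _ p q]) (auto simp: path_in_def)
  ultimately show "r \<in> path_mult S (path_mult S X Y) Z"
    using pq z st by - (rule path_multI[of _ "p +++ q" z], auto)
qed

lemma path_mult_class:
  assumes p: "path_in S a b p" and q: "path_in S b c q"
  shows "path_mult S (homotopy_class S p) (homotopy_class S q) = homotopy_class S (p +++ q)"
proof (intro Set.set_eqI iffI)
  fix r assume "r \<in> path_mult S (homotopy_class S p) (homotopy_class S q)"
  then obtain p' q' where *: "homotopic_paths S p p'" "homotopic_paths S q q'"
      "homotopic_paths S (p' +++ q') r"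
    by (auto simp: path_mult_def homotopy_class_def)
  have "homotopic_paths S (p +++ q) (p' +++ q')"
    using * p q by (intro homotopic_paths_join) (auto simp: path_in_def)
  then show "r \<in> homotopy_class S (p +++ q)"
    using * by (auto simp: homotopy_class_def intro: homotopic_paths_trans)
next
  fix r assume "r \<in> homotopy_class S (p +++ q)"
  then show "r \<in> path_mult S (homotopy_class S p) (homotopy_class S q)"
    using p q by (intro path_multI[of _ p q]) (auto simp: homotopy_class_def path_in_def)
qed

text \<open>The library states the groupoid laws for constant paths only in real vector spaces; the
  versions below come from those laws for the identity path of the unit interval.\<close>

lemma homotopic_paths_push:
  assumes "homotopic_paths {0..1::real} f g" "path p" "path_image p \<subseteq> S"
  shows "homotopic_paths S (p \<circ> f) (p \<circ> g)"
  using assms by (intro homotopic_paths_continuous_image) (auto simp: path_def path_image_def)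

lemma path_comp_linepath01: "p \<circ> linepath 0 (1::real) = p"
  by (auto simp: linepath_def)

lemma homotopic_paths_const_right:
  assumes "path_in S a b p"
  shows "homotopic_paths S (p +++ (\<lambda>_. b)) p"
proof -
  have "homotopic_paths {0..1::real} (linepath 0 1 +++ linepath 1 1) (linepath 0 1)"
    by (rule homotopic_paths_rid') (auto simp: closed_segment_eq_real_ivl)
  from homotopic_paths_push[OF this, of p S] assms
  have "homotopic_paths S ((p \<circ> linepath 0 1) +++ (p \<circ> linepath 1 1)) (p \<circ> linepath 0 1)"
    by (simp add: path_compose_join path_in_def)
  moreover have "p \<circ> linepath 1 (1::real) = (\<lambda>_. b)"
    using assms by (auto simp: path_in_def pathfinish_def linepath_def)
  ultimately show ?thesis by (simp add: path_comp_linepath01)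
qed

lemma homotopic_paths_const_left:
  assumes "path_in S a b p"
  shows "homotopic_paths S ((\<lambda>_. a) +++ p) p"
proof -
  have "homotopic_paths S (reversepath (reversepath p +++ (\<lambda>_. a))) (reversepath (reversepath p))"
    using homotopic_paths_const_right[OF path_in_reversepath[OF assms]]
    by (simp only: homotopic_paths_reversepath)
  moreover have "reversepath (\<lambda>_. a) = (\<lambda>_. a)" by (simp add: reversepath_def)
  moreover have "pathfinish (reversepath p) = pathstart (\<lambda>_. a)"
    using assms by (simp add: path_in_def pathstart_def)
  ultimately show ?thesis by (simp add: reversepath_joinpaths)
qed

lemma homotopic_paths_reverse_right:
  assumes "path_in S a b p"
  shows "homotopic_paths S (p +++ reversepath p) (\<lambda>_. a)"
proof -
  have "homotopic_paths {0..1::real} (linepath 0 1 +++ reversepath (linepath 0 1))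
          (linepath (pathstart (linepath 0 1)) (pathstart (linepath 0 1)))"
    by (rule homotopic_paths_rinv) (auto simp: closed_segment_eq_real_ivl)
  from homotopic_paths_push[OF this, of p S] assms
  have "homotopic_paths S ((p \<circ> linepath 0 1) +++ (p \<circ> linepath 1 0)) (p \<circ> linepath 0 0)"
    by (simp add: path_compose_join path_in_def)
  moreover have "p \<circ> linepath 0 (0::real) = (\<lambda>_. a)"
    using assms by (auto simp: path_in_def pathstart_def linepath_def)
  moreover have "p \<circ> linepath 1 (0::real) = reversepath p"
    by (auto simp: linepath_def reversepath_def)
  ultimately show ?thesis by (simp add: path_comp_linepath01)
qed

lemma path_mult_const_left:
  assumes "path_in S a b p"
  shows "path_mult S (homotopy_class S (\<lambda>_. a)) (homotopy_class S p) = homotopy_class S p"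
proof -
  have "a \<in> S" using assms by (auto simp: path_in_def)
  then have a: "path_in S a a (\<lambda>_. a)" by (rule path_in_const)
  show ?thesis
    unfolding path_mult_class[OF a assms]
    using homotopic_paths_const_left[OF assms] homotopy_class_eq_iff[OF path_in_join[OF a assms]]
      by blast
qed

lemma path_mult_const_right:
  assumes "path_in S a b p"
  shows "path_mult S (homotopy_class S p) (homotopy_class S (\<lambda>_. b)) = homotopy_class S p"
proof -
  have "b \<in> S" using assms by (auto simp: path_in_def)
  then have b: "path_in S b b (\<lambda>_. b)" by (rule path_in_const)
  show ?thesis
    unfolding path_mult_class[OF assms b]
    using homotopic_paths_const_right[OF assms] homotopy_class_eq_iff[OF path_in_join[OF assms b]]
      by blast
qed

lemma path_mult_reverse_right:
  "path_in S a b p \<Longrightarrow>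
   path_mult S (homotopy_class S p) (homotopy_class S (reversepath p)) = homotopy_class S (\<lambda>_. a)"
  by (metis path_mult_class homotopic_paths_reverse_right homotopy_class_eq_iff path_in_join
      path_in_reversepath)

lemma path_mult_reverse_left:
  "path_in S a b p \<Longrightarrow>
   path_mult S (homotopy_class S (reversepath p)) (homotopy_class S p) = homotopy_class S (\<lambda>_. b)"
  using path_mult_reverse_right[of S b a "reversepath p"] by (simp add: path_in_reversepath)

lemma carrier_fundamental_group:
  "X \<in> carrier (fundamental_group S b) \<longleftrightarrow> (\<exists>p. path_in S b b p \<and> X = homotopy_class S p)"
  by (auto simp: fundamental_group_def path_in_def)

lemma one_fundamental_group: "\<one>\<^bsub>fundamental_group S b\<^esub> = homotopy_class S (\<lambda>_. b)"
  by (simp add: fundamental_group_def)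

text \<open>Homotopies of paths fix the ends, so all members of the two classes are loops at
  \<open>b\<close>, and the extra conditions in \<open>path_mult\<close> hold automatically.\<close>

lemma mult_fundamental_group:
  assumes "X \<in> carrier (fundamental_group S b)" "Y \<in> carrier (fundamental_group S b)"
  shows "X \<otimes>\<^bsub>fundamental_group S b\<^esub> Y = path_mult S X Y"
proof -
  obtain p q
    where "path_in S b b p" "X = homotopy_class S p" "path_in S b b q" "Y = homotopy_class S q"
    using assms by (auto simp: carrier_fundamental_group)
  then have "path_in S b b r" if "r \<in> X \<union> Y" for r
    using that path_in_homotopic[of S b b] unfolding homotopy_class_def by blast
  then have "path r \<and> pathstart r = b \<and> pathfinish r = b" if "r \<in> X \<union> Y" for r
    using that unfolding path_in_def by blast
  then show ?thesis
    unfolding fundamental_group_def path_mult_def by (simp; blast)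
qed

text \<open>Makes the whole carrier a competitor in the hull that defines the pure shard monoid, so
  that the hull stays inside the carrier.\<close>

lemma submonoid_fundamental_group:
  assumes "b \<in> S"
  shows "submonoid (carrier (fundamental_group S b)) (fundamental_group S b)"
proof
  fix X Y assume *: "X \<in> carrier (fundamental_group S b)" "Y \<in> carrier (fundamental_group S b)"
  then obtain p q
    where "path_in S b b p" "X = homotopy_class S p" "path_in S b b q" "Y = homotopy_class S q"
    by (auto simp: carrier_fundamental_group)
  then show "X \<otimes>\<^bsub>fundamental_group S b\<^esub> Y \<in> carrier (fundamental_group S b)"
    unfolding mult_fundamental_group[OF *] 
    by (auto simp: carrier_fundamental_group path_mult_class intro!: exI[of _ "p +++ q"]
      path_in_join)
next
  show "\<one>\<^bsub>fundamental_group S b\<^esub> \<in> carrier (fundamental_group S b)"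
    using path_in_const[OF assms] by (auto simp: carrier_fundamental_group one_fundamental_group)
qed auto

section \<open>Edge paths and cones\<close>

lemma continuous_seg: 
  assumes "continuous_on A f" "continuous_on A g" "continuous_on A h"
  shows "continuous_on A (\<lambda>x. seg (f x) (g x) (h x :: real))"
  unfolding seg_def 
  by (intro continuous_on_coordinatewise_then_product continuous_intros
      continuous_on_product_then_coordinatewise[OF assms(1)]
      continuous_on_product_then_coordinatewise[OF assms(2)] assms(3))

lemma seg_0 [simp]: "seg x y 0 = x" and seg_1 [simp]: "seg x y 1 = y"
  by (auto simp: seg_def)

lemma path_seg: "path (seg x y)"
  unfolding path_def using continuous_seg[of "{0..1}" "\<lambda>_. x" "\<lambda>_. y" "\<lambda>t. t"] by simp

lemma pathstart_seg [simp]: "pathstart (seg x y) = x"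
    and pathfinish_seg [simp]: "pathfinish (seg x y) = y"
  by (auto simp: pathstart_def pathfinish_def)

lemma path_edge_path: "path (edge_path C D)"
  by (auto simp: edge_path_def path_seg)

lemma pathstart_edge_path [simp]: "pathstart (edge_path C D) = cell_pt (Vertex C)"
  and pathfinish_edge_path [simp]: "pathfinish (edge_path C D) = cell_pt (Vertex D)"
  by (auto simp: edge_path_def)

text \<open>In the unit square, the side \<open>s = 0\<close> is homotopic to the union of the three other sides, and the
  image of these under \<open>(s, t) \<mapsto> seg (p t) z s\<close> depends only on the ends of \<open>p\<close>.\<close>

lemma homotopic_paths_in_cone:
  fixes p q :: "real \<Rightarrow> 'i \<Rightarrow> real"
  assumes p: "path_in K a b p" and q: "path_in K a b q"
    and cone: "\<And>x t. x \<in> K \<Longrightarrow> 0 \<le> t \<Longrightarrow> t \<le> 1 \<Longrightarrow> seg x z t \<in> S"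
  shows "homotopic_paths S p q"
proof -
  define l where
      "l = linepath (0,0) (1,0) +++ (linepath (1,0) (1,1) +++ linepath (1,1) (0::real,1::real))"
  define std where "std = seg a z +++ ((\<lambda>_. z) +++ reversepath (seg b z))"
  let ?Q = "{0..1::real} \<times> {0..1::real}"
  have sc: "simply_connected ?Q"
    by (intro convex_imp_simply_connected convex_Times convex_real_interval)
  have "homotopic_paths S r std" if r: "path_in K a b r" for r
  proof -
    define \<phi> where "\<phi> = (\<lambda>u. seg (r (snd u)) z (fst u))"
    have cont: "continuous_on ?Q \<phi>"
    proof -
      have "continuous_on ?Q (\<lambda>u. r (snd u))"
        by (rule continuous_on_compose2[of "{0..1}" r])
          (use r in \<open>auto simp: path_in_def path_def intro: continuous_on_snd\<close>)
      then show ?thesis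
        unfolding \<phi>_def
          by (intro continuous_seg continuous_on_const continuous_on_fst continuous_on_id)
    qed
    have img: "\<phi> \<in> ?Q \<rightarrow> S"
    proof
      fix u assume "u \<in> ?Q"
      then have "0 \<le> fst u" "fst u \<le> 1" "r (snd u) \<in> K"
        using r by (auto simp: path_in_def path_image_def)
      then show "\<phi> u \<in> S" unfolding \<phi>_def by (intro cone)
    qed
    have seg1: "path_image (linepath x y) \<subseteq> ?Q" if "x \<in> ?Q" "y \<in> ?Q" for x y :: "real \<times> real"
      using that closed_segment_subset[of x ?Q y] by (simp add: convex_Times)
    have "path_image l \<subseteq> ?Q"
      unfolding l_def by (intro subset_path_image_join seg1) auto
    moreover have "path_image (linepath (0,0) (0,1)) \<subseteq> ?Q"
      by (rule seg1) auto
    moreover have "path l" "pathstart l = (0,0)" "pathfinish l = (0,1)"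
      by (simp_all add: l_def)
    ultimately have "homotopic_paths ?Q (linepath (0,0) (0,1)) l"
      using sc unfolding simply_connected_eq_homotopic_paths
      by (metis path_linepath pathfinish_linepath pathstart_linepath)
    from homotopic_paths_continuous_image[OF this cont img]
    have "homotopic_paths S (\<phi> \<circ> linepath (0,0) (0,1)) (\<phi> \<circ> l)" .
    moreover have "\<phi> \<circ> linepath (0,0) (0,1) = r"
      by (auto simp: \<phi>_def linepath_def)
    moreover have "\<phi> \<circ> l = std"
    proof -
      have "\<phi> \<circ> linepath (0,0) (1,0) = seg a z" "\<phi> \<circ> linepath (1,0) (1,1) = (\<lambda>_. z)"
           "\<phi> \<circ> linepath (1,1) (0,1) = reversepath (seg b z)"
        using r by
          (auto simp: \<phi>_def linepath_def reversepath_def path_in_def pathstart_def pathfinish_def)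
      then show ?thesis by (simp add: l_def std_def path_compose_join)
    qed
    ultimately show ?thesis by simp
  qed
  from this[OF p] this[OF q] show ?thesis
    by (meson homotopic_paths_sym homotopic_paths_trans)
qed

section \<open>Sign vectors of regions\<close>

lemma normal_to_parallel:
  assumes "normal_to a H" "normal_to b H"
  obtains c where "c \<noteq> 0" "a = c *\<^sub>R b"
proof -
  \<comment> \<open>The component of \<open>a\<close> orthogonal to \<open>b\<close>. It lies in
    \<open>H\<close>, so it is orthogonal to \<open>a\<close> as well and must vanish.\<close>
  define u where "u = a - ((a \<bullet> b) / (b \<bullet> b)) *\<^sub>R b"
  have ne: "a \<noteq> 0" "b \<noteq> 0" using assms by (auto simp: normal_to_def)
  have H: "a \<bullet> x = 0 \<longleftrightarrow> b \<bullet> x = 0" for x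
    using assms by (auto simp: normal_to_def)
  have "b \<bullet> u = 0"
    using ne by (simp add: u_def inner_diff_right inner_commute)
  moreover have "a \<bullet> u = 0" using H calculation by blast
  ultimately have "u \<bullet> u = 0"
    by (simp add: u_def inner_diff_left)
  then have "a = ((a \<bullet> b) / (b \<bullet> b)) *\<^sub>R b" by (simp add: u_def)
  moreover from this have "(a \<bullet> b) / (b \<bullet> b) \<noteq> 0" using ne by auto
  ultimately show ?thesis using that by blast
qed

lemma normal_to_scaleR: "normal_to a H \<Longrightarrow> c \<noteq> 0 \<Longrightarrow> normal_to (c *\<^sub>R a) H"
  unfolding normal_to_def by simp

section \<open>Small perturbations and general position\<close>

lemma eventually_sgn_add_scaleR:
  fixes a x v :: "'a::euclidean_space"
  assumes "a \<bullet> x \<noteq> 0"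
  shows "eventually (\<lambda>e. sgn (a \<bullet> (x + e *\<^sub>R v)) = sgn (a \<bullet> x)) (at_right 0)"
proof -
  have lim: "((\<lambda>e. a \<bullet> (x + e *\<^sub>R v)) \<longlongrightarrow> a \<bullet> (x + 0 *\<^sub>R v)) (at_right 0)"
    by (intro tendsto_intros)
  show ?thesis
  proof (cases "a \<bullet> x > 0")
    case True
    then have "eventually (\<lambda>e. a \<bullet> (x + e *\<^sub>R v) > 0) (at_right 0)"
      using lim by (intro order_tendstoD(1)[OF lim]) auto
    then show ?thesis by eventually_elim (use True in simp)
  next
    case False
    then have "eventually (\<lambda>e. a \<bullet> (x + e *\<^sub>R v) < 0) (at_right 0)"
      using lim assms by (intro order_tendstoD(2)[OF lim]) auto
    then show ?thesis by eventually_elim (use False assms in simp)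
  qed
qed

text \<open>The bound \<open>e < 1\<close> serves the sweeps along segments, where the perturbed
  parameter must stay before the end of the segment.\<close>

lemma exists_perturbation:
  fixes x v :: "'a::euclidean_space"
  assumes "finite A" "\<And>a. a \<in> A \<Longrightarrow> f a \<bullet> x \<noteq> 0"
  shows "\<exists>e>0. e < 1 \<and> (\<forall>a\<in>A. sgn (f a \<bullet> (x + e *\<^sub>R v)) = sgn (f a \<bullet> x))"
proof -
  have "eventually (\<lambda>e. \<forall>a\<in>A. sgn (f a \<bullet> (x + e *\<^sub>R v)) = sgn (f a \<bullet> x)) (at_right 0)"
    using assms by (intro eventually_ball_finite ballI eventually_sgn_add_scaleR)
  moreover have "eventually (\<lambda>e::real. e \<in> {0<..<1}) (at_right 0)"
    by (rule eventually_at_right_real) simp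
  ultimately have
    "eventually (\<lambda>e. 0 < e \<and> e < 1 \<and> (\<forall>a\<in>A. sgn (f a \<bullet> (x + e *\<^sub>R v)) =
        sgn (f a \<bullet> x))) (at_right 0)"
    by eventually_elim simp
  then show ?thesis
    using eventually_happens'[of "at_right (0::real)"] by fastforce
qed

lemma eventually_add_scaleR_in_open:
  fixes x v :: "'a::euclidean_space"
  assumes "open U" "x \<in> U"
  shows "eventually (\<lambda>e. x + e *\<^sub>R v \<in> U) (at_right 0)"
proof -
  have "((\<lambda>e. x + e *\<^sub>R v) \<longlongrightarrow> x + 0 *\<^sub>R v) (at_right 0)"
    by (intro tendsto_intros)
  then show ?thesis using assms by (simp add: tendsto_def)
qed

lemma closure_ray:
  fixes x v :: "'a::euclidean_space"
  assumes "\<And>e. 0 < e \<Longrightarrow> x + e *\<^sub>R v \<in> S"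
  shows "x \<in> closure S"
proof -
  have "((\<lambda>e. x + e *\<^sub>R v) \<longlongrightarrow> x + 0 *\<^sub>R v) (at_right 0)"
    by (intro tendsto_intros)
  moreover have "eventually (\<lambda>e. x + e *\<^sub>R v \<in> closure S) (at_right 0)"
    using eventually_at_right_less[of "0::real"]
    by eventually_elim (use assms closure_subset[of S] in \<open>simp add: subset_eq\<close>)
  ultimately have "x + 0 *\<^sub>R v \<in> closure S"
    by (intro Lim_in_closed_set[OF closed_closure _ trivial_limit_at_right_real])
  then show ?thesis by simp
qed

text \<open>Leave the hyperplanes one at a time: a small move in a direction of \<open>S\<close>
  that is not orthogonal to \<open>w\<close> keeps the earlier products nonzero. It is applied to
  the whole space for start points of rays and to a hyperplane for walks along a shard.\<close>

lemma subspace_avoid_hyperplanes: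
  fixes y :: "'a::euclidean_space"
  assumes "subspace S" "open U" "y \<in> U \<inter> S" "finite W" "\<And>w. w \<in> W \<Longrightarrow> \<exists>s\<in>S. w \<bullet> s \<noteq> 0"
  shows "\<exists>x\<in>U \<inter> S. \<forall>w\<in>W. w \<bullet> x \<noteq> 0"
  using assms(4,5)
proof (induction W rule: finite_induct)
  case empty
  then show ?case using assms by auto
next
  case (insert w F)
  then obtain x where x: "x \<in> U \<inter> S" "\<forall>v\<in>F. v \<bullet> x \<noteq> 0" by auto
  obtain s where s: "s \<in> S" "w \<bullet> s \<noteq> 0" using insert.prems by auto
  show ?case
  proof (cases "w \<bullet> x = 0")
    case False
    then show ?thesis using x by auto
  next
    case True
    have "eventually (\<lambda>e. \<forall>v\<in>F. sgn (v \<bullet> (x + e *\<^sub>R s)) = sgn (v \<bullet> x)) (at_right 0)"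
      using insert.hyps x(2) by (intro eventually_ball_finite ballI eventually_sgn_add_scaleR) auto
    moreover have "eventually (\<lambda>e. x + e *\<^sub>R s \<in> U) (at_right 0)"
      using assms x by (intro eventually_add_scaleR_in_open) auto
    ultimately have "eventually (\<lambda>e. (\<forall>v\<in>insert w F. v \<bullet> (x + e *\<^sub>R s) \<noteq> 0) \<and> x + e *\<^sub>R s \<in> U) (at_right 0)"
      using eventually_at_right_less[of "0::real"]
    proof eventually_elim
      case (elim e)
      then show ?case using x(2) s(2) True by (auto simp: inner_add_right sgn_0_0)
    qed
    then obtain e where "\<forall>v\<in>insert w F. v \<bullet> (x + e *\<^sub>R s) \<noteq> 0" "x + e *\<^sub>R s \<in> U"
      using eventually_happens'[of "at_right (0::real)"] by auto
    moreover have "x + e *\<^sub>R s \<in> S"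
      using x s assms(1) by (auto intro: subspace_add subspace_scale)
    ultimately show ?thesis by blast
  qed
qed

lemma vanishing_on_hyperplane:
  fixes w n :: "'a::euclidean_space"
  assumes "\<And>s. n \<bullet> s = 0 \<Longrightarrow> w \<bullet> s = 0" "n \<noteq> 0"
  shows "w \<in> span {n}"
proof -
  define u where "u = w - ((w \<bullet> n) / (n \<bullet> n)) *\<^sub>R n"
  have "n \<bullet> u = 0" using assms(2) by (simp add: u_def inner_diff_right inner_commute)
  moreover from this have "w \<bullet> u = 0" by (rule assms(1))
  ultimately have "u \<bullet> u = 0" by (simp add: u_def inner_diff_left)
  then have "w = ((w \<bullet> n) / (n \<bullet> n)) *\<^sub>R n" by (simp add: u_def)
  then show ?thesis by (metis insertI1 span_base span_scale)
qed

lemma convex_comb_nonzero: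
  assumes "sgn a = sgn b" "b \<noteq> 0" "0 < t" "t < (1::real)"
  shows "(1 - t) * a + t * b \<noteq> 0"
proof (cases "b > 0")
  case True
  then have "a > 0" using assms(1) by (simp add: sgn_1_pos)
  then have "(1 - t) * a + t * b > 0" using True assms by (intro add_pos_pos mult_pos_pos) auto
  then show ?thesis by simp
next
  case False
  then have "b < 0" using assms(2) by simp
  then have "a < 0" using assms(1) by (simp add: sgn_1_neg)
  then have "(1 - t) * a + t * b < 0"
    using \<open>b < 0\<close> assms by (intro add_neg_neg mult_pos_neg) auto
  then show ?thesis by simp
qed

text \<open>The common engine of both sweeps. The assumption \<open>aff\<close> says that each
  \<open>\<phi> K\<close> is affine, interpolated from its values at \<open>s\<close> and
  \<open>1\<close>; each function in \<open>M\<close> changes sign, and the earliest zero is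
  taken.\<close>

lemma affine_first_zero:
  fixes \<phi> :: "'k \<Rightarrow> real \<Rightarrow> real"
  assumes M: "finite M" "M \<noteq> {}" and s: "s < 1"
    and aff: "\<And>K t. (1 - s) * \<phi> K t = (1 - t) * \<phi> K s + (t - s) * \<phi> K 1"
    and sgn: "\<And>K. K \<in> M \<Longrightarrow> \<phi> K s > 0" "\<And>K. K \<in> M \<Longrightarrow> \<phi> K 1 < 0"
  obtains t K0 where "s < t" "t < 1" "K0 \<in> M" "\<phi> K0 t = 0" "\<And>K. K \<in> M \<Longrightarrow> 0 \<le> \<phi> K t"
proof -
  \<comment> \<open>The unique zero of the affine function with the given values at \<open>s\<close>
    and \<open>1\<close>.\<close>
  define \<tau> where "\<tau> = (\<lambda>K. (\<phi> K s - s * \<phi> K 1) / (\<phi> K s - \<phi> K 1))"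
  have tau: "t \<le> \<tau> K \<longleftrightarrow> 0 \<le> \<phi> K t" "t = \<tau> K \<longleftrightarrow> \<phi> K t = 0" if K: "K \<in> M" for K t
  proof -
    have pos: "\<phi> K s - \<phi> K 1 > 0" using sgn[OF K] by simp
    have "t \<le> \<tau> K \<longleftrightarrow> 0 \<le> (1 - t) * \<phi> K s + (t - s) * \<phi> K 1"
      using pos by (simp add: \<tau>_def pos_le_divide_eq algebra_simps)
    then show "t \<le> \<tau> K \<longleftrightarrow> 0 \<le> \<phi> K t"
      using aff[where K=K and t=t] s by (metis diff_gt_0_iff_gt zero_le_mult_iff less_le not_le)
    have "t = \<tau> K \<longleftrightarrow> 0 = (1 - t) * \<phi> K s + (t - s) * \<phi> K 1"
      using pos by (simp add: \<tau>_def eq_divide_eq algebra_simps)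
    then show "t = \<tau> K \<longleftrightarrow> \<phi> K t = 0"
      using aff[where K=K and t=t] s by auto
  qed
  define t where "t = Min (\<tau> ` M)"
  have "t \<in> \<tau> ` M" unfolding t_def by (rule Min_in) (use M in auto)
  then obtain K0 where K0: "K0 \<in> M" "t = \<tau> K0" by auto
  have "s < \<tau> K0" "\<tau> K0 < 1"
    using tau[OF K0(1), of s] tau[OF K0(1), of 1] sgn[OF K0(1)] by (auto simp: less_le)
  moreover have "0 \<le> \<phi> K t" if "K \<in> M" for K
    using tau(1)[OF that, of t] M that by (simp add: t_def)
  ultimately show ?thesis using that[of t K0] K0 tau(2)[OF K0(1), of t] by simp
qed

lemma sgn_eqI: "s = 1 \<or> s = -1 \<Longrightarrow> 0 \<le> s * y \<Longrightarrow> y \<noteq> 0 \<Longrightarrow> sgn y = (s::real)"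
  by (auto simp: sgn_if)

section \<open>Half turns in the punctured plane\<close>

definition half_turn :: "complex \<Rightarrow> complex set" where
  "half_turn s = closed_segment s (s * \<i>) \<union> closed_segment (s * \<i>) (- s)"

lemma half_turn_start: "s \<in> half_turn s" and half_turn_end: "- s \<in> half_turn s"
  by (auto simp: half_turn_def)

lemma half_turn_nonzero:
  assumes "s = 1 \<or> s = -1"
  shows "0 \<notin> half_turn s"
proof -
  have "1 - u \<noteq> 0 \<or> u \<noteq> 0" for u :: real by auto
  then show ?thesis
    using assms by (auto simp: half_turn_def in_segment complex_eq_iff)
qed

text \<open>The set is star-shaped about its corner: both segments are convex and contain
  \<open>s * \<i>\<close>. So a cone with this apex over a part of the half turn still misses the
  origin.\<close>

lemma half_turn_cone:
  assumes "y \<in> half_turn s" "0 \<le> t" "t \<le> 1"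
  shows "(1 - t) *\<^sub>R y + t *\<^sub>R (s * \<i>) \<in> half_turn s"
proof -
  have "(1 - t) *\<^sub>R y + t *\<^sub>R (s * \<i>) \<in> S"
    if "convex S" "y \<in> S" "s * \<i> \<in> S" for S
    using convexD[OF that, of "1 - t" t] assms(2,3) by simp
  then show ?thesis
    using assms(1) unfolding half_turn_def by (metis Un_iff convex_closed_segment ends_in_segment)
qed

section \<open>Regions as sign vectors\<close>

definition nvec :: "'a::euclidean_space set \<Rightarrow> 'a" where
  "nvec H = (SOME a. normal_to a H)"

definition region_point :: "'a set \<Rightarrow> 'a" where
  "region_point C = (SOME x. x \<in> C)"

definition side :: "'a::euclidean_space set \<Rightarrow> 'a set \<Rightarrow> real" where
  "side C H = sgn (nvec H \<bullet> region_point C)"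

definition cell_of :: "'a::euclidean_space set set \<Rightarrow> 'a \<Rightarrow> 'a set" where
  "cell_of \<H> x = {y. \<forall>H\<in>\<H>. sgn (nvec H \<bullet> y) = sgn (nvec H \<bullet> x)}"

lemma convex_sgn_inner: "convex {y. sgn (a \<bullet> y) = (s::real)}"
proof -
  consider "s = 1" | "s = -1" | "s = 0" | "s \<notin> {1,-1,0}" by blast
  then show ?thesis
  proof cases
    case 1
    then have "{y. sgn (a \<bullet> y) = s} = {y. a \<bullet> y > 0}" by (auto simp: sgn_1_pos)
    then show ?thesis by (simp add: convex_halfspace_gt)
  next
    case 2
    then have "{y. sgn (a \<bullet> y) = s} = {y. a \<bullet> y < 0}" by (auto simp: sgn_1_neg)
    then show ?thesis by (simp add: convex_halfspace_lt)
  next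
    case 3
    then have "{y. sgn (a \<bullet> y) = s} = {y. a \<bullet> y = 0}" by (auto simp: sgn_0_0)
    then show ?thesis by (simp add: convex_hyperplane)
  next
    case 4
    then have "{y. sgn (a \<bullet> y) = s} = {}" by (auto simp: sgn_if split: if_splits)
    then show ?thesis by simp
  qed
qed

lemma sgn_inner_constant_on_connected:
  fixes a :: "'a::euclidean_space"
  assumes "connected S" "\<And>y. y \<in> S \<Longrightarrow> a \<bullet> y \<noteq> 0" "x \<in> S" "y \<in> S"
  shows "sgn (a \<bullet> y) = sgn (a \<bullet> x)"
proof -
  have "\<not> (a \<bullet> u < 0 \<and> 0 < a \<bullet> v)" if "u \<in> S" "v \<in> S" for u v
    using connected_ivt_hyperplane[OF assms(1) that, of a 0] assms(2) by force
  then show ?thesis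
    using assms(2)[OF assms(3)] assms(2)[OF assms(4)] assms(3,4)
    by (metis (no_types, opaque_lifting) linorder_neqE_linordered_idom sgn_neg sgn_pos)
qed

locale arrangement =
  fixes \<H> :: "'a::euclidean_space set set"
  assumes central: "central_arrangement \<H>"
begin

abbreviation all_regions ("\<R>") where "\<R> \<equiv> regions \<H>"

abbreviation "Inv \<equiv> sep \<H>"

lemma finite_arr [simp]: "finite \<H>"
  using central by (simp add: central_arrangement_def)

lemma normal_nvec: "H \<in> \<H> \<Longrightarrow> normal_to (nvec H) H"
  using central unfolding central_arrangement_def nvec_def by (metis someI_ex)

lemma nvec_nonzero [simp]: "H \<in> \<H> \<Longrightarrow> nvec H \<noteq> 0"
  using normal_nvec by (auto simp: normal_to_def)

lemma mem_hyperplane: "H \<in> \<H> \<Longrightarrow> x \<in> H \<longleftrightarrow> nvec H \<bullet> x = 0"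
  using normal_nvec[of H] unfolding normal_to_def by blast

lemma nvec_parallel:
  assumes "H \<in> \<H>" "K \<in> \<H>" "nvec H = c *\<^sub>R nvec K"
  shows "H = K"
proof -
  have "c \<noteq> 0" using assms nvec_nonzero[of H] by auto
  then show ?thesis using assms mem_hyperplane by auto
qed

text \<open>A sign class is convex, hence connected, which gives one inclusion. Signs are constant
  on a connected set that misses the hyperplanes, which gives the other.\<close>

lemma cell_of_region:
  assumes "\<And>H. H \<in> \<H> \<Longrightarrow> nvec H \<bullet> x \<noteq> 0"
  shows "cell_of \<H> x \<in> \<R>" "connected_component_set (UNIV - \<Union>\<H>) x = cell_of \<H> x"
proof -
  have x: "x \<in> UNIV - \<Union>\<H>"
    using assms mem_hyperplane by auto
  have cell: "cell_of \<H> x = (\<Inter>H\<in>\<H>. {y. sgn (nvec H \<bullet> y) = sgn (nvec H \<bullet> x)})"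
    by (auto simp: cell_of_def)
  have "convex (cell_of \<H> x)"
    unfolding cell by (intro convex_INT convex_sgn_inner)
  moreover have "cell_of \<H> x \<subseteq> UNIV - \<Union>\<H>"
    using assms by (auto simp: cell_of_def mem_hyperplane) (metis sgn_0_0 sgn_zero_iff)
  moreover have "x \<in> cell_of \<H> x" by (simp add: cell_of_def)
  ultimately have 1: "cell_of \<H> x \<subseteq> connected_component_set (UNIV - \<Union>\<H>) x"
    by (intro connected_component_maximal) (auto intro: convex_connected)
  have 2: "connected_component_set (UNIV - \<Union>\<H>) x \<subseteq> cell_of \<H> x"
  proof
    fix y assume y: "y \<in> connected_component_set (UNIV - \<Union>\<H>) x"
    have sub: "connected_component_set (UNIV - \<Union>\<H>) x \<subseteq> UNIV - \<Union>\<H>"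
      by (rule connected_component_subset)
    have "sgn (nvec H \<bullet> y) = sgn (nvec H \<bullet> x)" if "H \<in> \<H>" for H
      by (rule sgn_inner_constant_on_connected[of "connected_component_set (UNIV - \<Union>\<H>) x"])
        (use that x y sub mem_hyperplane in \<open>auto simp: connected_connected_component\<close>)
    then show "y \<in> cell_of \<H> x" by (simp add: cell_of_def)
  qed
  show eq: "connected_component_set (UNIV - \<Union>\<H>) x = cell_of \<H> x"
    using 1 2 by blast
  show "cell_of \<H> x \<in> \<R>"
    unfolding regions_def eq[symmetric] using x by (rule componentsI)
qed

lemma region_cell_of_point:
  assumes "C \<in> \<R>"
  shows "region_point C \<in> C" "C = cell_of \<H> (region_point C)" "H \<in> \<H> \<Longrightarrow> nvec H \<bullet> region_point C \<noteq> 0"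
proof -
  have "C \<noteq> {}" "C \<subseteq> UNIV - \<Union>\<H>"
    using assms in_components_nonempty in_components_subset unfolding regions_def by blast+
  then show "region_point C \<in> C" unfolding region_point_def by (metis ex_in_conv someI_ex)
  then show *: "H \<in> \<H> \<Longrightarrow> nvec H \<bullet> region_point C \<noteq> 0" for H
    using \<open>C \<subseteq> _\<close> mem_hyperplane by auto
  obtain x where "x \<in> UNIV - \<Union>\<H>" "C = connected_component_set (UNIV - \<Union>\<H>) x"
    using assms by (auto simp: regions_def components_def)
  then show "C = cell_of \<H> (region_point C)"
    using \<open>region_point C \<in> C\<close> cell_of_region(2)[OF *]
    by (metis connected_component_eq)
qed

lemma side_cases:
  assumes "C \<in> \<R>" "H \<in> \<H>"
  shows "side C H = 1 \<or> side C H = -1"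
  using region_cell_of_point(3)[OF assms] by (auto simp: side_def sgn_if)

lemma mem_region: "C \<in> \<R> \<Longrightarrow> x \<in> C \<longleftrightarrow> (\<forall>H\<in>\<H>. sgn (nvec H \<bullet> x) = side C H)"
  using region_cell_of_point(2)[of C] unfolding cell_of_def side_def by blast

lemma region_eqI:
  assumes "C \<in> \<R>" "D \<in> \<R>" "\<And>H. H \<in> \<H> \<Longrightarrow> side C H = side D H"
  shows "C = D"
  using assms by (auto simp: mem_region)

lemma cell_of:
  assumes "\<forall>H\<in>\<H>. nvec H \<bullet> x \<noteq> 0"
  shows "cell_of \<H> x \<in> \<R>" "H \<in> \<H> \<Longrightarrow> side (cell_of \<H> x) H = sgn (nvec H \<bullet> x)"
    "x \<in> cell_of \<H> x"
proof -
  show 1: "cell_of \<H> x \<in> \<R>" using cell_of_region assms by blast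
  show 2: "x \<in> cell_of \<H> x" by (simp add: cell_of_def)
  show "H \<in> \<H> \<Longrightarrow> side (cell_of \<H> x) H = sgn (nvec H \<bullet> x)"
    using 1 2 mem_region by auto
qed

text \<open>The definition of \<open>sep\<close> allows any normal; all of them are nonzero
  multiples of \<open>nvec H\<close>, so comparing signs for this one suffices.\<close>

lemma sep_eq:
  assumes "C \<in> \<R>" "D \<in> \<R>"
  shows "Inv C D = {H \<in> \<H>. side C H \<noteq> side D H}"
proof (intro Set.set_eqI iffI)
  fix H assume "H \<in> Inv C D"
  then obtain a where H: "H \<in> \<H>" and a: "normal_to a H" "\<forall>x\<in>C. a \<bullet> x < 0" "\<forall>x\<in>D. 0 < a \<bullet> x"
    by (auto simp: sep_def)
  obtain c where c: "c \<noteq> 0" "a = c *\<^sub>R nvec H"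
    using normal_to_parallel[OF a(1) normal_nvec[OF H]] by blast
  have "c * (nvec H \<bullet> region_point C) < 0" "0 < c * (nvec H \<bullet> region_point D)"
    using a c region_cell_of_point(1) assms by (auto simp: inner_scaleR_left)
  then have "side C H \<noteq> side D H"
    unfolding side_def by (auto simp: zero_less_mult_iff mult_less_0_iff)
  then show "H \<in> {H \<in> \<H>. side C H \<noteq> side D H}" using H by simp
next
  fix H assume *: "H \<in> {H \<in> \<H>. side C H \<noteq> side D H}"
  then have H: "H \<in> \<H>" and ne: "side C H \<noteq> side D H" by auto
  have 1: "sgn (nvec H \<bullet> x) = side C H" if "x \<in> C" for x using mem_region assms(1) H that by auto
  have 2: "sgn (nvec H \<bullet> x) = side D H" if "x \<in> D" for x using mem_region assms(2) H that by auto
  have "normal_to (side D H *\<^sub>R nvec H) H"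
    using side_cases[OF assms(2) H] by (intro normal_to_scaleR[OF normal_nvec[OF H]]) auto
  moreover have "\<forall>x\<in>C. (side D H *\<^sub>R nvec H) \<bullet> x < 0" "\<forall>x\<in>D. 0 < (side D H *\<^sub>R nvec H) \<bullet> x"
    using 1 2 side_cases[OF assms(1) H] side_cases[OF assms(2) H] ne
    by (auto simp: sgn_1_pos sgn_1_neg)
  ultimately show "H \<in> Inv C D"
    using H unfolding sep_def by blast
qed

lemma sep_subset: "Inv C D \<subseteq> \<H>"
  by (auto simp: sep_def)

lemma finite_sep [simp]: "finite (Inv C D)"
  using finite_subset[OF sep_subset] by simp

lemma sep_commute: "C \<in> \<R> \<Longrightarrow> D \<in> \<R> \<Longrightarrow> Inv C D = Inv D C"
  by (auto simp: sep_eq)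

text \<open>Separating sets add modulo two because a hyperplane has just two sides. Most
  computations of separating sets below are instances of this.\<close>

lemma sep_trans:
  assumes "C \<in> \<R>" "D \<in> \<R>" "E \<in> \<R>"
  shows "Inv C E = (Inv C D - Inv D E) \<union> (Inv D E - Inv C D)"
proof -
  have "side C H \<noteq> side E H \<longleftrightarrow> (side C H \<noteq> side D H) \<noteq> (side D H \<noteq> side E H)" if "H \<in> \<H>" for H
    using side_cases[OF assms(1) that] side_cases[OF assms(2) that] side_cases[OF assms(3) that] by auto
  then show ?thesis using assms by (auto simp: sep_eq)
qed

lemma sep_empty_iff: "C \<in> \<R> \<Longrightarrow> D \<in> \<R> \<Longrightarrow> Inv C D = {} \<longleftrightarrow> C = D"
  using region_eqI[of C D] by (auto simp: sep_eq)

lemma region_eqI_sep: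
  assumes "B \<in> \<R>" "C \<in> \<R>" "D \<in> \<R>" "Inv B C = Inv B D"
  shows "C = D"
proof -
  have "Inv C D = {}"
    using sep_trans[of C B D] assms sep_commute[of C B] by auto
  then show ?thesis using sep_empty_iff assms by auto
qed

lemma finite_regions: "finite \<R>"
proof -
  have "inj_on (\<lambda>C. Inv B C) \<R>" if "B \<in> \<R>" for B
    using region_eqI_sep[OF that] by (auto simp: inj_on_def)
  moreover have "(\<lambda>C. Inv B C) ` \<R> \<subseteq> Pow \<H>" for B
    using sep_subset by auto
  ultimately show ?thesis
    by (metis (no_types, lifting) finite_Pow_iff finite_arr finite_imageD finite_subset all_not_in_conv finite.emptyI)
qed

lemma region_open:
  assumes C: "C \<in> \<R>"
  shows "open C"
proof -
  have "C = (\<Inter>H\<in>\<H>. {x. (side C H *\<^sub>R nvec H) \<bullet> x > 0})"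
    using side_cases[OF C] by (fastforce simp: mem_region[OF C] sgn_1_pos sgn_1_neg)
  moreover have "open (\<Inter>H\<in>\<H>. {x. (side C H *\<^sub>R nvec H) \<bullet> x > 0})"
    by (intro open_INT ballI finite_arr open_halfspace_gt)
  ultimately show ?thesis by presburger
qed

lemma region_convex:
  assumes "C \<in> \<R>"
  shows "convex C"
proof -
  have "C = (\<Inter>H\<in>\<H>. {y. sgn (nvec H \<bullet> y) = side C H})"
    using mem_region[OF assms] by blast
  moreover have "convex (\<Inter>H\<in>\<H>. {y. sgn (nvec H \<bullet> y) = side C H})"
    by (intro convex_INT convex_sgn_inner)
  ultimately show ?thesis by presburger
qed

text \<open>For the converse, adding any positive multiple of a point of \<open>C\<close> turns the
  weak inequalities at \<open>x\<close> into strict ones, so \<open>x\<close> is a limit of points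
  of \<open>C\<close>.\<close>

lemma closure_region:
  assumes C: "C \<in> \<R>"
  shows "x \<in> closure C \<longleftrightarrow> (\<forall>H\<in>\<H>. 0 \<le> side C H * (nvec H \<bullet> x))"
proof
  let ?P = "\<Inter>H\<in>\<H>. {x. (side C H *\<^sub>R nvec H) \<bullet> x \<ge> 0}"
  assume x: "x \<in> closure C"
  have "C \<subseteq> ?P"
  proof
    fix y assume "y \<in> C"
    then have "side C H * (nvec H \<bullet> y) = \<bar>nvec H \<bullet> y\<bar>" if "H \<in> \<H>" for H
      using that C by (metis abs_sgn mem_region mult.commute)
    then show "y \<in> ?P" by simp
  qed
  then have "closure C \<subseteq> ?P"
    by (intro closure_minimal closed_INT ballI closed_halfspace_ge)
  then show "\<forall>H\<in>\<H>. 0 \<le> side C H * (nvec H \<bullet> x)" using x by auto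
next
  assume *: "\<forall>H\<in>\<H>. 0 \<le> side C H * (nvec H \<bullet> x)"
  have mem: "x + e *\<^sub>R region_point C \<in> C" if "0 < e" for e
  proof -
    have "sgn (nvec H \<bullet> (x + e *\<^sub>R region_point C)) = side C H" if H: "H \<in> \<H>" for H
    proof -
      have "0 < side C H * (nvec H \<bullet> region_point C)"
        using region_cell_of_point(3)[OF C H] by (simp add: side_def zero_less_mult_iff sgn_if)
      then have "0 < side C H * (nvec H \<bullet> (x + e *\<^sub>R region_point C))"
        using * H \<open>0 < e\<close> by (simp add: inner_add_right distrib_left add_nonneg_pos mult.left_commute[of _ e])
      then show ?thesis using side_cases[OF C H] by (auto simp: sgn_1_pos sgn_1_neg)
    qed
    then show ?thesis by (simp add: mem_region[OF C])
  qed
  show "x \<in> closure C" by (rule closure_ray[OF mem])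
qed

section \<open>Opposite regions\<close>

definition opp :: "'a set \<Rightarrow> 'a set" where
  "opp C = cell_of \<H> (- region_point C)"

lemma opp:
  assumes "C \<in> \<R>"
  shows "opp C \<in> \<R>" "H \<in> \<H> \<Longrightarrow> side (opp C) H = - side C H"
proof -
  have *: "\<forall>H\<in>\<H>. nvec H \<bullet> (- region_point C) \<noteq> 0"
    using region_cell_of_point(3)[OF assms] by simp
  show "opp C \<in> \<R>"
    unfolding opp_def by (rule cell_of(1)) (rule *)
  show "H \<in> \<H> \<Longrightarrow> side (opp C) H = - side C H"
    unfolding opp_def using cell_of(2)[of "- region_point C" H] * by (simp add: side_def sgn_minus)
qed

lemma sep_opp: "C \<in> \<R> \<Longrightarrow> Inv C (opp C) = \<H>"
  using opp[of C] side_cases[of C] by (fastforce simp: sep_eq)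

lemma sep_opp_left:
  assumes "C \<in> \<R>" "D \<in> \<R>"
  shows "Inv (opp C) D = \<H> - Inv C D"
  using sep_trans[of "opp C" C D] assms opp(1) sep_opp sep_commute[of C "opp C"] sep_subset[of C D] by auto

lemma sep_opp_right:
  assumes "C \<in> \<R>" "D \<in> \<R>"
  shows "Inv C (opp D) = \<H> - Inv C D"
  using sep_opp_left[of D C] assms opp(1) sep_commute by metis

lemma opposite_region_eq: "C \<in> \<R> \<Longrightarrow> opposite_region \<H> C = opp C"
  unfolding opposite_region_def
  by (rule the_equality) (use sep_opp opp(1) region_eqI_sep[of C] in \<open>simp, metis\<close>)

lemma exists_region_sep:
  assumes C: "C \<in> \<R>" and "A \<subseteq> \<H>"
    and y: "\<And>K. K \<in> \<H> \<Longrightarrow> sgn (nvec K \<bullet> y) = (if K \<in> A then - side C K else side C K)"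
  shows "\<exists>E\<in>\<R>. y \<in> E \<and> Inv C E = A"
proof -
  have nz: "\<forall>K\<in>\<H>. nvec K \<bullet> y \<noteq> 0"
  proof
    fix K assume "K \<in> \<H>"
    then show "nvec K \<bullet> y \<noteq> 0" using y[of K] side_cases[OF C, of K] by (auto split: if_splits)
  qed
  have "side C K \<noteq> side (cell_of \<H> y) K \<longleftrightarrow> K \<in> A" if "K \<in> \<H>" for K
    using y[OF that] cell_of(2)[OF nz that] side_cases[OF C that] by (auto split: if_splits)
  then have "Inv C (cell_of \<H> y) = A"
    using sep_eq[OF C cell_of(1)[OF nz]] \<open>A \<subseteq> \<H>\<close> by blast
  then show ?thesis using cell_of(1,3)[OF nz] by blast
qed

section \<open>Walls\<close>

text \<open>For a region \<open>C\<close>, these are the points in the relative interior of its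
  facet in \<open>H\<close>; the existence of one says that \<open>H\<close> is a wall of
  \<open>C\<close>.\<close>

definition facet_point :: "'a set \<Rightarrow> 'a set \<Rightarrow> 'a \<Rightarrow> bool" where
  "facet_point C H x \<longleftrightarrow> H \<in> \<H> \<and> nvec H \<bullet> x = 0 \<and> (\<forall>K\<in>\<H> - {H}. sgn (nvec K \<bullet> x) = side C K)"

lemma facet_point_nonzero:
  assumes "C \<in> \<R>" "facet_point C H x" "K \<in> \<H> - {H}"
  shows "nvec K \<bullet> x \<noteq> 0"
proof -
  have "sgn (nvec K \<bullet> x) = side C K" "K \<in> \<H>" using assms by (auto simp: facet_point_def)
  then show ?thesis using side_cases[OF assms(1), of K] by auto
qed

lemma region_across:
  assumes C: "C \<in> \<R>" and x: "facet_point C H x"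
  obtains E where "E \<in> \<R>" "Inv C E = {H}"
proof -
  have H: "H \<in> \<H>" "nvec H \<bullet> x = 0" using x by (auto simp: facet_point_def)
  define v where "v = - (side C H *\<^sub>R nvec H)"
  obtain e where e: "0 < e" "\<forall>K\<in>\<H>-{H}. sgn (nvec K \<bullet> (x + e *\<^sub>R v)) = sgn (nvec K \<bullet> x)"
    using exists_perturbation[of "\<H>-{H}" nvec x "v"] facet_point_nonzero[OF C x] finite_Diff[OF finite_arr, of "{H}"] by metis
  have s: "sgn (nvec K \<bullet> (x + e *\<^sub>R v)) = (if K = H then - side C K else side C K)" if "K \<in> \<H>" for K
  proof (cases "K = H")
    case True
    have "nvec H \<bullet> (x + e *\<^sub>R v) = - (e * side C H * (nvec H \<bullet> nvec H))"
      using H by (simp add: v_def inner_diff_right)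
    moreover have "nvec H \<bullet> nvec H > 0" using H nvec_nonzero by simp
    ultimately show ?thesis using True e side_cases[OF C H(1)]
      by (auto simp: sgn_mult)
  next
    case False
    then show ?thesis using e x that by (simp add: facet_point_def)
  qed
  then show ?thesis
    using exists_region_sep[OF C, of "{H}" "x + e *\<^sub>R v"] H that by auto
qed

lemma facet_point_between:
  assumes C: "C \<in> \<R>" and E: "E \<in> \<R>" and sep: "Inv C E = {H}"
  obtains x where "facet_point C H x" "facet_point E H x"
proof -
  have H: "H \<in> \<H>" using sep sep_subset[of C E] by auto
  have ne: "side C H \<noteq> side E H" and eq: "\<And>K. K \<in> \<H> \<Longrightarrow> K \<noteq> H \<Longrightarrow> side C K = side E K"
    using sep C E by (auto simp: sep_eq)
  define p where "p = nvec H \<bullet> region_point C" 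
  define q where "q = nvec H \<bullet> region_point E"
  have pq: "p * q < 0"
    using ne region_cell_of_point(3)[OF C H] region_cell_of_point(3)[OF E H]
    by (auto simp: side_def p_def q_def sgn_if mult_less_0_iff split: if_splits)
  \<comment> \<open>The products \<open>p\<close> and \<open>q\<close> have opposite signs, so these
    weights make \<open>\<bar>q\<bar> * p + \<bar>p\<bar> * q\<close> vanish. As they are positive,
    the signs shared by \<open>C\<close> and \<open>E\<close> survive.\<close>
  define x where "x = \<bar>q\<bar> *\<^sub>R region_point C + \<bar>p\<bar> *\<^sub>R region_point E"
  have pos: "\<bar>p\<bar> > 0" "\<bar>q\<bar> > 0" using pq by auto
  have "nvec H \<bullet> x = 0"
    using pq by (auto simp: x_def inner_add_right p_def[symmetric] q_def[symmetric] mult_less_0_iff)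
  moreover have "sgn (nvec K \<bullet> x) = side C K" if "K \<in> \<H> - {H}" for K
  proof -
    have "sgn (nvec K \<bullet> region_point C) = side C K" "sgn (nvec K \<bullet> region_point E) = side C K"
      using eq[of K] that by (auto simp: side_def)
    then show ?thesis
      using pos side_cases[OF C, of K] that
      by (auto simp: x_def inner_add_right sgn_1_pos sgn_1_neg add_pos_pos add_neg_neg mult_pos_neg)
  qed
  ultimately show ?thesis using that[of x] H eq by (auto simp: facet_point_def)
qed

text \<open>The ray \<open>c + r *\<^sub>R d\<close> with \<open>r \<ge> 0\<close> runs from \<open>c\<close> towards \<open>d\<close>, and meets \<open>H\<close> at
  \<open>r = rho d H \<bullet> c\<close>.  This parameter is linear in \<open>c\<close>.\<close>

definition rho :: "'a \<Rightarrow> 'a set \<Rightarrow> 'a" where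
  "rho d H = (-1 / (nvec H \<bullet> d)) *\<^sub>R nvec H"

context
  fixes C D :: "'a set" and d :: 'a
  assumes C: "C \<in> \<R>" and D: "D \<in> \<R>" and d: "d \<in> D"
begin

lemma nvec_d_nonzero: "K \<in> \<H> \<Longrightarrow> nvec K \<bullet> d \<noteq> 0"
  using d side_cases[OF D, of K] mem_region[OF D, of d] by force

lemma rho_inner_d: "K \<in> \<H> \<Longrightarrow> rho d K \<bullet> d = -1"
  using nvec_d_nonzero by (simp add: rho_def)

lemma nvec_ray:
  assumes "K \<in> \<H>"
  shows "nvec K \<bullet> (y + r *\<^sub>R d) = - (nvec K \<bullet> d) * (rho d K \<bullet> y - r)"
proof -
  have "nvec K \<bullet> d \<noteq> 0" using nvec_d_nonzero assms by simp
  then show ?thesis by (simp add: rho_def inner_add_right algebra_simps)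
qed

text \<open>Before the parameter \<open>rho d K \<bullet> y\<close> the ray is on the side of
  \<open>C\<close>, after it on the side of \<open>D\<close>, so comparing parameters decides all
  signs along the ray.\<close>

lemma sgn_ray_sep:
  assumes "K \<in> Inv C D"
  shows "sgn (nvec K \<bullet> (y + r *\<^sub>R d)) = side C K * sgn (rho d K \<bullet> y - r)"
proof -
  have K: "K \<in> \<H>" "side C K = - side D K"
    using assms C D side_cases[OF C] side_cases[OF D] by (fastforce simp: sep_eq)+
  then have "sgn (- (nvec K \<bullet> d)) = side C K"
    using d D by (simp add: mem_region sgn_minus)
  then show ?thesis unfolding nvec_ray[OF K(1)] sgn_mult by simp
qed

lemma sgn_ray_not_sep:
  assumes "K \<in> \<H> - Inv C D" "sgn (nvec K \<bullet> y) = side C K" "0 \<le> r"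
  shows "sgn (nvec K \<bullet> (y + r *\<^sub>R d)) = side C K"
proof -
  have "sgn (nvec K \<bullet> d) = side C K"
    using assms C D d by (auto simp: sep_eq mem_region)
  then show ?thesis
    using assms side_cases[OF C, of K] 
    by (auto simp: inner_add_right sgn_1_pos sgn_1_neg add_pos_nonneg add_neg_nonpos mult_nonneg_nonpos)
qed

lemma rho_pos:
  assumes "K \<in> Inv C D" "sgn (nvec K \<bullet> y) = side C K"
  shows "rho d K \<bullet> y > 0"
  using sgn_ray_sep[OF assms(1), of y 0] assms(2) side_cases[OF C, of K] sep_subset[of C D] assms(1)
  by (auto simp: sgn_1_pos)

lemma facet_point_first:
  assumes c: "c \<in> C" and H: "H \<in> Inv C D"
    and min: "\<And>K. K \<in> Inv C D \<Longrightarrow> K \<noteq> H \<Longrightarrow> rho d H \<bullet> c < rho d K \<bullet> c"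
  shows "facet_point C H (c + (rho d H \<bullet> c) *\<^sub>R d)"
proof -
  have sc: "sgn (nvec K \<bullet> c) = side C K" if "K \<in> \<H>" for K using c C that by (simp add: mem_region)
  have H': "H \<in> \<H>" using H sep_subset by blast
  have "nvec H \<bullet> (c + (rho d H \<bullet> c) *\<^sub>R d) = 0" using nvec_ray[OF H'] by simp
  moreover have "sgn (nvec K \<bullet> (c + (rho d H \<bullet> c) *\<^sub>R d)) = side C K" if "K \<in> \<H> - {H}" for K
  proof (cases "K \<in> Inv C D")
    case True
    then show ?thesis using sgn_ray_sep[OF True] min[OF True] that by simp
  next
    case False
    then show ?thesis using sgn_ray_not_sep[of K c] sc that rho_pos[OF H sc[OF H']] by simp
  qed
  ultimately show ?thesis using H' by (simp add: facet_point_def)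
qed

text \<open>Step back from \<open>x\<close> by \<open>e\<close> against \<open>d\<close>. Every
  parameter grows by \<open>e\<close>; at \<open>x\<close> that of \<open>H\<close> is zero and
  those of the other separating hyperplanes are positive, so \<open>H\<close> is met first.\<close>

lemma facet_point_first_converse:
  assumes H: "H \<in> Inv C D" and x: "facet_point C H x"
  obtains c where "c \<in> C" "\<And>K. K \<in> Inv C D \<Longrightarrow> K \<noteq> H \<Longrightarrow> rho d H \<bullet> c < rho d K \<bullet> c"
proof -
  have H': "H \<in> \<H>" "nvec H \<bullet> x = 0" using H x by (auto simp: facet_point_def)
  obtain e where e: "0 < e" "\<forall>K\<in>\<H>-{H}. sgn (nvec K \<bullet> (x + e *\<^sub>R (-d))) = sgn (nvec K \<bullet> x)"
    using exists_perturbation[of "\<H>-{H}" nvec x "-d"] facet_point_nonzero[OF C x] finite_Diff[OF finite_arr, of "{H}"] by metis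
  define c where "c = x + e *\<^sub>R (-d)"
  have rc: "rho d K \<bullet> c = rho d K \<bullet> x + e" if "K \<in> \<H>" for K
    using rho_inner_d[OF that] by (simp add: c_def inner_diff_right)
  have r0: "rho d H \<bullet> x = 0" using H' by (simp add: rho_def)
  have "sgn (nvec H \<bullet> c) = side C H"
    using sgn_ray_sep[OF H, of x "-e"] e r0 by (simp add: c_def)
  moreover have "sgn (nvec K \<bullet> c) = side C K" if "K \<in> \<H> - {H}" for K
    using e x that unfolding c_def by (simp add: facet_point_def)
  ultimately have "c \<in> C"
    by (auto simp: mem_region[OF C])
  moreover have "rho d H \<bullet> c < rho d K \<bullet> c" if "K \<in> Inv C D" "K \<noteq> H" for K
  proof -
    have "K \<in> \<H>" using that sep_subset by blast
    then show ?thesis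
      using rho_pos[OF that(1), of x] x that rc H' r0 by (auto simp: facet_point_def)
  qed
  ultimately show ?thesis using that by blast
qed

text \<open>Distinct hyperplanes have distinct linear forms \<open>rho d H\<close>, so a generic
  start point meets them at distinct parameters.\<close>

lemma rho_eq_imp_eq:
  assumes "H \<in> \<H>" "K \<in> \<H>" "rho d H = rho d K"
  shows "H = K"
proof -
  have nz: "nvec H \<bullet> d \<noteq> 0" using nvec_d_nonzero assms by simp
  have "nvec H = (- (nvec H \<bullet> d)) *\<^sub>R rho d H"
    using nz by (simp add: rho_def)
  also have "\<dots> = ((nvec H \<bullet> d) / (nvec K \<bullet> d)) *\<^sub>R nvec K"
    unfolding assms(3) by (simp add: rho_def)
  finally show ?thesis using nvec_parallel assms by blast
qed

end

lemma exists_facet_point: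
  assumes C: "C \<in> \<R>" and D: "D \<in> \<R>" and "C \<noteq> D"
  obtains H x where "H \<in> Inv C D" "facet_point C H x"
proof -
  define d where "d = region_point D"
  have d: "d \<in> D" using region_cell_of_point D by (simp add: d_def)
  \<comment> \<open>A start point that is not orthogonal to any of these differences has no ties
    between parameters, hence a unique first wall.\<close>
  define W where "W = (\<lambda>(H,K). rho d H - rho d K) ` (\<H> \<times> \<H>) - {0}"
  have "finite W" by (simp add: W_def)
  moreover have "w \<noteq> 0" if "w \<in> W" for w
    using that by (simp add: W_def)
  then have "\<exists>s\<in>UNIV. w \<bullet> s \<noteq> 0" if "w \<in> W" for w
    using that by (metis UNIV_I inner_eq_zero_iff)
  ultimately obtain c where c: "c \<in> C" "\<forall>w\<in>W. w \<bullet> c \<noteq> 0"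
    using subspace_avoid_hyperplanes[of UNIV C "region_point C" W] region_open[OF C] region_cell_of_point(1)[OF C] by auto
  have ne: "Inv C D \<noteq> {}" using sep_empty_iff assms by auto
  define H where "H = arg_min_on (\<lambda>H. rho d H \<bullet> c) (Inv C D)"
  have H: "H \<in> Inv C D" unfolding H_def by (rule arg_min_if_finite) (use ne in auto)
  have "rho d H \<bullet> c < rho d K \<bullet> c" if K: "K \<in> Inv C D" "K \<noteq> H" for K
  proof -
    have "rho d H \<bullet> c \<le> rho d K \<bullet> c"
      unfolding H_def by (rule arg_min_least) (use ne K in auto)
    moreover have "H \<in> \<H>" "K \<in> \<H>" using H K sep_subset by blast+
    then have "rho d H - rho d K \<in> W"
      using rho_eq_imp_eq[OF C D d, of H K] K by (auto simp: W_def)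
    then have "rho d H \<bullet> c \<noteq> rho d K \<bullet> c" using c by (force simp: inner_diff_left)
    ultimately show ?thesis by simp
  qed
  then show ?thesis using facet_point_first[OF C D d c(1) H] that H by blast
qed

section \<open>Flats of codimension two\<close>

definition at_point :: "'a \<Rightarrow> 'a set set" where
  "at_point x = {H \<in> \<H>. nvec H \<bullet> x = 0}"

text \<open>The members meet in codimension two. Two normals spanning the others is the form in
  which the generic sweeps deliver this; \<open>dim_flat\<close> recovers the dimension.\<close>

definition rank2 :: "'a set set \<Rightarrow> bool" where
  "rank2 A \<longleftrightarrow> A \<subseteq> \<H> \<and> (\<exists>H\<in>A. \<exists>K\<in>A. H \<noteq> K \<and> (\<forall>L\<in>A. nvec L \<in> span {nvec H, nvec K}))"

definition flat :: "'a set set \<Rightarrow> 'a set" where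
  "flat A = {y. \<forall>H\<in>A. nvec H \<bullet> y = 0}"

lemma subspace_flat: "subspace (flat A)"
  by (auto simp: flat_def subspace_def inner_add_right)

lemma dim_flat:
  assumes "rank2 A"
  shows "dim (flat A) + 2 = DIM('a)"
proof -
  obtain H K where HK: "H \<in> A" "K \<in> A" "H \<noteq> K" "\<And>L. L \<in> A \<Longrightarrow> nvec L \<in> span {nvec H, nvec K}" "A \<subseteq> \<H>"
    using assms unfolding rank2_def by blast
  let ?V = "span {nvec H, nvec K}"
  have in_arr: "H \<in> \<H>" "K \<in> \<H>" using HK by auto
  have "flat A = {y \<in> UNIV. \<forall>x\<in>?V. orthogonal x y}"
  proof (intro Set.set_eqI iffI)
    fix y assume "y \<in> flat A"
    then have "orthogonal y x" if "x \<in> {nvec H, nvec K}" for x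
      using HK that by (auto simp: flat_def orthogonal_def inner_commute)
    then show "y \<in> {y \<in> UNIV. \<forall>x\<in>?V. orthogonal x y}"
      using orthogonal_to_span orthogonal_commute by blast
  next
    fix y assume "y \<in> {y \<in> UNIV. \<forall>x\<in>?V. orthogonal x y}"
    then show "y \<in> flat A" using HK(4) by (auto simp: flat_def orthogonal_def)
  qed
  moreover have "dim ?V = 2"
  proof -
    have "nvec H \<notin> span {nvec K}"
      using nvec_parallel[OF in_arr] HK(3) by (auto simp: span_singleton)
    moreover have "nvec K \<noteq> 0" using in_arr by simp
    ultimately have "independent {nvec H, nvec K}" "nvec H \<noteq> nvec K"
      by (auto simp: independent_insert span_base)
    then show ?thesis by (simp add: dim_span dim_eq_card_independent)
  qed
  ultimately show ?thesis
    using dim_subspace_orthogonal_to_vectors[of ?V UNIV] by simp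
qed

text \<open>The faces used to glue 2-cells are defined by dimension and closure, while the sweeps
  produce points; this turns a point of a codimension two flat in \<open>closure C\<close> into such
  a face.\<close>

lemma codim2_face:
  assumes C: "C \<in> \<R>" and x: "x \<in> closure C" and rank: "rank2 (at_point x)"
  defines "F \<equiv> closure C \<inter> flat (at_point x)"
  shows "F \<in> codim2_faces \<H>" "{H \<in> \<H>. F \<subseteq> H} = at_point x"
proof -
  let ?A = "at_point x"
  have xF: "x \<in> F" using x by (auto simp: F_def flat_def at_point_def)
  \<comment> \<open>A sum of normals pointing into \<open>C\<close>: it is nonnegative on
    \<open>closure C\<close> and vanishes there exactly on the flat, so \<open>F\<close> is an
    exposed face.\<close>
  define a where "a = (\<Sum>H\<in>?A. side C H *\<^sub>R nvec H)"
  have A: "?A \<subseteq> \<H>" "finite ?A" by (auto simp: at_point_def)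
  have a: "a \<bullet> y = (\<Sum>H\<in>?A. side C H * (nvec H \<bullet> y))" for y
    by (simp add: a_def inner_sum_left)
  have nn: "0 \<le> side C H * (nvec H \<bullet> y)" if "y \<in> closure C" "H \<in> ?A" for H y
    using that A closure_region[OF C] by auto
  have F_eq: "F = closure C \<inter> {y. a \<bullet> y = 0}"
  proof -
    have "y \<in> flat ?A \<longleftrightarrow> a \<bullet> y = 0" if y: "y \<in> closure C" for y
    proof -
      have "a \<bullet> y = 0 \<longleftrightarrow> (\<forall>H\<in>?A. side C H * (nvec H \<bullet> y) = 0)"
        unfolding a using nn[OF y] A(2) by (intro sum_nonneg_eq_0_iff) auto
      also have "\<dots> \<longleftrightarrow> y \<in> flat ?A"
        using side_cases[OF C] A(1) by (fastforce simp: flat_def)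
      finally show ?thesis ..
    qed
    then show ?thesis by (auto simp: F_def)
  qed
  have face: "F face_of closure C"
    unfolding F_eq
    by (rule face_of_Int_supporting_hyperplane_ge)
      (use region_convex[OF C] nn in \<open>auto simp: a intro!: sum_nonneg convex_closure\<close>)
  \<comment> \<open>A neighbourhood of \<open>x\<close> in the flat that stays in
    \<open>closure C\<close>; it forces \<open>F\<close> to have the full dimension of the
    flat.\<close>
  define S where "S = flat ?A \<inter> (\<Inter>K\<in>\<H> - ?A. {y. (side C K *\<^sub>R nvec K) \<bullet> y > 0})"
  have "openin (top_of_set (flat ?A)) S"
    unfolding S_def by (intro openin_open_Int open_INT ballI open_halfspace_gt) auto
  moreover have xS: "x \<in> S"
  proof -
    have "0 < side C K * (nvec K \<bullet> x)" if "K \<in> \<H> - ?A" for K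
    proof -
      have "0 \<le> side C K * (nvec K \<bullet> x)" "nvec K \<bullet> x \<noteq> 0" "side C K \<noteq> 0"
        using that x closure_region[OF C] side_cases[OF C, of K] by (auto simp: at_point_def)
      then show ?thesis by (simp add: less_le)
    qed
    then show ?thesis using xF by (auto simp: S_def F_def)
  qed
  ultimately have "aff_dim S = aff_dim (flat ?A)"
    by (intro aff_dim_openin subspace_imp_affine subspace_flat) auto
  moreover have "S \<subseteq> F"
  proof
    fix y assume y: "y \<in> S"
    have "0 \<le> side C H * (nvec H \<bullet> y)" if "H \<in> \<H>" for H
      using y that by (cases "H \<in> ?A") (auto simp: S_def flat_def less_imp_le)
    then show "y \<in> F" using y by (auto simp: F_def S_def closure_region[OF C])
  qed
  moreover have "F \<subseteq> flat ?A" by (auto simp: F_def)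
  ultimately have "aff_dim F = aff_dim (flat ?A)"
    using aff_dim_subset by (metis order_antisym)
  also have "\<dots> = int DIM('a) - 2"
    using dim_flat[OF rank] by (simp add: aff_dim_subspace[OF subspace_flat])
  finally show "F \<in> codim2_faces \<H>"
    using face C xF unfolding codim2_faces_def by blast
  show "{H \<in> \<H>. F \<subseteq> H} = ?A"
    using xF mem_hyperplane by (auto simp: F_def flat_def at_point_def)
qed

text \<open>Start at \<open>x\<close> and move slightly along the negative of a point of
  \<open>C\<close>: hyperplanes through \<open>x\<close> see only the negated point, the others
  still see the sign of \<open>x\<close>.\<close>

lemma region_beyond:
  assumes C: "C \<in> \<R>" and x: "x \<in> closure C"
  obtains Q where "Q \<in> \<R>" "Inv C Q = at_point x"
proof -
  define c where "c = region_point C"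
  have c: "sgn (nvec H \<bullet> c) = side C H" for H by (simp add: c_def side_def)
  obtain e where e: "0 < e" "\<forall>K\<in>\<H> - at_point x. sgn (nvec K \<bullet> (x + e *\<^sub>R (-c))) = sgn (nvec K \<bullet> x)"
  proof -
    have "nvec K \<bullet> x \<noteq> 0" if "K \<in> \<H> - at_point x" for K
      using that by (simp add: at_point_def)
    then show ?thesis
      using exists_perturbation[of "\<H> - at_point x" nvec x "-c"] that finite_Diff[OF finite_arr] by metis
  qed
  have sx: "sgn (nvec K \<bullet> x) = side C K" if "K \<in> \<H> - at_point x" for K
  proof -
    have "0 \<le> side C K * (nvec K \<bullet> x)" "nvec K \<bullet> x \<noteq> 0"
      using that x closure_region[OF C] by (auto simp: at_point_def)
    then show ?thesis using sgn_eqI side_cases[OF C, of K] that by blast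
  qed
  have s: "sgn (nvec K \<bullet> (x + e *\<^sub>R (-c))) = (if K \<in> at_point x then - side C K else side C K)" if "K \<in> \<H>" for K
    using e c[of K] sx that by (auto simp: at_point_def inner_diff_right sgn_mult)
  then show ?thesis
    using exists_region_sep[OF C, of "at_point x" "x + e *\<^sub>R (-c)"] that by (auto simp: at_point_def)
qed

section \<open>Connectedness of the set of first walls\<close>

lemma rho_mem_span:
  assumes "nvec L \<bullet> d \<noteq> 0" "rho d L \<in> span {rho d H, rho d K}"
  shows "nvec L \<in> span {nvec H, nvec K}"
proof -
  have "nvec L = (- (nvec L \<bullet> d)) *\<^sub>R rho d L"
    using assms by (simp add: rho_def)
  moreover have "span {rho d H, rho d K} \<subseteq> span {nvec H, nvec K}"
  proof (intro span_minimal subspace_span subsetI)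
    fix u assume "u \<in> {rho d H, rho d K}"
    then obtain J where "J \<in> {H, K}" "u = rho d J" by blast
    then show "u \<in> span {nvec H, nvec K}" unfolding rho_def by (metis image_eqI image_insert image_empty span_base span_scale)
  qed
  ultimately show ?thesis using assms(2) by (metis span_scale subsetD)
qed

text \<open>Moving the start point \<open>c\<close> of the ray towards \<open>d\<close> inside \<open>C\<close> changes the first wall that the ray
  meets.  For a generic path of start points the change takes place at points that lie on a flat of
  codimension two, and the slopes of the minimising parameters decrease.\<close>

lemma first_wall_connected:
  assumes C: "C \<in> \<R>" and D: "D \<in> \<R>"
    and step: "\<And>E E' x H K. E \<in> \<R> \<Longrightarrow> E' \<in> \<R> \<Longrightarrow> Inv C E = {H} \<Longrightarrow> Inv C E' = {K} \<Longrightarrow>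
      x \<in> closure C \<Longrightarrow> rank2 (at_point x) \<Longrightarrow> at_point x \<subseteq> Inv C D \<Longrightarrow> H \<in> at_point x \<Longrightarrow>
      K \<in> at_point x \<Longrightarrow> f E = f E'"
    and E1: "E1 \<in> \<R>" "Inv C E1 = {H1}" "H1 \<in> Inv C D"
    and E2: "E2 \<in> \<R>" "Inv C E2 = {H2}" "H2 \<in> Inv C D"
  shows "f E1 = f E2"
proof -
  define d where "d = region_point D"
  have d: "d \<in> D" using region_cell_of_point D by (simp add: d_def)
  define r where "r = rho d"
  let ?S = "Inv C D"
  have S: "K \<in> \<H>" if "K \<in> ?S" for K using that sep_subset by blast
  have r_eq: "H = K" if "H \<in> \<H>" "K \<in> \<H>" "r H = r K" for H K
    using rho_eq_imp_eq[OF C D d] that by (simp add: r_def)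
  have across: "\<exists>E\<in>\<R>. Inv C E = {H}"
    if "c \<in> C" "H \<in> ?S" "\<And>K. K \<in> ?S \<Longrightarrow> K \<noteq> H \<Longrightarrow> r H \<bullet> c < r K \<bullet> c" for c H
    using region_across[OF C facet_point_first[OF C D d that[unfolded r_def]]] by metis
  obtain x1 where "facet_point C H1 x1" using facet_point_between[OF C E1(1,2)] .
  then obtain c1 where c1: "c1 \<in> C" "\<And>K. K \<in> ?S \<Longrightarrow> K \<noteq> H1 \<Longrightarrow> r H1 \<bullet> c1 < r K \<bullet> c1"
    using facet_point_first_converse[OF C D d E1(3)] unfolding r_def by metis
  obtain x2 where "facet_point C H2 x2" using facet_point_between[OF C E2(1,2)] .
  then obtain c0 where c0: "c0 \<in> C" "\<And>K. K \<in> ?S \<Longrightarrow> K \<noteq> H2 \<Longrightarrow> r H2 \<bullet> c0 < r K \<bullet> c0"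
    using facet_point_first_converse[OF C D d E2(3)] unfolding r_def by metis
  \<comment> \<open>All start points in \<open>C\<close> whose ray meets \<open>H2\<close> first.
    The set is open, so the generic point \<open>c2\<close> can replace \<open>c0\<close> without
    changing the first wall.\<close>
  define U where "U = C \<inter> (\<Inter>K\<in>?S - {H2}. {c. (r K - r H2) \<bullet> c > 0})"
  have "open U" unfolding U_def
    by (intro open_Int region_open[OF C] open_INT ballI open_halfspace_gt) auto
  moreover have "c0 \<in> U" using c0 by (auto simp: U_def inner_diff_left)
  \<comment> \<open>A combination of two differences of forms that is orthogonal to
    \<open>c1\<close>. A triple tie on the segment makes it orthogonal to \<open>c2\<close> too;
    genericity then forces it to be zero, so the differences are proportional.\<close>
  moreover define w where "w = (\<lambda>(H,K,L). ((r H - r L) \<bullet> c1) *\<^sub>R (r H - r K) - ((r H - r K) \<bullet> c1) *\<^sub>R (r H - r L))"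
  define W where "W = (\<lambda>(H,K). r H - r K) ` (\<H> \<times> \<H>) \<union> w ` (\<H> \<times> \<H> \<times> \<H>) - {0}"
  have "finite W" by (simp add: W_def)
  moreover have "w \<noteq> 0" if "w \<in> W" for w
    using that by (simp add: W_def)
  then have "\<exists>s\<in>UNIV. w \<bullet> s \<noteq> 0" if "w \<in> W" for w
    using that by (metis UNIV_I inner_eq_zero_iff)
  ultimately obtain c2 where c2: "c2 \<in> U" "\<forall>w\<in>W. w \<bullet> c2 \<noteq> 0"
    using subspace_avoid_hyperplanes[of UNIV U c0 W] by auto
  have c2C: "c2 \<in> C" using c2 by (simp add: U_def)
  have c2_min: "r H2 \<bullet> c2 < r K \<bullet> c2" if "K \<in> ?S" "K \<noteq> H2" for K
    using c2(1) that by (auto simp: U_def inner_diff_left)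
  have pair: "r H \<bullet> c2 \<noteq> r K \<bullet> c2" if "H \<in> \<H>" "K \<in> \<H>" "H \<noteq> K" for H K
  proof -
    have "r H - r K \<in> W" using r_eq[of H K] that by (auto simp: W_def)
    then show ?thesis using c2(2) by (force simp: inner_diff_left)
  qed
  define q where "q = (\<lambda>t::real. (1 - t) *\<^sub>R c1 + t *\<^sub>R c2)"
  have qC: "q t \<in> C" if "0 \<le> t" "t \<le> 1" for t
    using region_convex[OF C] c1(1) c2C that by (auto simp: q_def convex_alt)
  have triple: "nvec L \<in> span {nvec H, nvec K}"
    if HKL: "H \<in> \<H>" "K \<in> \<H>" "L \<in> \<H>" "H \<noteq> K" and t: "0 < t" "t \<le> 1"
      and tie: "r H \<bullet> q t = r K \<bullet> q t" "r H \<bullet> q t = r L \<bullet> q t" for H K L t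
  proof -
    define a where "a = r H - r K"
    define b where "b = r H - r L"
    define v where "v = (b \<bullet> c1) *\<^sub>R a - (a \<bullet> c1) *\<^sub>R b"
    have ab: "a \<bullet> q t = 0" "b \<bullet> q t = 0" using tie by (auto simp: a_def b_def inner_diff_left)
    have qt: "u \<bullet> q t = (1 - t) * (u \<bullet> c1) + t * (u \<bullet> c2)" for u
      by (simp add: q_def inner_add_right)
    have "v \<bullet> q t = 0" using ab by (simp add: v_def inner_diff_left)
    moreover have "v \<bullet> c1 = 0" by (simp add: v_def inner_diff_left)
    ultimately have "v \<bullet> c2 = 0" using qt[of v] t by simp
    moreover have "v = w (H, K, L)" by (simp add: v_def w_def a_def b_def)
    ultimately have "v = 0" using c2(2) HKL by (force simp: W_def)
    have ac2: "a \<bullet> c2 \<noteq> 0" using pair[OF HKL(1,2,4)] by (simp add: a_def inner_diff_left)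
    then have "a \<bullet> c1 \<noteq> 0" using ab(1) qt[of a] t by auto
    then have b: "b = ((b \<bullet> c1) / (a \<bullet> c1)) *\<^sub>R a"
      using \<open>v = 0\<close> by (simp add: v_def)
      (metis (no_types, opaque_lifting) divideR_right eq_iff_diff_eq_0 scaleR_scaleR divide_inverse mult.commute)
    have "r L = r H - ((b \<bullet> c1) / (a \<bullet> c1)) *\<^sub>R (r H - r K)"
      using b by (simp add: b_def[symmetric] a_def[symmetric]) (simp add: b_def)
    then have "r L \<in> span {r H, r K}"
      by (metis insertI1 insertI2 span_base span_diff span_scale)
    then show ?thesis
      using rho_mem_span[of L d H K] nvec_d_nonzero[OF C D d HKL(3)] by (simp add: r_def)
  qed
  have main: "f E = f E2"
    if "0 \<le> s" "s < 1" "H \<in> ?S" "E \<in> \<R>" "Inv C E = {H}"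
      "\<And>K. K \<in> ?S \<Longrightarrow> K \<noteq> H \<Longrightarrow> r H \<bullet> q s < r K \<bullet> q s" for s H E
    using that
  \<comment> \<open>The measure counts the hyperplanes that are ahead of \<open>H\<close> at the end
    point \<open>c2\<close>; only these can overtake \<open>H\<close>.\<close>
  proof (induction "card {K \<in> ?S. r K \<bullet> c2 < r H \<bullet> c2}" arbitrary: s H E rule: less_induct)
    case less
    note s = less.prems(1,2) and H = less.prems(3) and E = less.prems(4,5) and min = less.prems(6)
    show ?case
    proof (cases "H = H2")
      case True
      then have "E = E2" using region_eqI_sep[OF C] E E2 by auto
      then show ?thesis by simp
    next
      case False
      define M where "M = {K \<in> ?S. r K \<bullet> c2 < r H \<bullet> c2}"
      have M: "finite M" "H2 \<in> M" using c2_min[OF H False] E2(3) by (auto simp: M_def)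
      define \<phi> where "\<phi> = (\<lambda>K t. (r K - r H) \<bullet> q t)"
      have aff: "(1 - s) * \<phi> K t = (1 - t) * \<phi> K s + (t - s) * \<phi> K 1" for K t
        by (simp add: \<phi>_def q_def inner_add_right) algebra
      have ph1: "\<phi> K 1 = r K \<bullet> c2 - r H \<bullet> c2" for K by (simp add: \<phi>_def q_def inner_diff_left)
      have phs: "\<phi> K s > 0" if "K \<in> ?S" "K \<noteq> H" for K
        using min[OF that] by (simp add: \<phi>_def inner_diff_left)
      have M1: "\<phi> K s > 0" "\<phi> K 1 < 0" if "K \<in> M" for K
        using that phs[of K] ph1[of K] by (auto simp: M_def)
      have "M \<noteq> {}" using M(2) by blast
      \<comment> \<open>The first tie with \<open>H\<close>. Separating hyperplanes other than
        \<open>H\<close> and outside \<open>M\<close> stay strictly behind \<open>H\<close> up to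
        \<open>t\<close>, since they start behind and end no earlier.\<close>
      obtain t K0 where st: "s < t" "t < 1" and K0: "K0 \<in> M" "\<phi> K0 t = 0"
        and M_ge: "\<And>K. K \<in> M \<Longrightarrow> 0 \<le> \<phi> K t"
        using affine_first_zero[where \<phi> = \<phi>, OF M(1) \<open>M \<noteq> {}\<close> s(2) aff M1] by blast
      have t: "s < t" "t < 1" "0 < t" using st s by auto
      have ge: "0 \<le> \<phi> K t" if K: "K \<in> ?S" for K
      proof (cases "K = H \<or> K \<in> M")
        case True
        then show ?thesis using M_ge by (auto simp: \<phi>_def)
      next
        case F: False
        then have "0 \<le> (1 - t) * \<phi> K s + (t - s) * \<phi> K 1"
          using phs[OF K] ph1[of K] K t by (auto simp: M_def)
        then have "0 \<le> (1 - s) * \<phi> K t" using aff[of K t] by simp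
        then show ?thesis using s by (simp add: zero_le_mult_iff)
      qed
      define T where "T = {K \<in> ?S. \<phi> K t = 0}"
      have HT: "H \<in> T" "K0 \<in> T" using H K0 by (auto simp: T_def \<phi>_def M_def)
      have K0H: "K0 \<noteq> H" using K0(1) by (auto simp: M_def)
      \<comment> \<open>Of the hyperplanes tied at \<open>t\<close>, the one with the smallest
        parameter at \<open>c2\<close> takes the lead immediately after \<open>t\<close>.\<close>
      define H' where "H' = arg_min_on (\<lambda>K. r K \<bullet> c2) T"
      have T: "finite T" "T \<noteq> {}" using HT by (auto simp: T_def)
      have H'T: "H' \<in> T" unfolding H'_def by (rule arg_min_if_finite(1)[OF T])
      have H'_le: "r H' \<bullet> c2 \<le> r K \<bullet> c2" if "K \<in> T" for K
        unfolding H'_def by (rule arg_min_least[OF T that])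
      have TS: "T \<subseteq> ?S" by (auto simp: T_def)
      have H'_less: "r H' \<bullet> c2 < r K \<bullet> c2" if "K \<in> T" "K \<noteq> H'" for K
        using H'_le[OF that(1)] pair[of H' K] that H'T TS S by force
      have H'H: "r H' \<bullet> c2 < r H \<bullet> c2"
        using H'_le[OF HT(2)] K0 by (auto simp: M_def)
      define p where "p = q t"
      have pC: "p \<in> C" unfolding p_def using qC t s by auto
      have tie: "r K \<bullet> p = r H \<bullet> p" if "K \<in> T" for K
        using that by (simp add: T_def \<phi>_def p_def inner_diff_left)
      define x where "x = p + (r H \<bullet> p) *\<^sub>R d"
      have sgp: "sgn (nvec K \<bullet> p) = side C K" if "K \<in> \<H>" for K using pC C that by (simp add: mem_region)
      have rHp: "0 \<le> r H \<bullet> p"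
        using rho_pos[OF C D d H sgp] S[OF H] by (simp add: r_def)
      have sx1: "sgn (nvec K \<bullet> x) = side C K * sgn (\<phi> K t)" if "K \<in> ?S" for K
        using sgn_ray_sep[OF C D d that, of p "r H \<bullet> p"]
        by (simp add: x_def \<phi>_def p_def r_def inner_diff_left)
      have sx2: "sgn (nvec K \<bullet> x) = side C K" if "K \<in> \<H> - ?S" for K
        using sgn_ray_not_sep[OF C D d that _ rHp, of p] sgp that by (simp add: x_def)
      \<comment> \<open>The point \<open>x\<close> where the ray from \<open>q t\<close> leaves
        \<open>C\<close> lies on exactly the tied hyperplanes, so \<open>step\<close> applies at
        \<open>x\<close>.\<close>
      have at: "at_point x = T"
      proof -
        have "nvec K \<bullet> x = 0 \<longleftrightarrow> K \<in> T" if "K \<in> \<H>" for K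
        proof (cases "K \<in> ?S")
          case True
          then show ?thesis using sx1[OF True] side_cases[OF C that] 
            by (auto simp: T_def) (metis sgn_0_0 mult_zero_right sgn_zero)+
        next
          case False
          then show ?thesis using sx2[of K] side_cases[OF C that] that by (auto simp: T_def)
        qed
        then show ?thesis using TS S by (auto simp: at_point_def)
      qed
      have xcl: "x \<in> closure C"
        unfolding closure_region[OF C]
      proof
        fix K assume K: "K \<in> \<H>"
        have "sgn (nvec K \<bullet> x) = side C K \<or> nvec K \<bullet> x = 0"
          using sx1[of K] sx2[of K] ge[of K] K
          by (cases "K \<in> ?S") (auto simp: sgn_if split: if_splits)
        then show "0 \<le> side C K * (nvec K \<bullet> x)"
        proof
          assume "sgn (nvec K \<bullet> x) = side C K"
          then have "side C K * (nvec K \<bullet> x) = \<bar>nvec K \<bullet> x\<bar>" by (metis abs_sgn mult.commute)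
          then show ?thesis by simp
        qed simp
      qed
      have rank: "rank2 (at_point x)"
      proof -
        have "nvec L \<in> span {nvec H, nvec K0}" if L: "L \<in> T" for L
        proof (rule triple)
          show "H \<in> \<H>" "K0 \<in> \<H>" "L \<in> \<H>" using S TS HT L by blast+
          show "r H \<bullet> q t = r K0 \<bullet> q t" "r H \<bullet> q t = r L \<bullet> q t"
            using tie[OF HT(2)] tie[OF L] by (simp_all add: p_def)
        qed (use K0H t in simp_all)
        moreover have "T \<subseteq> \<H>" using TS S by blast
        ultimately show ?thesis
          unfolding at rank2_def using HT K0H by metis
      qed
      define g where "g = (\<lambda>K. r K - r H')"
      obtain e where e: "0 < e" "e < 1" "\<forall>K\<in>?S - T. sgn (g K \<bullet> (p + e *\<^sub>R (c2 - p))) = sgn (g K \<bullet> p)"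
      proof -
        have "g K \<bullet> p \<noteq> 0" if "K \<in> ?S - T" for K
          using that tie[OF H'T] by (auto simp: T_def \<phi>_def p_def g_def inner_diff_left)
        then show ?thesis
          using exists_perturbation[of "?S - T" g p "c2 - p"] that by (metis finite_Diff finite_sep)
      qed
      \<comment> \<open>A parameter just after \<open>t\<close>, small enough that the hyperplanes
        not tied at \<open>t\<close> remain behind \<open>H'\<close>.\<close>
      define s' where "s' = t + e * (1 - t)"
      have lt: "e * (1 - t) < 1 - t" using mult_strict_right_mono[of e 1 "1 - t"] e t by simp
      have gt: "0 < e * (1 - t)" using e t by simp
      have s': "0 \<le> s'" "s' < 1" unfolding s'_def using lt gt t by linarith+
      have qs': "q s' = p + e *\<^sub>R (c2 - p)"
        by (simp add: q_def p_def s'_def algebra_simps)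
      have min': "r H' \<bullet> q s' < r K \<bullet> q s'" if K: "K \<in> ?S" "K \<noteq> H'" for K
      proof (cases "K \<in> T")
        case True
        have "g K \<bullet> p = 0" using tie[OF True] tie[OF H'T] by (simp add: g_def inner_diff_left)
        then have "g K \<bullet> q s' = e * (g K \<bullet> c2)"
          unfolding qs' by (simp add: inner_add_right inner_diff_right)
        moreover have "g K \<bullet> c2 > 0" using H'_less[OF True K(2)] by (simp add: g_def inner_diff_left)
        ultimately have "g K \<bullet> q s' > 0" using e by simp
        then show ?thesis by (simp add: g_def inner_diff_left)
      next
        case False
        have "\<phi> K t > 0" using ge[OF K(1)] False K by (simp add: T_def less_le)
        then have "g K \<bullet> p > 0" using tie[OF H'T] by (simp add: g_def \<phi>_def p_def inner_diff_left)
        moreover have "sgn (g K \<bullet> q s') = sgn (g K \<bullet> p)" using e(3) False K(1) unfolding qs' by blast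
        ultimately have "g K \<bullet> q s' > 0" by (metis sgn_1_pos)
        then show ?thesis by (simp add: g_def inner_diff_left)
      qed
      have H'S: "H' \<in> ?S" using H'T TS by auto
      obtain E' where E': "E' \<in> \<R>" "Inv C E' = {H'}"
        using across[OF qC[of s'] H'S min'] s' by auto
      have "{K \<in> ?S. r K \<bullet> c2 < r H' \<bullet> c2} \<subset> {K \<in> ?S. r K \<bullet> c2 < r H \<bullet> c2}"
        using H'H H'S by auto
      then have "card {K \<in> ?S. r K \<bullet> c2 < r H' \<bullet> c2} < card {K \<in> ?S. r K \<bullet> c2 < r H \<bullet> c2}"
        by (intro psubset_card_mono) auto
      from less.hyps[OF this s' H'S E' min'] have "f E' = f E2" .
      moreover have "f E = f E'"
        by (rule step[OF E(1) E'(1) E(2) E'(2) xcl rank]) (use at TS HT H'T in auto)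
      ultimately show ?thesis by simp
    qed
  qed
  show ?thesis
    by (rule main[of 0 H1]) (use E1 c1(2) in \<open>auto simp: q_def\<close>)
qed


section \<open>Galleries\<close>

abbreviation path_class_mult (infixr "\<odot>" 70) where "X \<odot> Y \<equiv> path_mult (salvetti \<H>) X Y"

abbreviation vertex :: "'a set \<Rightarrow> 'a set cell \<Rightarrow> real" where "vertex C \<equiv> cell_pt (Vertex C)"

definition edge_class :: "'a set \<Rightarrow> 'a set \<Rightarrow> (real \<Rightarrow> 'a set cell \<Rightarrow> real) set" where
  "edge_class C D = homotopy_class (salvetti \<H>) (edge_path C D)"

definition gallery_class :: "'a set list \<Rightarrow> (real \<Rightarrow> 'a set cell \<Rightarrow> real) set" where
  "gallery_class g = homotopy_class (salvetti \<H>) (gallery_path g)"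

lemma adjacent_iff:
  "adjacent \<H> C D \<longleftrightarrow> C \<in> \<R> \<and> D \<in> \<R> \<and> (\<exists>H. Inv C D = {H})"
  by (auto simp: adjacent_def card_1_singleton_iff)

lemma vertex_in_salvetti: "C \<in> \<R> \<Longrightarrow> vertex C \<in> salvetti \<H>"
  by (auto simp: salvetti_def)

lemma path_in_edge: "adjacent \<H> C D \<Longrightarrow> path_in (salvetti \<H>) (vertex C) (vertex D) (edge_path C D)"
  unfolding path_in_def salvetti_def by (intro conjI path_edge_path pathstart_edge_path pathfinish_edge_path) blast

lemma gallery_Cons:
  "gallery \<H> C D (C' # E # g) \<longleftrightarrow> C' = C \<and> adjacent \<H> C E \<and> gallery \<H> E D (E # g)"
  by (auto simp: gallery_def adjacent_def)

lemma gallery_single: "gallery \<H> C D [E] \<longleftrightarrow> C \<in> \<R> \<and> E = C \<and> D = C"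
  by (auto simp: gallery_def)

lemma galleryD: "gallery \<H> C D g \<Longrightarrow> C \<in> \<R> \<and> D \<in> \<R> \<and> set g \<subseteq> \<R>"
  by (auto simp: gallery_def)

lemma gallery_cases:
  assumes "gallery \<H> C D g"
  obtains "g = [C]" "D = C" "C \<in> \<R>"
  | E g' H where "g = C # E # g'" "adjacent \<H> C E" "Inv C E = {H}" "gallery \<H> E D (E # g')"
proof (cases g)
  case Nil
  then show ?thesis using assms by (simp add: gallery_def)
next
  case (Cons C' g'')
  then show ?thesis
    using assms that by (cases g'') (auto simp: gallery_Cons gallery_single adjacent_iff)
qed

lemma path_in_gallery:
  "gallery \<H> C D g \<Longrightarrow> path_in (salvetti \<H>) (vertex C) (vertex D) (gallery_path g)"
proof (induction g arbitrary: C rule: gallery_path.induct)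
  case 1
  then show ?case by (simp add: gallery_def)
next
  case (2 E)
  then show ?case by (auto simp: gallery_single intro!: path_in_const vertex_in_salvetti)
next
  case (3 C' E g)
  then show ?case by (auto simp: gallery_Cons intro!: path_in_join path_in_edge)
qed

lemma gallery_class_Cons:
  assumes "adjacent \<H> C E" "gallery \<H> E D (E # g)"
  shows "gallery_class (C # E # g) = edge_class C E \<odot> gallery_class (E # g)"
  unfolding gallery_class_def edge_class_def
  using path_mult_class[OF path_in_edge[OF assms(1)] path_in_gallery[OF assms(2)]] by simp

lemma gallery_class_single_left:
  "gallery \<H> C D g \<Longrightarrow> gallery_class [C] \<odot> gallery_class g = gallery_class g"
  unfolding gallery_class_def using path_mult_const_left[OF path_in_gallery] by simp

lemma edge_class_single_right:
  "adjacent \<H> C D \<Longrightarrow> edge_class C D \<odot> gallery_class [D] = edge_class C D"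
  unfolding gallery_class_def edge_class_def using path_mult_const_right[OF path_in_edge] by simp

lemma gallery_append:
  assumes "gallery \<H> C D g" "gallery \<H> D E g'"
  shows "gallery \<H> C E (g @ tl g')" "gallery_class (g @ tl g') = gallery_class g \<odot> gallery_class g'"
proof -
  have "gallery \<H> C E (g @ tl g') \<and> gallery_class (g @ tl g') = gallery_class g \<odot> gallery_class g'"
    using assms(1)
  proof (induction g arbitrary: C rule: gallery_path.induct)
    case 1
    then show ?case by (simp add: gallery_def)
  next
    case (2 F)
    then have "F = D" "C = D" by (auto simp: gallery_single)
    moreover have "[D] @ tl g' = g'"
      using assms(2) by (cases g') (auto simp: gallery_def)
    ultimately show ?case
      using assms(2) gallery_class_single_left[OF assms(2)] by simp
  next
    case (3 C' F g)
    then have *: "C' = C" "adjacent \<H> C F" "gallery \<H> F D (F # g)" by (auto simp: gallery_Cons)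
    have IH: "gallery \<H> F E ((F # g) @ tl g')"
      "gallery_class ((F # g) @ tl g') = gallery_class (F # g) \<odot> gallery_class g'"
      using 3(1)[OF *(3)] by auto
    show ?case
      using * IH gallery_class_Cons[OF *(2), of E "g @ tl g'"] gallery_class_Cons[OF *(2,3)]
      by (simp add: gallery_Cons path_mult_assoc)
  qed
  then show "gallery \<H> C E (g @ tl g')" "gallery_class (g @ tl g') = gallery_class g \<odot> gallery_class g'"
    by auto
qed

lemma sep_across:
  assumes "C \<in> \<R>" "E \<in> \<R>" "D \<in> \<R>" "Inv C E = {H}"
  shows "H \<in> Inv C D \<Longrightarrow> Inv E D = Inv C D - {H}"
    "H \<notin> Inv C D \<Longrightarrow> Inv E D = insert H (Inv C D)"
  using sep_trans[of E C D] assms sep_commute[of C E] by auto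

lemma gallery_length:
  "gallery \<H> C D g \<Longrightarrow> card (Inv C D) \<le> length g - 1"
proof (induction g arbitrary: C rule: gallery_path.induct)
  case 1
  then show ?case by (simp add: gallery_def)
next
  case (2 E)
  then show ?case using sep_empty_iff by (auto simp: gallery_single)
next
  case (3 C' E g)
  then have *: "adjacent \<H> C E" "gallery \<H> E D (E # g)" by (auto simp: gallery_Cons)
  then obtain H where H: "Inv C E = {H}" "C \<in> \<R>" "E \<in> \<R>" by (auto simp: adjacent_iff)
  have D: "D \<in> \<R>" using galleryD *(2) by blast
  have "card (Inv C D) \<le> card (Inv E D) + 1"
    using sep_across[OF H(2,3) D H(1)] by (cases "H \<in> Inv C D") (auto simp: card_Diff_singleton_if)
  then show ?case using 3(1)[OF *(2)] by simp
qed

text \<open>If the first edge crossed a hyperplane that does not separate \<open>C\<close> from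
  \<open>D\<close>, the remaining distance would grow by one while the remaining length drops by
  one.\<close>

lemma minimal_gallery_cases:
  assumes "minimal_gallery \<H> C D g"
  obtains "g = [C]" "D = C" "C \<in> \<R>"
  | E g' H where "g = C # E # g'" "C \<in> \<R>" "E \<in> \<R>" "D \<in> \<R>" "adjacent \<H> C E"
      "Inv C E = {H}" "H \<in> Inv C D" "Inv E D = Inv C D - {H}" "minimal_gallery \<H> E D (E # g')"
proof -
  have g: "gallery \<H> C D g" and len: "length g - 1 = card (Inv C D)"
    using assms by (auto simp: minimal_gallery_def)
  from g show ?thesis
  proof (cases rule: gallery_cases)
    case 1
    then show ?thesis using that(1) by blast
  next
    case (2 E g' H)
    have r: "C \<in> \<R>" "E \<in> \<R>" "D \<in> \<R>"
      using 2 galleryD by (auto simp: adjacent_iff)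
    note len' = gallery_length[OF 2(4)]
    have H: "H \<in> Inv C D"
    proof (rule ccontr)
      assume "H \<notin> Inv C D"
      then have "card (Inv E D) = card (Inv C D) + 1"
        using sep_across[OF r 2(3)] by simp
      then show False using len len' 2(1) by simp
    qed
    have se: "Inv E D = Inv C D - {H}" using sep_across(1)[OF r 2(3) H] .
    then have "card (Inv E D) + 1 = card (Inv C D)"
      using card.remove[OF finite_sep H] by simp
    then have "minimal_gallery \<H> E D (E # g')"
      using 2 len by (simp add: minimal_gallery_def)
    then show ?thesis using that(2) 2 r H se by blast
  qed
qed

lemma minimal_gallery_Cons:
  assumes "C \<in> \<R>" "Inv C E = {H}" "H \<in> Inv C D" "minimal_gallery \<H> E D g"
  shows "minimal_gallery \<H> C D (C # g)"
proof -
  have g: "gallery \<H> E D g" "length g - 1 = card (Inv E D)"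
    using assms by (auto simp: minimal_gallery_def)
  obtain g' where g': "g = E # g'" using g(1) by (cases g) (auto simp: gallery_def)
  have r: "E \<in> \<R>" "D \<in> \<R>" using galleryD[OF g(1)] by auto
  have "card (Inv C D) = card (Inv E D) + 1"
    using sep_across(1)[OF assms(1) r assms(2,3)] card.remove[OF finite_sep assms(3)] by simp
  then show ?thesis
    using g g' assms r by (auto simp: minimal_gallery_def gallery_Cons adjacent_iff)
qed

lemma minimal_gallery_single: "C \<in> \<R> \<Longrightarrow> minimal_gallery \<H> C C [C]"
  using sep_empty_iff by (simp add: minimal_gallery_def gallery_single)

lemma exists_minimal_gallery:
  assumes "C \<in> \<R>" "D \<in> \<R>"
  shows "\<exists>g. minimal_gallery \<H> C D g"
  using assms
proof (induction "card (Inv C D)" arbitrary: C rule: less_induct)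
  case less
  show ?case
  proof (cases "C = D")
    case True
    then show ?thesis using minimal_gallery_single less.prems by blast
  next
    case False
    obtain H x where H: "H \<in> Inv C D" "facet_point C H x"
      using exists_facet_point[OF less.prems False] .
    obtain E where E: "E \<in> \<R>" "Inv C E = {H}"
      using region_across[OF less.prems(1) H(2)] .
    have "card (Inv E D) < card (Inv C D)"
      using sep_across(1)[OF less.prems(1) E(1) less.prems(2) E(2) H(1)] H(1)
      by (metis card_Diff1_less finite_sep)
    then show ?thesis
      using less.hyps[OF _ E(1) less.prems(2)] minimal_gallery_Cons[OF less.prems(1) E(2) H(1)] by blast
  qed
qed

lemma minimal_gallery_gal:
  "C \<in> \<R> \<Longrightarrow> D \<in> \<R> \<Longrightarrow> minimal_gallery \<H> C D (gal \<H> C D)"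
  unfolding gal_def using exists_minimal_gallery by (rule someI_ex)

text \<open>A minimal gallery never leaves the common side of a hyperplane that does not separate
  its ends. This keeps galleries around a face at that face, and keeps the image under
  \<open>circle_map\<close> constant.\<close>

lemma minimal_gallery_sep_subset:
  assumes "minimal_gallery \<H> C D g" "E \<in> set g"
  shows "Inv C E \<subseteq> Inv C D"
proof -
  have "Inv C E \<subseteq> Inv C D" if "minimal_gallery \<H> C D g" "E \<in> set g" for g E
    using that
  proof (induction "length g" arbitrary: g C rule: less_induct)
    case less
    from less.prems(1) show ?case
    proof (cases rule: minimal_gallery_cases)
      case 1
      then show ?thesis using less.prems sep_empty_iff by auto
    next
      case (2 F g' H)
      show ?thesis
      proof (cases "E = C")
        case True
        then show ?thesis using 2 sep_empty_iff[of C C] by simp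
      next
        case False
        have E: "E \<in> set (F # g')" using False 2(1) less.prems(2) by auto
        have Er: "E \<in> \<R>"
          using less.prems galleryD[of C D g] unfolding minimal_gallery_def by blast
        have "Inv F E \<subseteq> Inv F D"
          using less.hyps[OF _ 2(9) E] 2(1) by simp
        then show ?thesis using sep_trans[OF 2(2,3) Er] 2 by auto
      qed
    qed
  qed
  then show ?thesis using assms by blast
qed

lemma minimal_gallery_append:
  assumes g: "minimal_gallery \<H> C D g" and g': "minimal_gallery \<H> D E g'" and "Inv C D \<inter> Inv D E = {}"
  shows "minimal_gallery \<H> C E (g @ tl g')"
proof -
  have G: "gallery \<H> C D g" "gallery \<H> D E g'" using g g' by (auto simp: minimal_gallery_def)
  have r: "C \<in> \<R>" "D \<in> \<R>" "E \<in> \<R>" using G galleryD by auto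
  have "Inv C E = Inv C D \<union> Inv D E" using sep_trans[OF r] assms(3) by blast
  then have "card (Inv C E) = card (Inv C D) + card (Inv D E)"
    using assms(3) by (simp add: card_Un_disjoint)
  moreover have "length g \<ge> 1" "length g' \<ge> 1" using G by (auto simp: gallery_def Suc_le_eq)
  ultimately show ?thesis
    using gallery_append(1)[OF G] g g' by (auto simp: minimal_gallery_def)
qed

section \<open>Minimal galleries with the same ends are homotopic\<close>

text \<open>Such galleries cross only hyperplanes containing \<open>F\<close>, so every region
  visited has \<open>F\<close> in its closure. Both galleries thus lie in the base of the cone that
  is the 2-cell.\<close>

lemma two_cell_galleries_homotopic:
  assumes C: "C \<in> \<R>" and F: "F \<in> codim2_faces \<H>" "F \<subseteq> closure C"
    and Q: "Q \<in> \<R>" "Inv C Q = {H \<in> \<H>. F \<subseteq> H}"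
    and g: "minimal_gallery \<H> C Q g" and g': "minimal_gallery \<H> C Q g'"
  shows "gallery_class g = gallery_class g'"
proof -
  have opp: "opposite_about \<H> F C = Q"
    unfolding opposite_about_def by (rule the_equality) (use Q region_eqI_sep[OF C] in auto)
  have mem: "h \<in> two_cell_galleries \<H> C F" if h: "minimal_gallery \<H> C Q h" for h
  proof -
    have "F \<subseteq> closure D" if D: "D \<in> set h" for D
    proof
      fix x assume x: "x \<in> F"
      have Dr: "D \<in> \<R>" using h D galleryD by (auto simp: minimal_gallery_def)
      have "0 \<le> side D H * (nvec H \<bullet> x)" if H: "H \<in> \<H>" for H
      proof (cases "H \<in> Inv C D")
        case True
        then have "F \<subseteq> H" using minimal_gallery_sep_subset[OF h D] Q(2) by auto
        then show ?thesis using x mem_hyperplane[OF H] by auto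
      next
        case False
        then have "side D H = side C H" using sep_eq[OF C Dr] H by auto
        then show ?thesis using F(2) x H closure_region[OF C] by auto
      qed
      then show "x \<in> closure D" using closure_region[OF Dr] by blast
    qed
    then show ?thesis using h opp by (simp add: two_cell_galleries_def)
  qed
  let ?K = "\<Union>h\<in>two_cell_galleries \<H> C F. path_image (gallery_path h)"
  have in_K: "path_in ?K (vertex C) (vertex Q) (gallery_path h)" if "minimal_gallery \<H> C Q h" for h
    using path_in_gallery[of C Q h] mem[OF that] that by (auto simp: path_in_def minimal_gallery_def)
  have "seg x (cell_pt (Two_cell C F)) t \<in> salvetti \<H>" if "x \<in> ?K" "0 \<le> t" "t \<le> 1" for x t
  proof -
    have "seg x (cell_pt (Two_cell C F)) t \<in> two_cell \<H> C F"
      using that unfolding two_cell_def by blast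
    then show ?thesis using C F unfolding salvetti_def by blast
  qed
  from homotopic_paths_in_cone[OF in_K[OF g] in_K[OF g'] this]
  have "homotopic_paths (salvetti \<H>) (gallery_path g) (gallery_path g')" .
  moreover have "path_in (salvetti \<H>) (vertex C) (vertex Q) (gallery_path g)"
    using g by (auto simp: minimal_gallery_def intro: path_in_gallery)
  ultimately show ?thesis
    unfolding gallery_class_def using homotopy_class_eq_iff by blast
qed

text \<open>By induction on the distance, the class depends only on the first step. Two first steps
  are compared by \<open>first_wall_connected\<close>, which reduces to two walls at a common flat
  of codimension two.\<close>

theorem minimal_galleries_homotopic:
  assumes "minimal_gallery \<H> C D g" "minimal_gallery \<H> C D g'"
  shows "gallery_class g = gallery_class g'"
  using assms
proof (induction "card (Inv C D)" arbitrary: C g g' rule: less_induct)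
  case less
  define G where "G = (\<lambda>E. gallery_class (gal \<H> E D))"
  from less.prems(1) show ?case
  proof (cases rule: minimal_gallery_cases)
    case 1
    from less.prems(2) show ?thesis
      using 1 sep_empty_iff[of C C] by (cases rule: minimal_gallery_cases) auto
  next
    case (2 E1 g1 H1)
    note one = this
    from less.prems(2) show ?thesis
    proof (cases rule: minimal_gallery_cases)
      case 1
      then show ?thesis using one sep_empty_iff[of C C] by auto
    next
      case (2 E2 g2 H2)
      note two = this
      have C: "C \<in> \<R>" and D: "D \<in> \<R>" using one by auto
      have IH: "gallery_class h = G E"
        if "H \<in> Inv C D" "Inv E D = Inv C D - {H}" "minimal_gallery \<H> E D h" for E h H
      proof -
        have "card (Inv E D) < card (Inv C D)"
          using that(1,2) by (metis card_Diff1_less finite_sep)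
        moreover have "E \<in> \<R>"
          using that(3) galleryD unfolding minimal_gallery_def by blast
        then have "minimal_gallery \<H> E D (gal \<H> E D)"
          using D by (rule minimal_gallery_gal)
        ultimately show ?thesis unfolding G_def using less.hyps that(3) by blast
      qed
      have eq: "gallery_class (C # E # h) = edge_class C E \<odot> G E"
        if "adjacent \<H> C E" "H \<in> Inv C D" "Inv E D = Inv C D - {H}" "minimal_gallery \<H> E D (E # h)" for E h H
        using gallery_class_Cons[OF that(1), of D h] that IH[OF that(2-4)] by (auto simp: minimal_gallery_def)
      have "edge_class C E1 \<odot> G E1 = edge_class C E2 \<odot> G E2"
      \<comment> \<open>The invariant \<open>f E\<close> is the class of a minimal gallery that
        begins with the step to \<open>E\<close>; the induction hypothesis makes the choice of its
        continuation immaterial.\<close>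
      proof (rule first_wall_connected[OF C D, where f = "\<lambda>E. edge_class C E \<odot> G E"])
        fix E E' x H K
        assume E: "E \<in> \<R>" "E' \<in> \<R>" "Inv C E = {H}" "Inv C E' = {K}"
          and x: "x \<in> closure C" "rank2 (at_point x)" "at_point x \<subseteq> Inv C D" "H \<in> at_point x" "K \<in> at_point x"
        define F where "F = closure C \<inter> flat (at_point x)"
        have F: "F \<in> codim2_faces \<H>" "{H \<in> \<H>. F \<subseteq> H} = at_point x" "F \<subseteq> closure C"
          using codim2_face[OF C x(1,2)] by (auto simp: F_def)
        \<comment> \<open>The region opposite \<open>C\<close> about the flat. As all hyperplanes
          through \<open>x\<close> separate \<open>C\<close> from \<open>D\<close>, both galleries
          can be routed through \<open>Q\<close>, and they differ only around one 2-cell.\<close>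
        obtain Q where Q: "Q \<in> \<R>" "Inv C Q = at_point x"
          using region_beyond[OF C x(1)] .
        have split: "edge_class C E \<odot> G E = gallery_class (C # gal \<H> E Q) \<odot> gallery_class (gal \<H> Q D)
            \<and> minimal_gallery \<H> C Q (C # gal \<H> E Q)"
          if E: "E \<in> \<R>" "Inv C E = {H}" "H \<in> at_point x" for E H
        proof -
          have g1: "minimal_gallery \<H> E Q (gal \<H> E Q)" "minimal_gallery \<H> Q D (gal \<H> Q D)"
            using minimal_gallery_gal E Q D by auto
          have EQ: "Inv E Q = at_point x - {H}"
            using sep_across(1)[OF C E(1) Q(1) E(2)] E Q by simp
          have ED: "Inv E D = Inv C D - {H}"
            using sep_across(1)[OF C E(1) D E(2)] E x by blast
          have "Inv Q D = Inv C D - at_point x"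
            using sep_trans[OF Q(1) C D] sep_commute[OF C Q(1)] Q(2) x(3) by auto
          then have "Inv E Q \<inter> Inv Q D = {}" using EQ by auto
          from minimal_gallery_append[OF g1 this]
          have "G E = gallery_class (gal \<H> E Q @ tl (gal \<H> Q D))"
            using IH[OF _ ED] E(3) x(3) by (metis subsetD)
          also have "\<dots> = gallery_class (gal \<H> E Q) \<odot> gallery_class (gal \<H> Q D)"
            using gallery_append(2) g1 by (auto simp: minimal_gallery_def)
          finally have GE: "G E = gallery_class (gal \<H> E Q) \<odot> gallery_class (gal \<H> Q D)" .
          obtain h where h: "gal \<H> E Q = E # h"
            using g1(1) by (cases "gal \<H> E Q") (auto simp: minimal_gallery_def gallery_def)
          have "gallery_class (C # gal \<H> E Q) = edge_class C E \<odot> gallery_class (gal \<H> E Q)"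
            using gallery_class_Cons[of C E Q h] g1(1) E C h by (auto simp: adjacent_iff minimal_gallery_def)
          then show ?thesis
            using GE minimal_gallery_Cons[OF C E(2) _ g1(1)] Q(2) E(3) by (simp add: path_mult_assoc)
        qed
        have "gallery_class (C # gal \<H> E Q) = gallery_class (C # gal \<H> E' Q)"
          using two_cell_galleries_homotopic[OF C F(1,3) Q(1)] Q(2) F(2) split[OF E(1,3) x(4)] split[OF E(2,4) x(5)]
          by auto
        then show "edge_class C E \<odot> G E = edge_class C E' \<odot> G E'"
          using split[OF E(1,3) x(4)] split[OF E(2,4) x(5)] by simp
      next
        show "E1 \<in> \<R>" "Inv C E1 = {H1}" "H1 \<in> Inv C D" using one(3,6,7) .
        show "E2 \<in> \<R>" "Inv C E2 = {H2}" "H2 \<in> Inv C D" using two(3,6,7) .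
      qed
      then show ?thesis
        using eq[OF one(5,7-9)] eq[OF two(5,7-9)] one(1) two(1) by simp
    qed
  qed
qed

section \<open>Loops of edges\<close>

definition gal_class :: "'a set \<Rightarrow> 'a set \<Rightarrow> (real \<Rightarrow> 'a set cell \<Rightarrow> real) set" where
  "gal_class C D = gallery_class (gal \<H> C D)"

definition gal_inv :: "'a set \<Rightarrow> 'a set \<Rightarrow> (real \<Rightarrow> 'a set cell \<Rightarrow> real) set" where
  "gal_inv C D = homotopy_class (salvetti \<H>) (reversepath (gallery_path (gal \<H> C D)))"

lemma path_in_gal:
  "C \<in> \<R> \<Longrightarrow> D \<in> \<R> \<Longrightarrow> path_in (salvetti \<H>) (vertex C) (vertex D) (gallery_path (gal \<H> C D))"
  using minimal_gallery_gal path_in_gallery by (auto simp: minimal_gallery_def)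

lemma gal_class_eq:
  assumes "minimal_gallery \<H> C D g"
  shows "gallery_class g = gal_class C D"
proof -
  have "C \<in> \<R>" "D \<in> \<R>" using assms galleryD by (auto simp: minimal_gallery_def)
  then show ?thesis
    unfolding gal_class_def using minimal_galleries_homotopic assms minimal_gallery_gal by blast
qed

text \<open>Disjoint separating sets make the concatenation minimal. Together with the cancellation
  of \<open>gal_inv\<close>, this supplies the relations for all loops below.\<close>

lemma gal_class_trans:
  assumes "C \<in> \<R>" "D \<in> \<R>" "E \<in> \<R>" "Inv C D \<inter> Inv D E = {}"
  shows "gal_class C E = gal_class C D \<odot> gal_class D E"
proof -
  have m: "minimal_gallery \<H> C D (gal \<H> C D)" "minimal_gallery \<H> D E (gal \<H> D E)"
    using minimal_gallery_gal assms by auto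
  have "gal_class C E = gallery_class (gal \<H> C D @ tl (gal \<H> D E))"
    using gal_class_eq[OF minimal_gallery_append[OF m assms(4)]] by simp
  also have "\<dots> = gal_class C D \<odot> gal_class D E"
    unfolding gal_class_def using gallery_append(2) m by (auto simp: minimal_gallery_def)
  finally show ?thesis .
qed

lemma gal_class_refl: "C \<in> \<R> \<Longrightarrow> gal_class C C = gallery_class [C]"
  using gal_class_eq[OF minimal_gallery_single] by simp

lemma gal_class_adjacent:
  assumes "C \<in> \<R>" "D \<in> \<R>" "Inv C D = {H}"
  shows "gal_class C D = edge_class C D"
proof -
  have adj: "adjacent \<H> C D" using assms by (auto simp: adjacent_iff)
  have "minimal_gallery \<H> C D [C, D]"
    using assms minimal_gallery_Cons[OF assms(1,3) _ minimal_gallery_single] by auto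
  from gal_class_eq[OF this] have "gal_class C D = edge_class C D \<odot> gallery_class [D]"
    using gallery_class_Cons[OF adj, of D "[]"] assms by (simp add: gallery_single)
  then show ?thesis using edge_class_single_right[OF adj] by simp
qed

lemma gal_class_unit:
  assumes "C \<in> \<R>" "D \<in> \<R>"
  shows "gallery_class [C] \<odot> gal_class C D = gal_class C D"
    "gal_class C D \<odot> gallery_class [D] = gal_class C D"
    "gal_inv C D \<odot> gallery_class [C] = gal_inv C D"
  unfolding gal_class_def gallery_class_def gal_inv_def
  using path_mult_const_left[OF path_in_gal[OF assms]] path_mult_const_right[OF path_in_gal[OF assms]]
    path_mult_const_right[OF path_in_reversepath[OF path_in_gal[OF assms]]]
  by simp_all

lemma gal_inv:
  assumes "C \<in> \<R>" "D \<in> \<R>"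
  shows "gal_class C D \<odot> gal_inv C D = gallery_class [C]"
    "gal_inv C D \<odot> gal_class C D = gallery_class [D]"
  unfolding gal_class_def gallery_class_def gal_inv_def
  using path_mult_reverse_right[OF path_in_gal[OF assms]] path_mult_reverse_left[OF path_in_gal[OF assms]]
  by simp_all

lemma path_in_edge_loop:
  assumes "B \<in> \<R>" "adjacent \<H> C' C"
  shows "path_in (salvetti \<H>) (vertex B) (vertex B)
    (gallery_path (gal \<H> B C') +++ edge_path C' C +++ edge_path C C' +++ reversepath (gallery_path (gal \<H> B C')))"
proof -
  have "adjacent \<H> C C'" "C' \<in> \<R>" using assms(2) sep_commute by (auto simp: adjacent_iff)
  then show ?thesis
    using path_in_gal[OF assms(1), of C'] path_in_edge assms(2)
    by (blast intro: path_in_join path_in_reversepath)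
qed

lemma edge_loop_eq:
  assumes "B \<in> \<R>" "adjacent \<H> C' C"
  shows "edge_loop \<H> B C' C = gal_class B C' \<odot> edge_class C' C \<odot> edge_class C C' \<odot> gal_inv B C'"
proof -
  have a: "adjacent \<H> C C'" "C' \<in> \<R>" using assms(2) sep_commute by (auto simp: adjacent_iff)
  note p = path_in_gal[OF assms(1) a(2)] path_in_edge[OF assms(2)] path_in_edge[OF a(1)]
    path_in_reversepath[OF path_in_gal[OF assms(1) a(2)]]
  show ?thesis
    unfolding edge_loop_def gal_class_def gallery_class_def edge_class_def gal_inv_def
    using path_mult_class[OF p(3,4)] path_mult_class[OF p(2) path_in_join[OF p(3,4)]]
      path_mult_class[OF p(1) path_in_join[OF p(2) path_in_join[OF p(3,4)]]] by simp
qed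

text \<open>With \<open>y = gal(C', D')\<close>, \<open>y' = gal(C, D)\<close>, \<open>e\<close> the edge from \<open>C'\<close> to \<open>C\<close> and \<open>f\<close> the edge from
  \<open>D'\<close> to \<open>D\<close>, both \<open>y f = e y'\<close> and \<open>y' f* = e* y\<close> are equalities of minimal galleries.\<close>

lemma edge_class_slide:
  assumes r: "C' \<in> \<R>" "C \<in> \<R>" "D' \<in> \<R>" "D \<in> \<R>"
    and H: "Inv C' C = {H}" "Inv D' D = {H}" "H \<notin> Inv C' D'"
  shows "edge_class C' C \<odot> edge_class C C' \<odot> gal_class C' D'
       = gal_class C' D' \<odot> edge_class D' D \<odot> edge_class D D'"
proof -
  have H': "Inv C C' = {H}" "Inv D D' = {H}" using H r sep_commute by auto
  have CD': "Inv C D' = insert H (Inv C' D')" using sep_trans[OF r(2,1,3)] H' H by auto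
  have CD: "Inv C D = Inv C' D'" using sep_trans[OF r(2,3,4)] CD' H by auto
  have 1: "gal_class C' D = gal_class C' D' \<odot> edge_class D' D"
    using gal_class_trans[OF r(1,3,4)] gal_class_adjacent[OF r(3,4) H(2)] H by simp
  have 2: "gal_class C' D = edge_class C' C \<odot> gal_class C D"
    using gal_class_trans[OF r(1,2,4)] gal_class_adjacent[OF r(1,2) H(1)] H CD by simp
  have 3: "gal_class C D' = gal_class C D \<odot> edge_class D D'"
    using gal_class_trans[OF r(2,4,3)] gal_class_adjacent[OF r(4,3) H'(2)] H H' CD by simp
  have 4: "gal_class C D' = edge_class C C' \<odot> gal_class C' D'"
    using gal_class_trans[OF r(2,1,3)] gal_class_adjacent[OF r(2,1) H'(1)] H H' by simp
  show ?thesis using 1 2 3 4 by (metis path_mult_assoc)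
qed

lemma edge_loop_eq_slide:
  assumes r: "B \<in> \<R>" "C' \<in> \<R>" "C \<in> \<R>" "D' \<in> \<R>" "D \<in> \<R>"
    and H: "Inv C' C = {H}" "Inv D' D = {H}" "H \<notin> Inv C' D'"
    and B: "Inv B C' \<inter> Inv C' D' = {}"
  shows "edge_loop \<H> B C' C = edge_loop \<H> B D' D"
proof -
  have adj: "adjacent \<H> C' C" "adjacent \<H> D' D" using r H by (auto simp: adjacent_iff)
  have tr: "gal_class B D' = gal_class B C' \<odot> gal_class C' D'" by (rule gal_class_trans[OF r(1,2,4) B])
  \<comment> \<open>The loops are compared after right multiplication by
    \<open>gal_class B D'\<close>, which cancels the inverse gallery at the end of the loop and
    exposes the slide from \<open>C'\<close> to \<open>D'\<close>; \<open>gal_inv B D'\<close>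
    undoes it.\<close>
  have "edge_loop \<H> B C' C \<odot> gal_class B D'
      = gal_class B C' \<odot> edge_class C' C \<odot> edge_class C C' \<odot> (gal_inv B C' \<odot> gal_class B C') \<odot> gal_class C' D'"
    by (simp add: edge_loop_eq[OF r(1) adj(1)] tr path_mult_assoc)
  also have "\<dots> = gal_class B C' \<odot> edge_class C' C \<odot> edge_class C C' \<odot> gal_class C' D'"
    by (simp add: gal_inv r gal_class_unit)
  also have "\<dots> = gal_class B D' \<odot> edge_class D' D \<odot> edge_class D D'"
    using edge_class_slide[OF r(2-) H] by (simp add: tr path_mult_assoc)
  finally have "(edge_loop \<H> B C' C \<odot> gal_class B D') \<odot> gal_inv B D'
      = (gal_class B D' \<odot> edge_class D' D \<odot> edge_class D D') \<odot> gal_inv B D'"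
    by (rule arg_cong)
  then have "edge_loop \<H> B C' C \<odot> gal_class B D' \<odot> gal_inv B D'
      = gal_class B D' \<odot> edge_class D' D \<odot> edge_class D D' \<odot> gal_inv B D'"
    by (simp only: path_mult_assoc)
  moreover have "edge_loop \<H> B C' C \<odot> gal_class B D' \<odot> gal_inv B D' = edge_loop \<H> B C' C"
    using gal_class_unit(3)[OF r(1,2)]
    by (simp add: gal_inv r edge_loop_eq[OF r(1) adj(1)] path_mult_assoc)
  ultimately show ?thesis by (simp add: edge_loop_eq[OF r(1) adj(2)])
qed

section \<open>Shards\<close>

lemma exists_facet_pair:
  assumes H: "H \<in> \<H>" and B: "B \<in> \<R>"
    and x: "nvec H \<bullet> x = 0" "\<And>K. K \<in> \<H> - {H} \<Longrightarrow> nvec K \<bullet> x \<noteq> 0"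
  obtains C' C where "C' \<in> \<R>" "C \<in> \<R>" "Inv C' C = {H}" "H \<notin> Inv B C'" "facet_point C' H x"
proof -
  \<comment> \<open>Pushes \<open>x\<close> off \<open>H\<close> to the side of \<open>B\<close>, so
    that the edge found here crosses \<open>H\<close> away from \<open>B\<close>.\<close>
  define v where "v = side B H *\<^sub>R nvec H"
  obtain e where e: "0 < e" "\<forall>K\<in>\<H>-{H}. sgn (nvec K \<bullet> (x + e *\<^sub>R v)) = sgn (nvec K \<bullet> x)"
    using exists_perturbation[of "\<H>-{H}" nvec x v] x(2) finite_Diff[OF finite_arr, of "{H}"] by metis
  have "nvec H \<bullet> (x + e *\<^sub>R v) = e * (nvec H \<bullet> nvec H) * side B H" using x by (simp add: v_def inner_add_right)
  moreover have "e * (nvec H \<bullet> nvec H) > 0" using e H by simp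
  ultimately have sH: "sgn (nvec H \<bullet> (x + e *\<^sub>R v)) = side B H"
    using side_cases[OF B H] by (metis sgn_mult sgn_pos mult_1 sgn_one sgn_minus)
  have nz: "\<forall>K\<in>\<H>. nvec K \<bullet> (x + e *\<^sub>R v) \<noteq> 0"
  proof
    fix K assume "K \<in> \<H>"
    show "nvec K \<bullet> (x + e *\<^sub>R v) \<noteq> 0"
    proof (cases "K = H")
      case True
      then show ?thesis using sH side_cases[OF B H] by auto
    next
      case False
      then show ?thesis using e(2) x(2)[of K] \<open>K \<in> \<H>\<close> by (metis Diff_iff sgn_zero_iff singletonD)
    qed
  qed
  define C' where "C' = cell_of \<H> (x + e *\<^sub>R v)"
  have C': "C' \<in> \<R>" unfolding C'_def using cell_of(1)[OF nz] .
  have "facet_point C' H x"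
    unfolding facet_point_def C'_def using H x e cell_of(2)[OF nz] by auto
  moreover obtain C where "C \<in> \<R>" "Inv C' C = {H}"
    using region_across[OF C' calculation] .
  moreover have "H \<notin> Inv B C'"
    using sep_eq[OF B C'] cell_of(2)[OF nz H] sH by (simp add: C'_def)
  ultimately show ?thesis using that C' by blast
qed

section \<open>Basic hyperplanes of subarrangements\<close>

lemma arrangement_subset:
  assumes "A \<subseteq> \<H>"
  shows "arrangement A"
proof
  show "central_arrangement A"
    using central finite_subset[OF assms] assms unfolding central_arrangement_def by blast
qed

lemma aff_dim_hyperplane_arr:
  assumes "H \<in> \<H>"
  shows "aff_dim H = int DIM('a) - 1"
proof -
  have "H = {x. nvec H \<bullet> x = 0}" using mem_hyperplane[OF assms] by blast
  then have "aff_dim H = aff_dim {x. nvec H \<bullet> x = 0}" by (rule arg_cong)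
  then show ?thesis using assms DIM_positive[where 'a='a] by (simp add: of_nat_diff Suc_leI)
qed

lemma exists_basic:
  assumes A: "A \<subseteq> \<H>" "A \<noteq> {}" and B: "B \<in> \<R>"
  shows "\<exists>K. basic A B K"
proof -
  interpret A: arrangement A by (rule arrangement_subset[OF A(1)])
  have nz: "\<forall>K\<in>A. nvec K \<bullet> region_point B \<noteq> 0" using region_cell_of_point(3)[OF B] A by auto
  define R where "R = cell_of A (region_point B)"
  have R: "R \<in> regions A" unfolding R_def by (rule A.cell_of(1)[OF nz])
  have BR: "B \<subseteq> R" using region_cell_of_point(2)[OF B] A by (auto simp: R_def cell_of_def)
  \<comment> \<open>As \<open>A\<close> is nonempty, \<open>R\<close> differs from its opposite
    region in \<open>A\<close>, and therefore has a wall.\<close>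
  have "sep A R (A.opp R) = A" using A.sep_opp[OF R] .
  then have "R \<noteq> A.opp R" using A.sep_empty_iff[OF R A.opp(1)[OF R]] A by auto
  then obtain K x where x: "A.facet_point R K x"
    using A.exists_facet_point[OF R A.opp(1)[OF R]] by blast
  then have K: "K \<in> A" by (simp add: A.facet_point_def)
  have Keq: "K = {y. nvec K \<bullet> y = 0}" using A.mem_hyperplane[OF K] by blast
  \<comment> \<open>A relatively open part of \<open>K\<close> inside the frontier of
    \<open>R\<close>, so the frontier meets \<open>K\<close> in full dimension, as
    \<open>basic\<close> demands.\<close>
  define S where "S = K \<inter> (\<Inter>L\<in>A - {K}. {y. (side R L *\<^sub>R nvec L) \<bullet> y > 0})"
  have "openin (top_of_set K) S"
    unfolding S_def by (intro openin_open_Int open_INT ballI open_halfspace_gt) auto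
  moreover have "x \<in> S"
  proof -
    have "0 < side R L * (nvec L \<bullet> x)" if "L \<in> A - {K}" for L
    proof -
      have "sgn (nvec L \<bullet> x) = side R L" using x that unfolding A.facet_point_def by blast
      then show ?thesis using that A.side_cases[OF R, of L] by (auto simp: sgn_1_pos sgn_1_neg)
    qed
    then show ?thesis using x K A.mem_hyperplane by (auto simp: S_def A.facet_point_def)
  qed
  moreover have "affine K" by (subst Keq) (rule affine_hyperplane)
  ultimately have "aff_dim S = aff_dim K"
    by (intro aff_dim_openin) auto
  moreover have "S \<subseteq> K \<inter> frontier R"
  proof
    fix y assume y: "y \<in> S"
    then have yK: "y \<in> K" "nvec K \<bullet> y = 0" using A.mem_hyperplane[OF K] by (auto simp: S_def)
    have "0 \<le> side R L * (nvec L \<bullet> y)" if "L \<in> A" for L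
      using y yK that by (cases "L = K") (auto simp: S_def less_imp_le)
    then have "y \<in> closure R" by (simp add: A.closure_region[OF R])
    moreover have "y \<notin> R"
      using yK A.mem_region[OF R, of y] A.side_cases[OF R K] K by force
    ultimately show "y \<in> K \<inter> frontier R"
      using yK A.region_open[OF R] by (simp add: frontier_def interior_open)
  qed
  ultimately have "aff_dim (K \<inter> frontier R) = aff_dim K"
    by (metis aff_dim_subset inf_le1 order_antisym)
  then have "basic A B K"
    unfolding basic_def using K R BR A.aff_dim_hyperplane_arr[OF K] by auto
  then show ?thesis ..
qed

text \<open>A rank 2 arrangement has two half-hyperplanes over each of its members, and the basic member is
  adjacent to the base region along one of them.\<close>

lemma basic_side:
  assumes A: "A \<subseteq> \<H>" "rank2 A" and B: "B \<in> \<R>" and H: "basic A B H"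
    and K0: "K0 \<in> A" "\<And>L. L \<in> A \<Longrightarrow> nvec L \<in> span {nvec H, nvec K0}"
    and v: "nvec H \<bullet> v = 0" "\<And>K. K \<in> A - {H} \<Longrightarrow> nvec K \<bullet> v \<noteq> 0" "K0 \<noteq> H"
  shows "(\<forall>K\<in>A-{H}. sgn (nvec K \<bullet> v) = side B K) \<or> (\<forall>K\<in>A-{H}. sgn (nvec K \<bullet> v) = - side B K)"
proof -
  interpret A: arrangement A by (rule arrangement_subset[OF A(1)])
  obtain R where HA: "H \<in> A" and R: "R \<in> regions A" "B \<subseteq> R" and dimR: "aff_dim (H \<inter> frontier R) = int DIM('a) - 1"
    using H by (auto simp: basic_def)
  have sgR: "side R K = side B K" if "K \<in> A" for K
    using A.mem_region[OF R(1), of "region_point B"] region_cell_of_point(1)[OF B] R(2) that by (auto simp: side_def)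
  \<comment> \<open>The facet has codimension one and the flat codimension two, so the facet has a
    point \<open>u\<close> off the flat.\<close>
  have "\<not> H \<inter> frontier R \<subseteq> flat A"
  proof
    assume "H \<inter> frontier R \<subseteq> flat A"
    from aff_dim_subset[OF this] show False
      using dimR dim_flat[OF A(2)] by (simp add: aff_dim_subspace[OF subspace_flat])
  qed
  then obtain u where u: "u \<in> H" "u \<in> closure R" "u \<notin> flat A"
    by (auto simp: frontier_def)
  \<comment> \<open>Chosen so that \<open>u - \<sigma> *\<^sub>R v\<close> is orthogonal to both
    spanning normals, hence to all of \<open>A\<close>. So \<open>u\<close> and
    \<open>\<sigma> *\<^sub>R v\<close> agree modulo the flat, and the sign of
    \<open>\<sigma>\<close> tells on which half-hyperplane the facet lies.\<close>
  define \<sigma> where "\<sigma> = (nvec K0 \<bullet> u) / (nvec K0 \<bullet> v)"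
  have "nvec K0 \<bullet> v \<noteq> 0" using v K0 by auto
  then have z: "nvec K0 \<bullet> (u - \<sigma> *\<^sub>R v) = 0" "nvec H \<bullet> (u - \<sigma> *\<^sub>R v) = 0"
    using u(1) v(1) A.mem_hyperplane[OF HA] by (auto simp: \<sigma>_def inner_diff_right)
  have Ku: "nvec K \<bullet> u = \<sigma> * (nvec K \<bullet> v)" if "K \<in> A" for K
  proof -
    have "orthogonal (u - \<sigma> *\<^sub>R v) (nvec K)"
      by (rule orthogonal_to_span[OF K0(2)[OF that]]) (use z in \<open>auto simp: orthogonal_def inner_commute\<close>)
    then show ?thesis by (simp add: orthogonal_def inner_diff_right inner_commute[of _ "nvec K"])
  qed
  have "\<sigma> \<noteq> 0" using u(3) Ku by (auto simp: flat_def)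
  have cl: "0 \<le> side B K * (\<sigma> * (nvec K \<bullet> v))" if "K \<in> A" for K
    using A.closure_region[OF R(1)] u(2) sgR[OF that] Ku[OF that] that by auto
  have *: "sgn (\<sigma> * (nvec K \<bullet> v)) = side B K" if "K \<in> A - {H}" for K
    by (rule sgn_eqI) (use that cl v(2) \<open>\<sigma> \<noteq> 0\<close> side_cases[OF B, of K] A in auto)
  show ?thesis
  proof (cases "\<sigma> > 0")
    case True
    then show ?thesis using * by (simp add: sgn_mult)
  next
    case False
    then have "sgn \<sigma> = -1" using \<open>\<sigma> \<noteq> 0\<close> by simp
    then show ?thesis using * by (metis sgn_mult mult_minus1 minus_minus)
  qed
qed

section \<open>Loops of edges along a shard\<close>

lemma cuts_irrefl: "\<not> cuts \<H> B H H"
  by (auto simp: cuts_def)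

lemma rank2_subarrangementI:
  assumes "rank2 (at_point p)"
  shows "at_point p \<in> rank2_subarrangements \<H>"
proof -
  let ?A = "at_point p"
  have "p \<in> flat ?A" by (auto simp: flat_def at_point_def)
  then have eq: "{H \<in> \<H>. flat ?A \<subseteq> H} = ?A"
    using mem_hyperplane by (auto simp: flat_def at_point_def)
  obtain H K where HK: "H \<in> ?A" "K \<in> ?A" "H \<noteq> K" using assms unfolding rank2_def by blast
  have "finite ?A" by (simp add: at_point_def)
  then have "card {H, K} \<le> card ?A" using HK by (intro card_mono) auto
  then have "2 \<le> card ?A" using HK by simp
  then show ?thesis
    unfolding rank2_subarrangements_def
    by (intro CollectI exI[of _ "flat ?A"] conjI subspace_flat dim_flat[OF assms]) (simp_all only: eq)
qed

text \<open>Some member of \<open>at_point p\<close> is basic, and it would cut \<open>H\<close> if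
  \<open>H\<close> were not basic. By \<open>basic_side\<close>, \<open>C'\<close> or
  \<open>D'\<close> then lies on the side of \<open>B\<close> for all other members, so a minimal
  gallery from \<open>B\<close> to that region continues minimally to the other, and the edge can be
  slid. The vector \<open>v\<close> points inside \<open>H\<close> towards
  \<open>D'\<close>.\<close>

lemma edge_loop_eq_across_flat:
  assumes B: "B \<in> \<R>" and r: "C' \<in> \<R>" "C \<in> \<R>" "D' \<in> \<R>" "D \<in> \<R>"
    and sepH: "Inv C' C = {H}" "Inv D' D = {H}"
    and A: "rank2 (at_point p)" "H \<in> at_point p" "Inv C' D' = at_point p - {H}"
    and K0: "K0 \<in> at_point p" "K0 \<noteq> H" "\<And>L. L \<in> at_point p \<Longrightarrow> nvec L \<in> span {nvec H, nvec K0}"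
    and v: "nvec H \<bullet> v = 0" "\<And>K. K \<in> at_point p - {H} \<Longrightarrow> sgn (nvec K \<bullet> v) = side D' K"
    and nocut: "\<And>K. K \<in> at_point p \<Longrightarrow> \<not> cuts \<H> B K H"
  shows "edge_loop \<H> B C' C = edge_loop \<H> B D' D"
proof -
  let ?A = "at_point p"
  have AH: "?A \<subseteq> \<H>" by (auto simp: at_point_def)
  obtain K where K: "basic ?A B K" using exists_basic[OF AH _ B] A(2) by blast
  have basicH: "basic ?A B H"
  proof (rule ccontr)
    assume "\<not> basic ?A B H"
    then have "cuts \<H> B K H"
      using K A(2) rank2_subarrangementI[OF A(1)] unfolding cuts_def basic_def by blast
    then show False using nocut K by (auto simp: basic_def)
  qed
  have nz: "nvec K \<bullet> v \<noteq> 0" if "K \<in> ?A - {H}" for K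
    using v(2)[OF that] side_cases[OF r(3), of K] that AH by auto
  have C'D': "side C' K = - side D' K" if "K \<in> ?A - {H}" for K
  proof -
    have "K \<in> Inv C' D'" "K \<in> \<H>" using that A(3) AH by auto
    then show ?thesis using side_cases[OF r(1), of K] side_cases[OF r(3), of K] sep_eq[OF r(1,3)] by auto
  qed
  have D'C': "Inv D' C' = ?A - {H}" using sep_commute[OF r(1,3)] A(3) by simp
  from basic_side[OF AH A(1) B basicH K0(1,3) v(1) nz K0(2)]
  show ?thesis
  proof
    assume "\<forall>K\<in>?A-{H}. sgn (nvec K \<bullet> v) = side B K"
    then have "K \<notin> Inv B D'" if "K \<in> ?A - {H}" for K
      using v(2)[OF that] that sep_eq[OF B r(3)] by simp
    then have "Inv B D' \<inter> Inv D' C' = {}" using D'C' by blast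
    then show ?thesis
      using edge_loop_eq_slide[OF B r(3,4,1,2) sepH(2,1)] D'C' by auto
  next
    assume "\<forall>K\<in>?A-{H}. sgn (nvec K \<bullet> v) = - side B K"
    then have "K \<notin> Inv B C'" if "K \<in> ?A - {H}" for K
      using v(2)[OF that] C'D'[OF that] that sep_eq[OF B r(1)] by simp
    then have "Inv B C' \<inter> Inv C' D' = {}" using A(3) by blast
    then show ?thesis
      using edge_loop_eq_slide[OF B r sepH] A(3) by auto
  qed
qed

text \<open>A sweep inside \<open>H\<close> from \<open>x\<close> to a generic point
  \<open>y'\<close> of the facet of \<open>D'\<close>. Each time the segment leaves a facet it
  passes a flat of codimension two at which nothing cuts \<open>H\<close>.\<close>

lemma edge_loop_eq_same_piece:
  assumes B: "B \<in> \<R>" and r: "C' \<in> \<R>" "C \<in> \<R>" "D' \<in> \<R>" "D \<in> \<R>"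
    and sepH: "Inv C' C = {H}" "Inv D' D = {H}" and HB: "H \<notin> Inv B C'" "H \<notin> Inv B D'"
    and x: "facet_point C' H x" and y: "facet_point D' H y"
    and same: "\<And>K. K \<in> \<H> \<Longrightarrow> cuts \<H> B K H \<Longrightarrow> sgn (nvec K \<bullet> x) = sgn (nvec K \<bullet> y)"
  shows "edge_loop \<H> B C' C = edge_loop \<H> B D' D"
proof -
  have H: "H \<in> \<H>" and xH: "nvec H \<bullet> x = 0" using x by (auto simp: facet_point_def)
  define N where "N = {s. nvec H \<bullet> s = 0}"
  have "subspace N" by (auto simp: N_def subspace_def inner_add_right)
  define U where "U = (\<Inter>K\<in>\<H> - {H}. {z. (side D' K *\<^sub>R nvec K) \<bullet> z > 0})"
  have sgU: "sgn (nvec K \<bullet> z) = side D' K \<longleftrightarrow> (side D' K *\<^sub>R nvec K) \<bullet> z > 0" if "K \<in> \<H>" for K z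
    using side_cases[OF r(3) that] by (auto simp: sgn_1_pos sgn_1_neg)
  have "open U" unfolding U_def by (intro open_INT ballI open_halfspace_gt) auto
  moreover have "y \<in> U \<inter> N"
    using y sgU by (auto simp: U_def N_def facet_point_def)
  moreover define w where "w = (\<lambda>(K,L). (nvec L \<bullet> x) *\<^sub>R nvec K - (nvec K \<bullet> x) *\<^sub>R nvec L)"
  \<comment> \<open>The end point has to stay in \<open>N\<close>, so only vectors that do not
    vanish on \<open>N\<close> can be avoided. The others are multiples of \<open>nvec H\<close>,
    which still yields the dependence proved in \<open>triple\<close>.\<close>
  define W where "W = {u \<in> w ` (\<H> \<times> \<H>). \<exists>s\<in>N. u \<bullet> s \<noteq> 0}"
  have "finite W" by (simp add: W_def)
  ultimately obtain y' where y': "y' \<in> U \<inter> N" "\<forall>u\<in>W. u \<bullet> y' \<noteq> 0"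
    using subspace_avoid_hyperplanes[of N U y W] \<open>subspace N\<close> unfolding W_def by blast
  have y'H: "nvec H \<bullet> y' = 0" using y' by (simp add: N_def)
  have sy': "sgn (nvec K \<bullet> y') = side D' K" if "K \<in> \<H> - {H}" for K
    using y'(1) sgU[of K y'] that by (auto simp: U_def)
  have sx: "sgn (nvec K \<bullet> x) = side C' K" if "K \<in> \<H> - {H}" for K
    using x that by (simp add: facet_point_def)
  have same': "side C' K = side D' K" if "K \<in> \<H>" "cuts \<H> B K H" for K
  proof -
    have "K \<noteq> H" using that cuts_irrefl by auto
    then show ?thesis using same[OF that] x y that by (simp add: facet_point_def)
  qed
  define q where "q = (\<lambda>t::real. (1 - t) *\<^sub>R x + t *\<^sub>R y')"
  have qt: "u \<bullet> q t = (1 - t) * (u \<bullet> x) + t * (u \<bullet> y')" for u t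
    by (simp add: q_def inner_add_right)
  have qH: "nvec H \<bullet> q t = 0" for t using xH y'H by (simp add: qt)
  have triple: "nvec L \<in> span {nvec H, nvec K}"
    if KL: "K \<in> \<H> - {H}" "L \<in> \<H>" and t: "0 < t" and tie: "nvec K \<bullet> q t = 0" "nvec L \<bullet> q t = 0" for K L t
  proof -
    define v where "v = w (K, L)"
    have v: "v = (nvec L \<bullet> x) *\<^sub>R nvec K - (nvec K \<bullet> x) *\<^sub>R nvec L" by (simp add: v_def w_def)
    have "v \<bullet> q t = 0" using tie by (simp add: v inner_diff_left)
    moreover have "v \<bullet> x = 0" by (simp add: v inner_diff_left)
    ultimately have "v \<bullet> y' = 0" using qt[of v t] t by simp
    then have "v \<notin> W" using y'(2) by blast
    moreover have "v \<in> w ` (\<H> \<times> \<H>)" unfolding v_def using KL by (intro imageI) auto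
    ultimately have "\<forall>s\<in>N. v \<bullet> s = 0" unfolding W_def by blast
    then have "v \<in> span {nvec H}" using H by (intro vanishing_on_hyperplane) (auto simp: N_def)
    then have vs: "v \<in> span {nvec H, nvec K}" by (rule subsetD[OF span_mono, rotated]) auto
    have nz: "nvec K \<bullet> x \<noteq> 0" using facet_point_nonzero[OF r(1) x KL(1)] .
    have "(nvec K \<bullet> x) *\<^sub>R nvec L = (nvec L \<bullet> x) *\<^sub>R nvec K - v" by (simp add: v)
    then have "nvec L = (1 / (nvec K \<bullet> x)) *\<^sub>R ((nvec L \<bullet> x) *\<^sub>R nvec K - v)"
      using nz by (metis (no_types, lifting) divide_self_if scaleR_one scaleR_scaleR times_divide_eq_left mult_1)
    moreover have "(nvec L \<bullet> x) *\<^sub>R nvec K - v \<in> span {nvec H, nvec K}"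
      using vs by (intro span_diff span_scale span_base[of "nvec K"]) auto
    ultimately show ?thesis by (metis span_scale)
  qed
  have main: "edge_loop \<H> B E' E = edge_loop \<H> B D' D"
    if "0 \<le> s" "s < 1" "E' \<in> \<R>" "E \<in> \<R>" "Inv E' E = {H}" "H \<notin> Inv B E'"
      "facet_point E' H (q s)" for s E' E
    using that
  \<comment> \<open>The measure counts the hyperplanes other than \<open>H\<close> between the
    current region and \<open>D'\<close>.\<close>
  proof (induction "card {K \<in> \<H> - {H}. side E' K \<noteq> side D' K}" arbitrary: s E' E rule: less_induct)
    case less
    note s = less.prems(1,2) and E = less.prems(3-6) and f = less.prems(7)
    define M where "M = {K \<in> \<H> - {H}. side E' K \<noteq> side D' K}"
    have EH: "side E' H = side D' H" using sep_eq[OF B E(1)] sep_eq[OF B r(3)] E(4) HB H by auto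
    show ?case
    proof (cases "M = {}")
      case True
      then have "E' = D'"
        using region_eqI[OF E(1) r(3)] EH by (auto simp: M_def)
      moreover from this have "E = D" using region_eqI_sep[OF E(1,2) r(4)] E(3) sepH by simp
      ultimately show ?thesis by simp
    next
      case False
      have finM: "finite M" by (simp add: M_def)
      define \<phi> where "\<phi> = (\<lambda>K t. side E' K * (nvec K \<bullet> q t))"
      have aff: "(1 - s) * \<phi> K t = (1 - t) * \<phi> K s + (t - s) * \<phi> K 1" for K t
        by (simp add: \<phi>_def qt) algebra
      have s_s: "sgn (nvec K \<bullet> q s) = side E' K" if "K \<in> \<H> - {H}" for K
        using f that by (simp add: facet_point_def)
      have s_1: "sgn (nvec K \<bullet> q 1) = side D' K" if "K \<in> \<H> - {H}" for K
        using sy'[OF that] by (simp add: qt)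
      have phs: "\<phi> K s > 0" if "K \<in> \<H> - {H}" for K
        using s_s[OF that] side_cases[OF E(1), of K] that by (auto simp: \<phi>_def sgn_1_pos sgn_1_neg)
      have flip: "side E' K = - side D' K" if "K \<in> M" for K
        using that side_cases[OF E(1), of K] side_cases[OF r(3), of K] by (auto simp: M_def)
      have ph1: "\<phi> K 1 < 0" if "K \<in> M" for K
        using s_1[of K] flip[OF that] that side_cases[OF r(3), of K] 
        by (auto simp: \<phi>_def M_def sgn_1_pos sgn_1_neg)
      have ph1': "\<phi> K 1 > 0" if "K \<in> \<H> - {H} - M" for K
        using s_1[of K] that side_cases[OF r(3), of K] by (auto simp: \<phi>_def M_def sgn_1_pos sgn_1_neg)
      obtain t K0 where t: "s < t" "t < 1" and K0: "K0 \<in> M" "\<phi> K0 t = 0" and ge: "\<And>K. K \<in> M \<Longrightarrow> 0 \<le> \<phi> K t"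
      proof -
        have "\<phi> K s > 0" if "K \<in> M" for K using phs that by (simp add: M_def)
        from affine_first_zero[where \<phi> = \<phi>, OF finM False s(2) aff this ph1] that show ?thesis by blast
      qed
      define p where "p = q t"
      define T where "T = at_point p - {H}"
      have T_iff: "K \<in> T \<longleftrightarrow> K \<in> \<H> - {H} \<and> \<phi> K t = 0" for K
        using side_cases[OF E(1), of K] by (auto simp: T_def at_point_def \<phi>_def p_def)
      have pos: "\<phi> K t > 0" if K: "K \<in> \<H> - {H} - T" for K
      proof (cases "K \<in> M")
        case True
        then show ?thesis using ge[OF True] T_iff[of K] K by (auto simp: less_le)
      next
        case F: False
        then have "0 < (1 - t) * \<phi> K s + (t - s) * \<phi> K 1"
          using phs[of K] ph1'[of K] K t by (intro add_pos_pos mult_pos_pos) auto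
        then have "0 < (1 - s) * \<phi> K t" using aff[of K t] by simp
        then show ?thesis using s by (simp add: zero_less_mult_iff)
      qed
      \<comment> \<open>A hyperplane with \<open>E'\<close> and \<open>D'\<close> on the same side
        keeps its sign along the whole rest of the segment. So those met at \<open>p\<close> all lie
        between \<open>E'\<close> and \<open>D'\<close>, and passing \<open>p\<close> crosses
        exactly them.\<close>
      have TM: "T \<subseteq> M"
      proof
        fix K assume K: "K \<in> T"
        show "K \<in> M"
        proof (rule ccontr)
          assume "K \<notin> M"
          then have "0 < (1 - t) * \<phi> K s + (t - s) * \<phi> K 1"
            using phs[of K] ph1'[of K] K T_iff t by (intro add_pos_pos mult_pos_pos) auto
          then show False using aff[of K t] K T_iff by simp
        qed
      qed
      have Hp: "H \<in> at_point p" using H qH by (simp add: at_point_def p_def)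
      have K0T: "K0 \<in> T" using K0 T_iff by (auto simp: M_def)
      have sp: "nvec L \<in> span {nvec H, nvec K0}" if "L \<in> at_point p" for L
        using triple[of K0 L t] that K0T t s by (auto simp: at_point_def T_def p_def)
      have rank: "rank2 (at_point p)"
      proof -
        have "at_point p \<subseteq> \<H>" "K0 \<in> at_point p" "H \<noteq> K0" using K0T by (auto simp: T_def at_point_def)
        then show ?thesis unfolding rank2_def using Hp sp by metis
      qed
      obtain e where e: "0 < e" "e < 1" "\<forall>K\<in>\<H> - {H} - T. sgn (nvec K \<bullet> (p + e *\<^sub>R (y' - p))) = sgn (nvec K \<bullet> p)"
      proof -
        have "nvec K \<bullet> p \<noteq> 0" if "K \<in> \<H> - {H} - T" for K
          using that by (auto simp: T_def at_point_def)
        then show ?thesis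
          using exists_perturbation[of "\<H> - {H} - T" nvec p "y' - p"] that by (metis finite_Diff finite_arr)
      qed
      define s' where "s' = t + e * (1 - t)"
      have lt: "e * (1 - t) < 1 - t" using mult_strict_right_mono[of e 1 "1 - t"] e t by simp
      have gt: "0 < e * (1 - t)" using e t by simp
      have s': "0 \<le> s'" "s' < 1" unfolding s'_def using lt gt t s by linarith+
      have qs': "q s' = p + e *\<^sub>R (y' - p)"
        by (simp add: q_def p_def s'_def algebra_simps)
      have sT: "sgn (nvec K \<bullet> (y' - p)) = side D' K" "sgn (nvec K \<bullet> q s') = side D' K" if K: "K \<in> T" for K
      proof -
        have "nvec K \<bullet> p = 0" "K \<in> \<H> - {H}" using K by (auto simp: T_def at_point_def)
        then show "sgn (nvec K \<bullet> (y' - p)) = side D' K" "sgn (nvec K \<bullet> q s') = side D' K"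
          using sy'[of K] e by (auto simp: qs' inner_add_right inner_diff_right sgn_mult)
      qed
      have sn: "sgn (nvec K \<bullet> q s') = side E' K" if K: "K \<in> \<H> - {H} - T" for K
      proof -
        have "sgn (nvec K \<bullet> p) = side E' K"
          using pos[OF K] side_cases[OF E(1), of K] K by (auto simp: \<phi>_def p_def sgn_1_pos sgn_1_neg)
        then show ?thesis using e(3) K by (simp add: qs')
      qed
      have nz: "nvec K \<bullet> q s' \<noteq> 0" if K: "K \<in> \<H> - {H}" for K
        using sn[of K] sT(2)[of K] K side_cases[OF E(1), of K] side_cases[OF r(3), of K]
        by (cases "K \<in> T") auto
      obtain F' F where F: "F' \<in> \<R>" "F \<in> \<R>" "Inv F' F = {H}" "H \<notin> Inv B F'"
        and fF: "facet_point F' H (q s')"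
        using exists_facet_pair[OF H B qH nz] by metis
      have sF: "side F' K = (if K \<in> T then side D' K else side E' K)" if K: "K \<in> \<H> - {H}" for K
        using fF sn[of K] sT(2)[of K] K by (simp add: facet_point_def)
      have "{K \<in> \<H> - {H}. side F' K \<noteq> side D' K} \<subset> M"
      proof
        show "{K \<in> \<H> - {H}. side F' K \<noteq> side D' K} \<subseteq> M"
        proof
          fix K assume "K \<in> {K \<in> \<H> - {H}. side F' K \<noteq> side D' K}"
          then have K: "K \<in> \<H> - {H}" "side F' K \<noteq> side D' K" by simp_all
          then have "side E' K \<noteq> side D' K" using sF[OF K(1)] by (cases "K \<in> T") simp_all
          then show "K \<in> M" using K(1) unfolding M_def by blast
        qed
        have "K0 \<in> \<H> - {H}" using K0(1) unfolding M_def by blast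
        then have "side F' K0 = side D' K0" using sF[of K0] K0T by simp
        then show "{K \<in> \<H> - {H}. side F' K \<noteq> side D' K} \<noteq> M" using K0(1) by blast
      qed
      then have "card {K \<in> \<H> - {H}. side F' K \<noteq> side D' K} < card M"
        using finM by (rule psubset_card_mono[rotated])
      from less.hyps[OF this[unfolded M_def] s' F fF]
      have "edge_loop \<H> B F' F = edge_loop \<H> B D' D" .
      moreover have "edge_loop \<H> B E' E = edge_loop \<H> B F' F"
      proof (rule edge_loop_eq_across_flat[OF B E(1,2) F(1,2) E(3) F(3) rank Hp])
        have FH: "side F' H = side E' H" using sep_eq[OF B E(1)] sep_eq[OF B F(1)] E(4) F(4) H by auto
        have "side E' K \<noteq> side F' K \<longleftrightarrow> K \<in> T" if "K \<in> \<H>" for K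
          using sF[of K] FH TM that by (cases "K = H") (auto simp: M_def T_def)
        then show "Inv E' F' = at_point p - {H}"
          using sep_eq[OF E(1) F(1)] TM by (auto simp: T_def[symmetric] M_def)
        show "K0 \<in> at_point p" "K0 \<noteq> H" using K0T by (auto simp: T_def)
        show "nvec H \<bullet> (y' - p) = 0" using y'H qH by (simp add: inner_diff_right p_def)
        show "sgn (nvec K \<bullet> (y' - p)) = side F' K" if "K \<in> at_point p - {H}" for K
          using that sT(1)[of K] sF[of K] by (auto simp: T_def at_point_def)
        \<comment> \<open>The points \<open>x\<close> and \<open>y'\<close> are on the same side of
          every hyperplane that cuts \<open>H\<close>, so the segment between them never meets
          one.\<close>
        show "\<not> cuts \<H> B K H" if K: "K \<in> at_point p" for K
        proof
          assume c: "cuts \<H> B K H"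
          then have "K \<noteq> H" using cuts_irrefl by auto
          then have KT: "K \<in> T" "K \<in> \<H> - {H}" using K by (auto simp: T_def at_point_def)
          have "sgn (nvec K \<bullet> x) = sgn (nvec K \<bullet> y')"
            using same'[OF _ c] sx[OF KT(2)] sy'[OF KT(2)] KT by auto
          moreover have "side D' K \<noteq> 0" using side_cases[OF r(3), of K] KT by auto
          then have "nvec K \<bullet> y' \<noteq> 0" using sy'[OF KT(2)] by auto
          ultimately have "nvec K \<bullet> q t \<noteq> 0"
            unfolding qt using t s by (intro convex_comb_nonzero) auto
          then show False using K by (simp add: at_point_def p_def)
        qed
      qed (rule sp)
      ultimately show ?thesis by simp
    qed
  qed
  show ?thesis
    by (rule main[of 0]) (use r sepH HB x in \<open>auto simp: q_def\<close>)
qed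


section \<open>Shards as closures of sign classes\<close>

definition cutting :: "'a set \<Rightarrow> 'a set \<Rightarrow> 'a set set" where
  "cutting B H = {K \<in> \<H>. cuts \<H> B K H}"

definition piece :: "'a set \<Rightarrow> 'a set \<Rightarrow> 'a \<Rightarrow> 'a set" where
  "piece B H x = {y \<in> H. \<forall>K\<in>cutting B H. sgn (nvec K \<bullet> y) = sgn (nvec K \<bullet> x)}"

text \<open>The same argument as for regions: the sign class is convex, and signs are constant on
  connected sets that avoid the cutting hyperplanes.\<close>

lemma component_piece:
  assumes H: "H \<in> \<H>" and x: "x \<in> H - \<Union>(cutting B H)"
  shows "connected_component_set (H - \<Union>(cutting B H)) x = piece B H x"
proof
  have Heq: "H = {y. nvec H \<bullet> y = 0}" using mem_hyperplane[OF H] by blast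
  have K: "K \<in> \<H>" if "K \<in> cutting B H" for K using that by (simp add: cutting_def)
  have "piece B H x = {y. nvec H \<bullet> y = 0} \<inter> (\<Inter>K\<in>cutting B H. {y. sgn (nvec K \<bullet> y) = sgn (nvec K \<bullet> x)})"
    unfolding piece_def using mem_hyperplane[OF H] by blast
  then have "convex (piece B H x)"
    by (simp add: convex_Int convex_hyperplane convex_INT convex_sgn_inner)
  moreover have "piece B H x \<subseteq> H - \<Union>(cutting B H)"
  proof
    fix y assume y: "y \<in> piece B H x"
    have "y \<notin> K" if L: "K \<in> cutting B H" for K
    proof -
      have "nvec K \<bullet> x \<noteq> 0" using x L mem_hyperplane[OF K[OF L]] by blast
      moreover have "sgn (nvec K \<bullet> y) = sgn (nvec K \<bullet> x)" using y L by (simp add: piece_def)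
      ultimately show ?thesis using mem_hyperplane[OF K[OF L]] by (metis sgn_0_0)
    qed
    then show "y \<in> H - \<Union>(cutting B H)" using y by (auto simp: piece_def)
  qed
  moreover have "x \<in> piece B H x" using x by (simp add: piece_def)
  ultimately show "piece B H x \<subseteq> connected_component_set (H - \<Union>(cutting B H)) x"
    by (intro connected_component_maximal) (auto intro: convex_connected)
  have sub: "connected_component_set (H - \<Union>(cutting B H)) x \<subseteq> H - \<Union>(cutting B H)"
    by (rule connected_component_subset)
  show "connected_component_set (H - \<Union>(cutting B H)) x \<subseteq> piece B H x"
  proof
    fix y assume y: "y \<in> connected_component_set (H - \<Union>(cutting B H)) x"
    have "sgn (nvec K \<bullet> y) = sgn (nvec K \<bullet> x)" if L: "K \<in> cutting B H" for K
    proof (rule sgn_inner_constant_on_connected)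
      show "connected (connected_component_set (H - \<Union>(cutting B H)) x)"
        by (rule connected_connected_component)
      show "x \<in> connected_component_set (H - \<Union>(cutting B H)) x" using x by simp
      show "nvec K \<bullet> z \<noteq> 0" if "z \<in> connected_component_set (H - \<Union>(cutting B H)) x" for z
        using sub that L mem_hyperplane[OF K[OF L], of z] by blast
    qed (rule y)
    then show "y \<in> piece B H x" using sub y unfolding piece_def by blast
  qed
qed

lemma shards_eq: "shards \<H> B = {closure (piece B H x) | H x. H \<in> \<H> \<and> x \<in> H - \<Union>(cutting B H)}"
proof -
  have "components (H - \<Union>(cutting B H)) = piece B H ` (H - \<Union>(cutting B H))" if "H \<in> \<H>" for H
    unfolding components_def by (intro image_cong refl component_piece[OF that])
  then have "shards \<H> B = (\<Union>H\<in>\<H>. closure ` piece B H ` (H - \<Union>(cutting B H)))"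
    unfolding shards_def cutting_def[symmetric] by simp
  then show ?thesis by (simp only: image_image) blast
qed

lemma facet_point_not_cut:
  assumes C: "C \<in> \<R>" and x: "facet_point C H x"
  shows "x \<in> H - \<Union>(cutting B H)"
proof -
  have H: "H \<in> \<H>" "x \<in> H" using x mem_hyperplane by (auto simp: facet_point_def)
  have "x \<notin> K" if K: "K \<in> cutting B H" for K
  proof -
    have "K \<in> \<H> - {H}" using K cuts_irrefl by (auto simp: cutting_def)
    then show ?thesis using facet_point_nonzero[OF C x] mem_hyperplane by blast
  qed
  then show ?thesis using H by blast
qed

text \<open>Membership in the closure of a piece gives only weak inequalities; a facet point lies on
  no hyperplane but \<open>H\<close>, so they are strict. Hence a facet point lies in just one
  shard.\<close>

lemma facet_point_in_shard:
  assumes C: "C \<in> \<R>" and x: "facet_point C H x"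
    and H2: "H2 \<in> \<H>" "y \<in> H2" and mem: "x \<in> closure (piece B H2 y)"
  shows "H2 = H" "\<And>K. K \<in> cutting B H \<Longrightarrow> sgn (nvec K \<bullet> x) = sgn (nvec K \<bullet> y)"
proof -
  have clo: "nvec H2 \<bullet> x = 0 \<and> (\<forall>K\<in>cutting B H2. 0 \<le> sgn (nvec K \<bullet> y) * (nvec K \<bullet> x))"
  proof -
    let ?P = "{z. nvec H2 \<bullet> z = 0} \<inter> (\<Inter>K\<in>cutting B H2. {z. (sgn (nvec K \<bullet> y) *\<^sub>R nvec K) \<bullet> z \<ge> 0})"
    have "piece B H2 y \<subseteq> ?P"
    proof
      fix z assume z: "z \<in> piece B H2 y"
      have "0 \<le> sgn (nvec K \<bullet> y) * (nvec K \<bullet> z)" if "K \<in> cutting B H2" for K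
      proof -
        have "sgn (nvec K \<bullet> y) = sgn (nvec K \<bullet> z)" using z that by (simp add: piece_def)
        then show ?thesis by (simp add: sgn_if)
      qed
      then show "z \<in> ?P" using z mem_hyperplane[OF H2(1)] by (auto simp: piece_def)
    qed
    then have "closure (piece B H2 y) \<subseteq> ?P"
      by (intro closure_minimal closed_Int closed_hyperplane closed_INT ballI closed_halfspace_ge)
    then show ?thesis using mem by auto
  qed
  show eq: "H2 = H"
    using facet_point_nonzero[OF C x, of H2] clo H2 by blast
  fix K assume K: "K \<in> cutting B H"
  then have K': "K \<in> \<H> - {H}" using cuts_irrefl by (auto simp: cutting_def)
  have "nvec K \<bullet> x \<noteq> 0" using facet_point_nonzero[OF C x K'] .
  moreover have "0 \<le> sgn (nvec K \<bullet> y) * (nvec K \<bullet> x)" using clo K eq by auto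
  moreover have "sgn (nvec K \<bullet> y) = 1 \<or> sgn (nvec K \<bullet> y) = -1" if "nvec K \<bullet> y \<noteq> 0"
    using that by (simp add: sgn_if)
  \<comment> \<open>Only \<open>y \<in> H2\<close> is assumed. If \<open>y\<close> were on
    \<open>K\<close>, the whole piece and its closure would lie in \<open>K\<close>, but
    \<open>x\<close> does not.\<close>
  moreover have "nvec K \<bullet> y \<noteq> 0"
  proof
    assume "nvec K \<bullet> y = 0"
    then have "piece B H2 y \<subseteq> {z. nvec K \<bullet> z = 0}"
      using K eq by (auto simp: piece_def sgn_0_0)
    then have "closure (piece B H2 y) \<subseteq> {z. nvec K \<bullet> z = 0}"
      by (intro closure_minimal closed_hyperplane)
    then show False using mem \<open>nvec K \<bullet> x \<noteq> 0\<close> by blast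
  qed
  ultimately show "sgn (nvec K \<bullet> x) = sgn (nvec K \<bullet> y)"
    by (intro sgn_eqI) auto
qed

text \<open>Resolves the definite description: the common facet lies in the closure of the piece of
  \<open>x\<close>, and any shard containing that facet contains \<open>x\<close>, which lies in
  only one shard.\<close>

lemma shard_of_edge_eq:
  assumes C': "C' \<in> \<R>" and C: "C \<in> \<R>" and sep: "Inv C' C = {H}"
    and x: "facet_point C' H x"
  shows "shard_of_edge \<H> B C' C = closure (piece B H x)"
proof -
  have H: "H \<in> \<H>" "nvec H \<bullet> x = 0" using x by (auto simp: facet_point_def)
  have eq: "side C' K = side C K" if "K \<in> \<H> - {H}" for K
    using sep sep_eq[OF C' C] that by auto
  have opp: "side C H = - side C' H"
    using sep sep_eq[OF C' C] side_cases[OF C H(1)] side_cases[OF C' H(1)] by auto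
  have sx: "sgn (nvec K \<bullet> x) = side C' K" if "K \<in> \<H> - {H}" for K
    using x that by (simp add: facet_point_def)
  have nn: "0 \<le> side C' K * (nvec K \<bullet> x)" if "K \<in> \<H>" for K
  proof (cases "K = H")
    case False
    then have "side C' K = sgn (nvec K \<bullet> x)" using sx that by simp
    then show ?thesis by (simp add: sgn_if)
  qed (use H in simp)
  have xcl: "x \<in> closure C' \<inter> closure C"
  proof -
    have "0 \<le> side C K * (nvec K \<bullet> x)" if "K \<in> \<H>" for K
      using nn[OF that] eq[of K] H that by (cases "K = H") auto
    then show ?thesis using nn by (simp add: closure_region C C')
  qed
  have sub: "closure C' \<inter> closure C \<subseteq> closure (piece B H x)"
  proof
    fix y assume y: "y \<in> closure C' \<inter> closure C"
    then have ny: "0 \<le> side C' K * (nvec K \<bullet> y)" "0 \<le> side C K * (nvec K \<bullet> y)" if "K \<in> \<H>" for K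
      using that by (auto simp: closure_region C C')
    have yH: "nvec H \<bullet> y = 0"
      using ny[OF H(1)] opp side_cases[OF C' H(1)] by auto
    \<comment> \<open>A point of the closed facet moves into the piece when a positive multiple of
      the facet point \<open>x\<close> is added.\<close>
    have mem: "y + e *\<^sub>R x \<in> piece B H x" if "0 < e" for e
    proof -
      have "sgn (nvec K \<bullet> (y + e *\<^sub>R x)) = sgn (nvec K \<bullet> x)" if "K \<in> cutting B H" for K
      proof -
        have K: "K \<in> \<H> - {H}" using that cuts_irrefl by (auto simp: cutting_def)
        have "0 < side C' K * (nvec K \<bullet> x)"
          using nn[of K] facet_point_nonzero[OF C' x K] side_cases[OF C', of K] K by (auto simp: less_le)
        then have "0 < side C' K * (nvec K \<bullet> (y + e *\<^sub>R x))"
          using ny(1)[of K] K \<open>0 < e\<close>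
          by (simp add: inner_add_right distrib_left add_nonneg_pos mult.left_commute[of _ e])
        then show ?thesis
          using sgn_eqI[of "side C' K" "nvec K \<bullet> (y + e *\<^sub>R x)"] side_cases[OF C', of K] K sx[OF K] by (auto simp: less_imp_le)
      qed
      then show ?thesis
        using yH H mem_hyperplane[OF H(1)] by (simp add: piece_def inner_add_right)
    qed
    show "y \<in> closure (piece B H x)" by (rule closure_ray[OF mem])
  qed
  show ?thesis
    unfolding shard_of_edge_def
  proof (rule the_equality)
    show "closure (piece B H x) \<in> shards \<H> B \<and> closure C' \<inter> closure C \<subseteq> closure (piece B H x)"
      using sub H facet_point_not_cut[OF C' x] unfolding shards_eq by blast
  next
    fix S assume S: "S \<in> shards \<H> B \<and> closure C' \<inter> closure C \<subseteq> S"
    then obtain H2 y where y: "S = closure (piece B H2 y)" "H2 \<in> \<H>" "y \<in> H2"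
      unfolding shards_eq by blast
    have "x \<in> closure (piece B H2 y)" using S xcl y by blast
    from facet_point_in_shard[OF C' x y(2,3) this]
    have "H2 = H" "\<And>K. K \<in> cutting B H \<Longrightarrow> sgn (nvec K \<bullet> x) = sgn (nvec K \<bullet> y)" .
    then have "piece B H2 y = piece B H x" by (simp add: piece_def)
    then show "S = closure (piece B H x)" using y by simp
  qed
qed

text \<open>Crossing a wall of \<open>C'\<close> that separates it from \<open>C\<close> gives a
  region strictly above \<open>C'\<close> and at most \<open>C\<close> in the poset; for a cover it
  must be \<open>C\<close> itself.\<close>

lemma covers_iff:
  assumes B: "B \<in> \<R>"
  shows "covers \<H> B C' C \<longleftrightarrow>
    C' \<in> \<R> \<and> C \<in> \<R> \<and> (\<exists>H. Inv C' C = {H} \<and> H \<notin> Inv B C')"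
proof
  assume cov: "covers \<H> B C' C"
  then have r: "C' \<in> \<R>" "C \<in> \<R>" and lt: "Inv B C' \<subset> Inv B C"
    and nb: "\<And>D. D \<in> \<R> \<Longrightarrow> Inv B C' \<subset> Inv B D \<Longrightarrow> \<not> Inv B D \<subset> Inv B C"
    by (auto simp: covers_def)
  have s: "Inv C' C = Inv B C - Inv B C'"
    using sep_trans[OF r(1) B r(2)] sep_commute[OF B r(1)] lt by auto
  have "C' \<noteq> C" using lt by auto
  then obtain K x where K: "K \<in> Inv C' C" "facet_point C' K x" using exists_facet_point[OF r] by blast
  obtain E where E: "E \<in> \<R>" "Inv C' E = {K}" using region_across[OF r(1) K(2)] .
  have BE: "Inv B E = insert K (Inv B C')"
  proof -
    have "K \<notin> Inv B C'" using K(1) s by blast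
    then show ?thesis using sep_trans[OF B r(1) E(1)] unfolding E(2) by blast
  qed
  have K': "K \<in> Inv B C" "K \<notin> Inv B C'" using K(1) s by simp_all
  have "Inv B C' \<subset> Inv B E" unfolding BE using K'(2) by blast
  then have "\<not> Inv B E \<subset> Inv B C" by (rule nb[OF E(1)])
  moreover have "Inv B E \<subseteq> Inv B C" unfolding BE using K'(1) lt by (simp add: psubset_imp_subset)
  ultimately have "Inv B E = Inv B C" by (simp add: psubset_eq)
  then have "E = C" using region_eqI_sep[OF B E(1) r(2)] by simp
  then show "C' \<in> \<R> \<and> C \<in> \<R> \<and> (\<exists>H. Inv C' C = {H} \<and> H \<notin> Inv B C')"
    using r E K s by blast
next
  assume "C' \<in> \<R> \<and> C \<in> \<R> \<and> (\<exists>H. Inv C' C = {H} \<and> H \<notin> Inv B C')"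
  then obtain H where r: "C' \<in> \<R>" "C \<in> \<R>" and H: "Inv C' C = {H}" "H \<notin> Inv B C'"
    by blast
  have eq: "Inv B C = insert H (Inv B C')" using sep_trans[OF B r] unfolding H(1) using H(2) by blast
  have "\<not> (X \<subset> Y \<and> Y \<subset> insert H X)" for X Y by blast
  moreover have "Inv B C' \<subset> insert H (Inv B C')" using H(2) by blast
  ultimately show "covers \<H> B C' C" unfolding covers_def eq using r by simp
qed

text \<open>Resolves the second definite description: edges with the same shard have facet points in
  one hyperplane and on equal sides of all that cut it, so their loops agree.\<close>

lemma shard_loop_eq:
  assumes B: "B \<in> \<R>" and cov: "covers \<H> B C' C"
  shows "shard_loop \<H> B (shard_of_edge \<H> B C' C) = edge_loop \<H> B C' C"
  unfolding shard_loop_def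
proof (rule the_equality)
  show "\<exists>D' D. covers \<H> B D' D \<and> shard_of_edge \<H> B D' D = shard_of_edge \<H> B C' C \<and>
      edge_loop \<H> B C' C = edge_loop \<H> B D' D"
    using cov by blast
next
  fix l assume "\<exists>D' D. covers \<H> B D' D \<and> shard_of_edge \<H> B D' D = shard_of_edge \<H> B C' C \<and> l = edge_loop \<H> B D' D"
  then obtain D' D where D: "covers \<H> B D' D" "shard_of_edge \<H> B D' D = shard_of_edge \<H> B C' C"
    and l: "l = edge_loop \<H> B D' D" by blast
  obtain H where c: "C' \<in> \<R>" "C \<in> \<R>" "Inv C' C = {H}" "H \<notin> Inv B C'"
    using cov covers_iff[OF B] by blast
  obtain K where d: "D' \<in> \<R>" "D \<in> \<R>" "Inv D' D = {K}" "K \<notin> Inv B D'"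
    using D(1) covers_iff[OF B] by blast
  obtain x where x: "facet_point C' H x" using facet_point_between[OF c(1-3)] .
  obtain y where y: "facet_point D' K y" using facet_point_between[OF d(1-3)] .
  have "closure (piece B K y) = closure (piece B H x)"
    using D(2) shard_of_edge_eq[OF c(1-3) x] shard_of_edge_eq[OF d(1-3) y] by simp
  moreover have "x \<in> piece B H x" using facet_point_not_cut[OF c(1) x] by (simp add: piece_def)
  ultimately have mem: "x \<in> closure (piece B K y)" using closure_subset by blast
  have "K \<in> \<H>" "y \<in> K" using y mem_hyperplane by (auto simp: facet_point_def)
  from facet_point_in_shard[OF c(1) x this mem]
  have "K = H" and s: "\<And>L. L \<in> cutting B H \<Longrightarrow> sgn (nvec L \<bullet> x) = sgn (nvec L \<bullet> y)" .
  have "edge_loop \<H> B C' C = edge_loop \<H> B D' D"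
    by (rule edge_loop_eq_same_piece[OF B c(1,2) d(1,2) c(3) d(3)[unfolded \<open>K = H\<close>] c(4)
          d(4)[unfolded \<open>K = H\<close>] x y[unfolded \<open>K = H\<close>]])
      (use s in \<open>simp add: cutting_def\<close>)
  then show "l = edge_loop \<H> B C' C" using l by simp
qed

section \<open>Winding numbers\<close>

text \<open>A finite set that contains every cell of the complex, so that \<open>circle_map\<close>
  is a finite sum.\<close>

definition sal_cells :: "'a set cell set" where
  "sal_cells = Vertex ` \<R> \<union> (\<lambda>(C, D). Edge C D) ` (\<R> \<times> \<R>) \<union>
     (\<lambda>(C, F). Two_cell C F) ` (\<R> \<times> codim2_faces \<H>)"

text \<open>Crossing \<open>H\<close> from side \<open>s\<close> to side \<open>-s\<close> is mapped to a path from \<open>s\<close> to \<open>-s\<close> around the origin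
  through \<open>s * \<i>\<close>, in the counterclockwise direction for both values \<open>1\<close> and \<open>-1\<close> of \<open>s\<close>.\<close>

definition cell_value :: "'a set \<Rightarrow> 'a set cell \<Rightarrow> complex" where
  "cell_value H c = (case c of
      Vertex C \<Rightarrow> of_real (side C H)
    | Edge C D \<Rightarrow> if side C H = side D H then of_real (side C H) else of_real (side C H) * \<i>
    | Two_cell C F \<Rightarrow> if F \<subseteq> H then of_real (side C H) * \<i> else of_real (side C H))"

text \<open>Being linear, it sends a cone to the cone over the image of its base, so avoiding the
  origin can be checked cell by cell.\<close>

definition circle_map :: "'a set \<Rightarrow> ('a set cell \<Rightarrow> real) \<Rightarrow> complex" where
  "circle_map H x = (\<Sum>c\<in>sal_cells. x c *\<^sub>R cell_value H c)"

lemma finite_codim2_faces: "finite (codim2_faces \<H>)"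
proof -
  have "polyhedron (closure D)" if D: "D \<in> \<R>" for D
  proof -
    have "closure D = \<Inter>((\<lambda>H. {x. (side D H *\<^sub>R nvec H) \<bullet> x \<ge> 0}) ` \<H>)"
      by (auto simp: closure_region[OF D])
    moreover have "polyhedron (\<Inter>((\<lambda>H. {x. (side D H *\<^sub>R nvec H) \<bullet> x \<ge> 0}) ` \<H>))"
    proof (intro polyhedron_Inter finite_imageI finite_arr)
      show "polyhedron S" if "S \<in> (\<lambda>H. {x. (side D H *\<^sub>R nvec H) \<bullet> x \<ge> 0}) ` \<H>" for S
        using that polyhedron_halfspace_ge by blast
    qed
    ultimately show ?thesis by presburger
  qed
  then have "finite (\<Union>D\<in>\<R>. {F. F face_of closure D})"
    using finite_regions finite_polyhedron_faces by auto
  then show ?thesis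
    by (rule rev_finite_subset) (auto simp: codim2_faces_def)
qed

lemma finite_sal_cells: "finite sal_cells"
  unfolding sal_cells_def using finite_regions finite_codim2_faces by simp

lemma circle_map_cell_pt: "c \<in> sal_cells \<Longrightarrow> circle_map H (cell_pt c) = cell_value H c"
  unfolding circle_map_def cell_pt_def
  by (simp add: finite_sal_cells if_distrib[of "\<lambda>a. a *\<^sub>R _"] sum.delta cong: if_cong)

lemma circle_map_seg: "circle_map H (seg x y t) = (1 - t) *\<^sub>R circle_map H x + t *\<^sub>R circle_map H y"
  by (simp add: circle_map_def seg_def scaleR_add_left sum.distrib scaleR_sum_right)

lemma circle_map_comp_seg: "circle_map H \<circ> seg x y = linepath (circle_map H x) (circle_map H y)"
  by (auto simp: circle_map_seg linepath_def)

lemma continuous_circle_map: "continuous_on A (circle_map H)"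
  unfolding circle_map_def
  by (intro continuous_intros continuous_on_subset[OF continuous_on_product_coordinates]) auto

lemma circle_map_vertex: "C \<in> \<R> \<Longrightarrow> circle_map H (vertex C) = of_real (side C H)"
  by (simp add: circle_map_cell_pt sal_cells_def cell_value_def)

lemma circle_map_edge:
  assumes "C \<in> \<R>" "D \<in> \<R>"
  shows "circle_map H \<circ> edge_path C D =
    linepath (of_real (side C H)) (cell_value H (Edge C D)) +++ linepath (cell_value H (Edge C D)) (of_real (side D H))"
proof -
  have "Edge C D \<in> sal_cells" using assms by (force simp: sal_cells_def)
  then show ?thesis
    using assms by (simp add: edge_path_def path_compose_join circle_map_comp_seg circle_map_cell_pt circle_map_vertex)
qed

lemma image_edge_same:
  assumes "C \<in> \<R>" "D \<in> \<R>" "side C H = side D H"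
  shows "circle_map H ` path_image (edge_path C D) = {of_real (side C H)}"
  using assms unfolding path_image_compose[symmetric] circle_map_edge[OF assms(1,2)]
  by (simp add: path_image_join cell_value_def)

lemma image_edge_cross:
  assumes "C \<in> \<R>" "D \<in> \<R>" "side D H = - side C H" "side C H \<noteq> 0"
  shows "circle_map H ` path_image (edge_path C D) = half_turn (of_real (side C H))"
  using assms unfolding path_image_compose[symmetric] circle_map_edge[OF assms(1,2)]
  by (simp add: path_image_join cell_value_def half_turn_def)

lemma image_gallery_same:
  "gallery \<H> C D g \<Longrightarrow> (\<And>E. E \<in> set g \<Longrightarrow> side E H = s) \<Longrightarrow>
   circle_map H ` path_image (gallery_path g) \<subseteq> {of_real s}"
proof (induction g arbitrary: C rule: gallery_path.induct)
  case 1
  then show ?case by (simp add: gallery_def)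
next
  case (2 E)
  then show ?case by (auto simp: gallery_single path_image_def circle_map_vertex)
next
  case (3 C' E g)
  then have *: "adjacent \<H> C' E" "gallery \<H> E D (E # g)" by (auto simp: gallery_Cons)
  then have "circle_map H ` path_image (edge_path C' E) = {of_real s}"
    using image_edge_same[of C' E H] 3(3)[of C'] 3(3)[of E] by (auto simp: adjacent_def)
  moreover have "circle_map H ` path_image (gallery_path (E # g)) \<subseteq> {of_real s}"
    using 3(1)[OF *(2)] 3(3) by simp
  moreover have "path_image (gallery_path (C' # E # g)) = path_image (edge_path C' E) \<union> path_image (gallery_path (E # g))"
    using path_in_gallery[OF *(2)] by (simp add: path_image_join path_in_def)
  ultimately show ?case by (simp add: image_Un)
qed

lemma image_minimal_gallery_same:
  assumes "minimal_gallery \<H> C D g" "H \<in> \<H> - Inv C D"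
  shows "circle_map H ` path_image (gallery_path g) \<subseteq> {of_real (side C H)}"
proof -
  have g: "gallery \<H> C D g" using assms by (simp add: minimal_gallery_def)
  have "side E H = side C H" if "E \<in> set g" for E
  proof -
    have "H \<notin> Inv C E" using minimal_gallery_sep_subset[OF assms(1) that] assms(2) by blast
    moreover have "C \<in> \<R>" "E \<in> \<R>" using galleryD[OF g] that by auto
    ultimately show ?thesis using sep_eq[of C E] assms(2) by simp
  qed
  then show ?thesis using image_gallery_same[OF g] by blast
qed

text \<open>A minimal gallery crosses \<open>H\<close> at most once, so its image is a constant or a
  single half turn.\<close>

lemma image_minimal_gallery:
  assumes H: "H \<in> \<H>"
  shows "minimal_gallery \<H> C D g \<Longrightarrow> circle_map H ` path_image (gallery_path g) \<subseteq> half_turn (of_real (side C H))"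
proof (induction "length g" arbitrary: C g rule: less_induct)
  case less
  from less.prems show ?case
  proof (cases rule: minimal_gallery_cases)
    case 1
    then show ?thesis using half_turn_start by (auto simp: path_image_def circle_map_vertex)
  next
    case (2 E g' K)
    have pi: "path_image (gallery_path g) = path_image (edge_path C E) \<union> path_image (gallery_path (E # g'))"
      using path_in_gallery[of E D "E # g'"] 2 by (simp add: path_image_join path_in_def minimal_gallery_def)
    show ?thesis
    proof (cases "K = H")
      case True
      have opp: "side E H = - side C H" "side C H \<noteq> 0"
        using True 2 sep_eq[of C E] side_cases[of C H] side_cases[of E H] H by auto
      have "circle_map H ` path_image (gallery_path (E # g')) \<subseteq> {of_real (side E H)}"
        using image_minimal_gallery_same[OF 2(9)] H 2(8) True by simp
      then show ?thesis
        using pi image_edge_cross[OF 2(2,3) opp] opp half_turn_end[of "of_real (side C H)"] by (auto simp: image_Un)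
    next
      case False
      have same: "side C H = side E H"
        using False 2 sep_eq[of C E] H by auto
      have "circle_map H ` path_image (gallery_path (E # g')) \<subseteq> half_turn (of_real (side E H))"
        using less.hyps[OF _ 2(9)] 2(1) by simp
      then show ?thesis
        using pi image_edge_same[OF 2(2,3) same] same half_turn_start by (auto simp: image_Un)
    qed
  qed
qed

text \<open>If \<open>F\<close> lies in \<open>H\<close>, the base goes into a half turn and the
  apex to its corner, about which it is star-shaped. Otherwise some point of \<open>F\<close> off
  \<open>H\<close> lies in the closure of every region visited, so all are on one side of
  \<open>H\<close> and the cell is mapped to a point.\<close>

lemma circle_map_two_cell_nonzero:
  assumes H: "H \<in> \<H>" and C: "C \<in> \<R>" and F: "F \<in> codim2_faces \<H>" and x: "x \<in> two_cell \<H> C F"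
  shows "circle_map H x \<noteq> 0"
proof -
  obtain y t g where g: "g \<in> two_cell_galleries \<H> C F" "y \<in> path_image (gallery_path g)"
    and t: "0 \<le> t" "t \<le> 1" and x_eq: "x = seg y (cell_pt (Two_cell C F)) t"
    using x unfolding two_cell_def by blast
  have mg: "minimal_gallery \<H> C (opposite_about \<H> F C) g" and cl: "\<And>D. D \<in> set g \<Longrightarrow> F \<subseteq> closure D"
    using g(1) by (auto simp: two_cell_galleries_def)
  have gg: "gallery \<H> C (opposite_about \<H> F C) g" using mg by (simp add: minimal_gallery_def)
  have val: "circle_map H (cell_pt (Two_cell C F)) = cell_value H (Two_cell C F)"
    by (rule circle_map_cell_pt) (use C F in \<open>force simp: sal_cells_def\<close>)
  have s: "complex_of_real (side C H) = 1 \<or> complex_of_real (side C H) = -1" using side_cases[OF C H] by auto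
  show ?thesis
  proof (cases "F \<subseteq> H")
    case True
    have "circle_map H y \<in> half_turn (of_real (side C H))" using image_minimal_gallery[OF H mg] g(2) by blast
    then have "circle_map H x \<in> half_turn (of_real (side C H))"
      using half_turn_cone[OF _ t] True by (simp add: x_eq circle_map_seg val cell_value_def)
    then show ?thesis using half_turn_nonzero[OF s] by metis
  next
    case False
    then obtain u where u: "u \<in> F" "nvec H \<bullet> u \<noteq> 0" using mem_hyperplane[OF H] by blast
    have "side D H = sgn (nvec H \<bullet> u)" if D: "D \<in> set g" for D
    proof -
      have Dr: "D \<in> \<R>" using D galleryD[OF gg] by blast
      have "0 \<le> side D H * (nvec H \<bullet> u)" using cl[OF D] u closure_region[OF Dr] H by blast
      then show ?thesis using sgn_eqI[OF side_cases[OF Dr H] _ u(2)] by simp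
    qed
    moreover have "C \<in> set g" using gg hd_in_set by (force simp: gallery_def)
    ultimately have "side D H = side C H" if "D \<in> set g" for D using that by metis
    then have "circle_map H y = of_real (side C H)"
      using image_gallery_same[OF gg] g(2) by blast
    then have "circle_map H x = of_real (side C H)"
      using False by (simp add: x_eq circle_map_seg val cell_value_def scaleR_left_diff_distrib)
    then show ?thesis using s by auto
  qed
qed

lemma circle_map_nonzero:
  assumes H: "H \<in> \<H>" and x: "x \<in> salvetti \<H>"
  shows "circle_map H x \<noteq> 0"
proof -
  from x consider (v) C where "C \<in> \<R>" "x = vertex C"
    | (e) C D where "adjacent \<H> C D" "x \<in> path_image (edge_path C D)"
    | (t) C F where "C \<in> \<R>" "F \<in> codim2_faces \<H>" "x \<in> two_cell \<H> C F"
    unfolding salvetti_def by blast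
  then show ?thesis
  proof cases
    case v
    then show ?thesis using side_cases[OF v(1) H] by (auto simp: circle_map_vertex)
  next
    case e
    then have r: "C \<in> \<R>" "D \<in> \<R>" by (auto simp: adjacent_def)
    have s: "complex_of_real (side C H) = 1 \<or> complex_of_real (side C H) = -1" using side_cases[OF r(1) H] by auto
    have "circle_map H x \<in> half_turn (of_real (side C H))"
    proof (cases "side C H = side D H")
      case True
      from image_edge_same[OF r True] have "circle_map H x = of_real (side C H)" using e(2) by blast
      then show ?thesis using half_turn_start by simp
    next
      case False
      then have "side D H = - side C H" "side C H \<noteq> 0" using side_cases[OF r(1) H] side_cases[OF r(2) H] by auto
      from image_edge_cross[OF r this] show ?thesis using e(2) by blast
    qed
    then show ?thesis using half_turn_nonzero[OF s] by metis
  next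
    case t
    then show ?thesis using circle_map_two_cell_nonzero[OF H] by blast
  qed
qed

text \<open>Images of edges need not be closed, so their winding number may be complex; its real
  part is the total change of argument divided by a full turn.\<close>

definition winding :: "'a set \<Rightarrow> (real \<Rightarrow> 'a set cell \<Rightarrow> real) \<Rightarrow> real" where
  "winding H p = Re (winding_number (circle_map H \<circ> p) 0)"

lemma winding_homotopic:
  assumes "H \<in> \<H>" "homotopic_paths (salvetti \<H>) p q"
  shows "winding H p = winding H q"
proof -
  have "homotopic_paths (- {0}) (circle_map H \<circ> p) (circle_map H \<circ> q)"
    by (rule homotopic_paths_continuous_image[OF assms(2) continuous_circle_map])
      (use circle_map_nonzero[OF assms(1)] in auto)
  from winding_number_homotopic_paths[OF this] show ?thesis by (simp add: winding_def)
qed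

lemma path_circle_map:
  assumes "H \<in> \<H>" "path_in (salvetti \<H>) a b p"
  shows "path (circle_map H \<circ> p)" "0 \<notin> path_image (circle_map H \<circ> p)"
  using assms circle_map_nonzero[OF assms(1)]
  by (auto simp: path_in_def path_image_compose intro!: path_continuous_image continuous_circle_map)

lemma winding_join:
  assumes "H \<in> \<H>" "path_in (salvetti \<H>) a b p" "path_in (salvetti \<H>) b c q"
  shows "winding H (p +++ q) = winding H p + winding H q"
proof -
  have "pathfinish (circle_map H \<circ> p) = pathstart (circle_map H \<circ> q)"
    using assms(2,3) by (simp add: path_in_def pathfinish_compose pathstart_compose)
  then show ?thesis
    using winding_number_join path_circle_map[OF assms(1,2)] path_circle_map[OF assms(1,3)]
    by (simp add: winding_def path_compose_join)
qed

lemma winding_reversepath: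
  assumes "H \<in> \<H>" "path_in (salvetti \<H>) a b p"
  shows "winding H (reversepath p) = - winding H p"
  using winding_number_reversepath path_circle_map[OF assms]
  by (simp add: winding_def path_compose_reversepath)

lemma winding_edge:
  assumes H: "H \<in> \<H>" and adj: "adjacent \<H> C D"
  shows "H \<in> Inv C D \<Longrightarrow> winding H (edge_path C D) > 0"
    "H \<notin> Inv C D \<Longrightarrow> winding H (edge_path C D) = 0"
proof -
  have r: "C \<in> \<R>" "D \<in> \<R>" using adj by (auto simp: adjacent_def)
  let ?s = "complex_of_real (side C H)"
  have s: "?s = 1 \<or> ?s = -1" using side_cases[OF r(1) H] by auto
  { assume "H \<in> Inv C D"
    then have o: "side D H = - side C H" "side C H \<noteq> 0" 
      using side_cases[OF r(1) H] side_cases[OF r(2) H] by (auto simp: sep_eq[OF r])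
    then have ne: "side C H \<noteq> side D H" by auto
    have z: "0 \<notin> closed_segment ?s (?s * \<i>)" "0 \<notin> closed_segment (?s * \<i>) (- ?s)"
      using half_turn_nonzero[OF s] by (auto simp: half_turn_def)
    have "0 < Re (winding_number (linepath ?s (?s * \<i>)) 0)"
      "0 < Re (winding_number (linepath (?s * \<i>) (- ?s)) 0)"
      using s by (auto intro!: winding_number_linepath_pos_lt)
    then show "winding H (edge_path C D) > 0"
      using ne o z by (simp add: winding_def circle_map_edge[OF r] cell_value_def winding_number_join) }
  { assume "H \<notin> Inv C D"
    then have "side D H = side C H" using H by (auto simp: sep_eq[OF r])
    moreover have "?s \<noteq> 0" using s by auto
    ultimately show "winding H (edge_path C D) = 0"
      by (simp add: winding_def circle_map_edge[OF r] cell_value_def winding_number_join) }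
qed

section \<open>Winding numbers of homotopy classes\<close>

definition class_winding :: "'a set \<Rightarrow> 'a sal_elem \<Rightarrow> real" where
  "class_winding H X = winding H (SOME p. p \<in> X)"

lemma class_winding_eq:
  assumes "H \<in> \<H>" "path_in (salvetti \<H>) a b p"
  shows "class_winding H (homotopy_class (salvetti \<H>) p) = winding H p"
proof -
  have "p \<in> homotopy_class (salvetti \<H>) p" using assms by (simp add: homotopy_class_def path_in_def)
  then have "(SOME q. q \<in> homotopy_class (salvetti \<H>) p) \<in> homotopy_class (salvetti \<H>) p"
    unfolding some_in_eq by blast
  then show ?thesis
    unfolding class_winding_def using winding_homotopic[OF assms(1)] by (simp add: homotopy_class_def)
qed

lemma class_winding_mult:
  assumes "H \<in> \<H>" "X \<in> carrier (sal_group \<H> B)" "Y \<in> carrier (sal_group \<H> B)"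
  shows "class_winding H (X \<odot> Y) = class_winding H X + class_winding H Y"
proof -
  obtain p q where p: "path_in (salvetti \<H>) (vertex B) (vertex B) p" "X = homotopy_class (salvetti \<H>) p"
    and q: "path_in (salvetti \<H>) (vertex B) (vertex B) q" "Y = homotopy_class (salvetti \<H>) q"
    using assms by (auto simp: sal_group_def carrier_fundamental_group)
  show ?thesis
    unfolding p(2) q(2) path_mult_class[OF p(1) q(1)]
    using class_winding_eq[OF assms(1) path_in_join[OF p(1) q(1)]] class_winding_eq[OF assms(1) p(1)]
      class_winding_eq[OF assms(1) q(1)] winding_join[OF assms(1) p(1) q(1)] by simp
qed

text \<open>The gallery and its reverse cancel, while both directions of the edge turn
  counterclockwise and therefore add up.\<close>

lemma class_winding_edge_loop:
  assumes H: "H \<in> \<H>" and B: "B \<in> \<R>" and adj: "adjacent \<H> C' C"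
  shows "H \<in> Inv C' C \<Longrightarrow> class_winding H (edge_loop \<H> B C' C) > 0"
    "H \<notin> Inv C' C \<Longrightarrow> class_winding H (edge_loop \<H> B C' C) = 0"
proof -
  have adj': "adjacent \<H> C C'" and r: "C' \<in> \<R>" "C \<in> \<R>"
    using adj sep_commute by (auto simp: adjacent_iff)
  note g = path_in_gal[OF B r(1)] and e = path_in_edge[OF adj] path_in_edge[OF adj']
  note g' = path_in_reversepath[OF g]
  have "class_winding H (edge_loop \<H> B C' C) = winding H (edge_path C' C) + winding H (edge_path C C')"
    unfolding edge_loop_def
    using class_winding_eq[OF H path_in_edge_loop[OF B adj]] winding_join[OF H g path_in_join[OF e(1) path_in_join[OF e(2) g']]]
      winding_join[OF H e(1) path_in_join[OF e(2) g']] winding_join[OF H e(2) g'] winding_reversepath[OF H g]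
    by simp
  then show "H \<in> Inv C' C \<Longrightarrow> class_winding H (edge_loop \<H> B C' C) > 0"
    "H \<notin> Inv C' C \<Longrightarrow> class_winding H (edge_loop \<H> B C' C) = 0"
    using winding_edge[OF H adj] winding_edge[OF H adj'] sep_commute[OF r] by (auto simp: add_pos_pos)
qed

section \<open>The pure shard monoid\<close>

lemma sal_group_mult:
  "X \<in> carrier (sal_group \<H> B) \<Longrightarrow> Y \<in> carrier (sal_group \<H> B) \<Longrightarrow> X \<otimes>\<^bsub>sal_group \<H> B\<^esub> Y = X \<odot> Y"
  unfolding sal_group_def by (rule mult_fundamental_group)

lemma sal_group_one: "\<one>\<^bsub>sal_group \<H> B\<^esub> = gallery_class [B]"
  by (simp add: sal_group_def one_fundamental_group gallery_class_def)

lemma sal_group_unit: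
  assumes "X \<in> carrier (sal_group \<H> B)"
  shows "gallery_class [B] \<odot> X = X" "X \<odot> gallery_class [B] = X"
proof -
  obtain p where p: "path_in (salvetti \<H>) (vertex B) (vertex B) p" "X = homotopy_class (salvetti \<H>) p"
    using assms by (auto simp: sal_group_def carrier_fundamental_group)
  show "gallery_class [B] \<odot> X = X" "X \<odot> gallery_class [B] = X"
    unfolding p(2) gallery_class_def gallery_path.simps
    by (rule path_mult_const_left[OF p(1)], rule path_mult_const_right[OF p(1)])
qed

lemma submonoid_sal_group: "B \<in> \<R> \<Longrightarrow> submonoid (carrier (sal_group \<H> B)) (sal_group \<H> B)"
  unfolding sal_group_def by (intro submonoid_fundamental_group vertex_in_salvetti)

lemma edge_loop_in_sal_group:
  "B \<in> \<R> \<Longrightarrow> adjacent \<H> C' C \<Longrightarrow> edge_loop \<H> B C' C \<in> carrier (sal_group \<H> B)"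
  unfolding edge_loop_def sal_group_def carrier_fundamental_group using path_in_edge_loop by blast

lemma covers_adjacent: "B \<in> \<R> \<Longrightarrow> covers \<H> B C' C \<Longrightarrow> adjacent \<H> C' C"
  using covers_iff by (auto simp: adjacent_iff)

abbreviation shard_monoid :: "'a set \<Rightarrow> 'a sal_elem set" where
  "shard_monoid B \<equiv> carrier (pure_shard_monoid \<H> B)"

lemma shard_monoid_mult: "mult (pure_shard_monoid \<H> B) = mult (sal_group \<H> B)"
  and shard_monoid_one: "\<one>\<^bsub>pure_shard_monoid \<H> B\<^esub> = \<one>\<^bsub>sal_group \<H> B\<^esub>"
  by (simp_all add: pure_shard_monoid_def)

lemma shard_monoid_subset:
  assumes "submonoid M (sal_group \<H> B)" "\<And>C' C. covers \<H> B C' C \<Longrightarrow> edge_loop \<H> B C' C \<in> M"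
  shows "shard_monoid B \<subseteq> M"
proof -
  have "{edge_loop \<H> B C' C | C' C. covers \<H> B C' C} \<subseteq> M" using assms(2) by blast
  then have "(\<lambda>M. submonoid M (sal_group \<H> B)) hull {edge_loop \<H> B C' C | C' C. covers \<H> B C' C} \<subseteq> M"
    using assms(1) by (intro hull_minimal)
  then show ?thesis by (simp add: pure_shard_monoid_def)
qed

lemma shard_monoid_in_sal_group:
  assumes "B \<in> \<R>"
  shows "shard_monoid B \<subseteq> carrier (sal_group \<H> B)"
  using shard_monoid_subset[OF submonoid_sal_group[OF assms]] edge_loop_in_sal_group[OF assms]
    covers_adjacent[OF assms] by blast

lemma edge_loop_in_shard_monoid: "covers \<H> B C' C \<Longrightarrow> edge_loop \<H> B C' C \<in> shard_monoid B"
  using hull_subset[of "{edge_loop \<H> B C' C | C' C. covers \<H> B C' C}" "\<lambda>M. submonoid M (sal_group \<H> B)"]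
  unfolding pure_shard_monoid_def by auto

lemma mem_shard_monoid:
  "X \<in> shard_monoid B \<longleftrightarrow> (\<forall>M. submonoid M (sal_group \<H> B) \<longrightarrow>
     {edge_loop \<H> B C' C | C' C. covers \<H> B C' C} \<subseteq> M \<longrightarrow> X \<in> M)"
  by (simp add: pure_shard_monoid_def hull_def imp_conjL)

lemma shard_monoid_mult_closed:
  assumes "B \<in> \<R>" "X \<in> shard_monoid B" "Y \<in> shard_monoid B"
  shows "X \<odot> Y \<in> shard_monoid B"
proof -
  have "X \<otimes>\<^bsub>sal_group \<H> B\<^esub> Y \<in> shard_monoid B"
    unfolding mem_shard_monoid
  proof (intro allI impI)
    fix M assume M: "submonoid M (sal_group \<H> B)" "{edge_loop \<H> B C' C | C' C. covers \<H> B C' C} \<subseteq> M"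
    then have "X \<in> M" "Y \<in> M" using assms(2,3) unfolding mem_shard_monoid by blast+
    then show "X \<otimes>\<^bsub>sal_group \<H> B\<^esub> Y \<in> M" by (rule submonoid.m_closed[OF M(1)])
  qed
  moreover have "X \<in> carrier (sal_group \<H> B)" "Y \<in> carrier (sal_group \<H> B)"
    using assms shard_monoid_in_sal_group by blast+
  ultimately show ?thesis by (simp only: sal_group_mult)
qed

lemma one_in_shard_monoid: "gallery_class [B] \<in> shard_monoid B"
  unfolding mem_shard_monoid sal_group_one[symmetric] using submonoid.one_closed by blast

lemma class_winding_one:
  assumes "B \<in> \<R>" "H \<in> \<H>"
  shows "class_winding H (gallery_class [B]) = 0"
proof -
  have mem: "gallery_class [B] \<in> carrier (sal_group \<H> B)"
    using one_in_shard_monoid shard_monoid_in_sal_group[OF assms(1)] by blast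
  show ?thesis
    using class_winding_mult[OF assms(2) mem mem] sal_group_unit(1)[OF mem] by simp
qed

text \<open>The second claim is what later makes divisibility antisymmetric.\<close>

lemma shard_monoid_winding:
  assumes B: "B \<in> \<R>" and X: "X \<in> shard_monoid B"
  shows "H \<in> \<H> \<Longrightarrow> 0 \<le> class_winding H X"
    "(\<And>H. H \<in> \<H> \<Longrightarrow> class_winding H X = 0) \<Longrightarrow> X = gallery_class [B]"
proof -
  \<comment> \<open>The dichotomy survives products because a sum of nonnegative numbers is positive
    as soon as one of them is; generators satisfy it through the hyperplane they cross.\<close>
  define M where "M = {X \<in> carrier (sal_group \<H> B). (\<forall>H\<in>\<H>. 0 \<le> class_winding H X) \<and>
    (X = gallery_class [B] \<or> (\<exists>H\<in>\<H>. 0 < class_winding H X))}"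
  have "submonoid M (sal_group \<H> B)"
  proof
    show "M \<subseteq> carrier (sal_group \<H> B)" by (auto simp: M_def)
    show "\<one>\<^bsub>sal_group \<H> B\<^esub> \<in> M"
      using submonoid.one_closed[OF submonoid_sal_group[OF B]] class_winding_one[OF B]
      by (simp add: M_def sal_group_one)
    fix X Y assume X: "X \<in> M" and Y: "Y \<in> M"
    then have c: "X \<in> carrier (sal_group \<H> B)" "Y \<in> carrier (sal_group \<H> B)" by (auto simp: M_def)
    have nn: "0 \<le> class_winding H X" "0 \<le> class_winding H Y" if "H \<in> \<H>" for H
      using X Y that by (auto simp: M_def)
    have W: "class_winding H (X \<odot> Y) = class_winding H X + class_winding H Y" if "H \<in> \<H>" for H
      using class_winding_mult[OF that c] .
    have "X \<odot> Y = gallery_class [B] \<or> (\<exists>H\<in>\<H>. 0 < class_winding H (X \<odot> Y))"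
    proof (cases "X = gallery_class [B] \<and> Y = gallery_class [B]")
      case True
      then show ?thesis using sal_group_unit(1)[OF c(2)] by simp
    next
      case False
      then obtain H where "H \<in> \<H>" "0 < class_winding H X \<or> 0 < class_winding H Y"
        using X Y by (auto simp: M_def)
      then show ?thesis using W[of H] nn[of H] by (intro disjI2 bexI[of _ H]) auto
    qed
    moreover have "X \<odot> Y \<in> carrier (sal_group \<H> B)"
      using submonoid.m_closed[OF submonoid_sal_group[OF B] c] sal_group_mult[OF c] by simp
    ultimately show "X \<otimes>\<^bsub>sal_group \<H> B\<^esub> Y \<in> M"
      unfolding sal_group_mult[OF c] using W nn by (simp add: M_def)
  qed
  moreover have "edge_loop \<H> B C' C \<in> M" if cov: "covers \<H> B C' C" for C' C
  proof -
    note adj = covers_adjacent[OF B cov]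
    obtain K where K: "Inv C' C = {K}" "K \<in> \<H>" using adj sep_subset by (force simp: adjacent_iff)
    have "0 \<le> class_winding H (edge_loop \<H> B C' C)" if "H \<in> \<H>" for H
      using class_winding_edge_loop[OF that B adj] by force
    moreover have "0 < class_winding K (edge_loop \<H> B C' C)"
      using class_winding_edge_loop(1)[OF K(2) B adj] K(1) by simp
    ultimately show ?thesis
      using edge_loop_in_sal_group[OF B adj] K(2) by (auto simp: M_def)
  qed
  ultimately have "X \<in> M" using shard_monoid_subset X by blast
  then show "H \<in> \<H> \<Longrightarrow> 0 \<le> class_winding H X"
    "(\<And>H. H \<in> \<H> \<Longrightarrow> class_winding H X = 0) \<Longrightarrow> X = gallery_class [B]"
    by (auto simp: M_def)
qed

section \<open>The map Pow\<close>

definition round_trip :: "'a set \<Rightarrow> 'a set \<Rightarrow> 'a sal_elem" where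
  "round_trip B C = gal_class B C \<odot> gal_class C B"

lemma gal_class_cover:
  assumes r: "B \<in> \<R>" "C \<in> \<R>" "D \<in> \<R>" and H: "Inv C D = {H}" "H \<notin> Inv B C"
  shows "gal_class B D = gal_class B C \<odot> edge_class C D" "gal_class D B = edge_class D C \<odot> gal_class C B"
proof -
  show "gal_class B D = gal_class B C \<odot> edge_class C D"
    using gal_class_trans[OF r] gal_class_adjacent[OF r(2,3) H(1)] H by simp
  have DC: "Inv D C = {H}" using H sep_commute r by simp
  show "gal_class D B = edge_class D C \<odot> gal_class C B"
    using gal_class_trans[OF r(3,2,1)] gal_class_adjacent[OF r(3,2) DC] H(2) DC sep_commute[OF r(1,2)] by simp
qed

text \<open>The inverse gallery at the end of the loop cancels against the way out. The loop
  multiplies from the left, matching the order of factors in Pow, where the last edge comes first;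
  this is the telescoping step.\<close>

lemma edge_loop_round_trip:
  assumes r: "B \<in> \<R>" "C \<in> \<R>" "E \<in> \<R>" and H: "Inv C E = {H}" "H \<notin> Inv B C"
  shows "edge_loop \<H> B C E \<odot> round_trip B C = round_trip B E"
proof -
  have adj: "adjacent \<H> C E" using r H by (auto simp: adjacent_iff)
  have "edge_loop \<H> B C E \<odot> round_trip B C
      = gal_class B C \<odot> edge_class C E \<odot> edge_class E C \<odot> (gal_inv B C \<odot> gal_class B C) \<odot> gal_class C B"
    by (simp add: edge_loop_eq[OF r(1) adj] round_trip_def path_mult_assoc)
  also have "\<dots> = gal_class B C \<odot> edge_class C E \<odot> edge_class E C \<odot> gal_class C B"
    by (simp add: gal_inv r gal_class_unit)
  also have "\<dots> = round_trip B E" by (simp add: round_trip_def gal_class_cover[OF r H] path_mult_assoc)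
  finally show ?thesis .
qed

lemma round_trip_cover:
  assumes r: "B \<in> \<R>" "C \<in> \<R>" "D \<in> \<R>" and H: "Inv C D = {H}" "H \<notin> Inv B C"
  shows "round_trip B D = round_trip B C \<odot> edge_loop \<H> B (opp D) (opp C)" "covers \<H> B (opp D) (opp C)"
proof -
  have H': "H \<in> \<H>" using H(1) sep_subset[of C D] by auto
  have ro: "opp C \<in> \<R>" "opp D \<in> \<R>" using opp(1) r by auto
  have BD: "Inv B D = insert H (Inv B C)" using sep_trans[OF r] H by auto
  have so: "Inv (opp D) (opp C) = {H}"
    using sep_opp_left[OF r(3) ro(1)] sep_opp_right[OF r(3,2)] sep_commute[OF r(2,3)] H H' by auto
  have BoD: "Inv B (opp D) = \<H> - Inv B D" using sep_opp_right[OF r(1,3)] .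
  show "covers \<H> B (opp D) (opp C)"
    unfolding covers_iff[OF r(1)] using ro so BoD BD by blast
  have adj: "adjacent \<H> (opp D) (opp C)" using ro so by (auto simp: adjacent_iff)
  have tr: "gal_class C (opp D) = gal_class C B \<odot> gal_class B (opp D)"
  proof (rule gal_class_trans[OF r(2,1) ro(2)])
    show "Inv C B \<inter> Inv B (opp D) = {}"
      using BoD BD sep_commute[OF r(1,2)] by auto
  qed
  have "H \<notin> Inv C (opp D)" using sep_opp_right[OF r(2,3)] H by simp
  note slide = edge_class_slide[OF r(2,3) ro(2,1) H(1) so this]
  \<comment> \<open>Inserting \<open>gal(B,-D)\<close> and its inverse prolongs the gallery from
    \<open>C\<close> to \<open>B\<close> as far as \<open>-D\<close>, where the edge can be
    slid.\<close>
  have "edge_class C D \<odot> edge_class D C \<odot> gal_class C B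
      = edge_class C D \<odot> edge_class D C \<odot> gal_class C B \<odot> (gal_class B (opp D) \<odot> gal_inv B (opp D))"
    using gal_class_unit(2)[OF r(2,1)] by (simp add: gal_inv r ro)
  also have "\<dots> = (edge_class C D \<odot> edge_class D C \<odot> gal_class C (opp D)) \<odot> gal_inv B (opp D)"
    by (simp add: tr path_mult_assoc)
  also have "\<dots> = gal_class C B \<odot> edge_loop \<H> B (opp D) (opp C)"
    unfolding slide by (simp add: tr path_mult_assoc edge_loop_eq[OF r(1) adj])
  finally show "round_trip B D = round_trip B C \<odot> edge_loop \<H> B (opp D) (opp C)"
    by (simp add: round_trip_def gal_class_cover[OF r H] path_mult_assoc)
qed

text \<open>The induction removes the first edge, so the start must be any \<open>C\<close> from
  which the gallery prolongs a minimal one from \<open>B\<close>. The product is then described by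
  what it does to \<open>round_trip B C\<close>.\<close>

lemma gallery_pow:
  assumes B: "B \<in> \<R>"
  shows "minimal_gallery \<H> C D g \<Longrightarrow> Inv B C \<inter> Inv C D = {} \<Longrightarrow>
    gallery_pow \<H> B g \<in> shard_monoid B \<and> gallery_pow \<H> B g \<odot> round_trip B C = round_trip B D \<and>
    (\<forall>H\<in>\<H>. class_winding H (gallery_pow \<H> B g) > 0 \<longleftrightarrow> H \<in> Inv C D)"
proof (induction "length g" arbitrary: C g rule: less_induct)
  case less
  from less.prems(1) show ?case
  proof (cases rule: minimal_gallery_cases)
    case 1
    have "gallery_class [B] \<odot> round_trip B C = round_trip B C"
      using gal_class_unit(1)[OF B 1(3)] by (simp add: round_trip_def path_mult_assoc[symmetric])
    then show ?thesis
      using 1 one_in_shard_monoid sep_empty_iff[of C C] class_winding_one[OF B]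
      by (simp add: shard_monoid_one sal_group_one)
  next
    case (2 E g' K)
    have KBC: "K \<notin> Inv B C" using 2(7) less.prems(2) by blast
    have cov: "covers \<H> B C E" using covers_iff[OF B] 2(2,3,6) KBC by blast
    have BE: "Inv B E = insert K (Inv B C)" using sep_trans[OF B 2(2,3)] 2(6) KBC by auto
    have "Inv B E \<inter> Inv E D = {}" using BE 2(8) less.prems(2) by auto
    then have IH: "gallery_pow \<H> B (E # g') \<in> shard_monoid B"
      "gallery_pow \<H> B (E # g') \<odot> round_trip B E = round_trip B D"
      "\<And>H. H \<in> \<H> \<Longrightarrow> class_winding H (gallery_pow \<H> B (E # g')) > 0 \<longleftrightarrow> H \<in> Inv E D"
      using less.hyps[OF _ 2(9)] 2(1) by auto
    note l = edge_loop_in_shard_monoid[OF cov]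
    have car: "gallery_pow \<H> B (E # g') \<in> carrier (sal_group \<H> B)" "edge_loop \<H> B C E \<in> carrier (sal_group \<H> B)"
      using IH(1) l shard_monoid_in_sal_group[OF B] by auto
    have eq: "gallery_pow \<H> B g = gallery_pow \<H> B (E # g') \<odot> edge_loop \<H> B C E"
      using 2(1) sal_group_mult[OF car] by (simp add: shard_monoid_mult shard_loop_eq[OF B cov])
    have W: "class_winding H (gallery_pow \<H> B g) > 0 \<longleftrightarrow> H \<in> Inv C D" if H: "H \<in> \<H>" for H
    proof -
      have "class_winding H (edge_loop \<H> B C E) > 0 \<longleftrightarrow> H = K"
        using class_winding_edge_loop[OF H B 2(5)] unfolding 2(6) by (cases "H = K") simp_all
      moreover have "H \<in> Inv C D \<longleftrightarrow> H = K \<or> H \<in> Inv E D" using 2(7,8) by blast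
      moreover note shard_monoid_winding(1)[OF B IH(1) H] shard_monoid_winding(1)[OF B l H] IH(3)[OF H]
      ultimately show ?thesis
        unfolding eq class_winding_mult[OF H car] by linarith
    qed
    have "gallery_pow \<H> B g \<odot> round_trip B C = round_trip B D"
      unfolding eq path_mult_assoc edge_loop_round_trip[OF B 2(2,3,6) KBC] by (rule IH(2))
    moreover have "gallery_pow \<H> B g \<in> shard_monoid B"
      unfolding eq by (rule shard_monoid_mult_closed[OF B IH(1) l])
    ultimately show ?thesis using W by blast
  qed
qed

lemma region_pow:
  assumes B: "B \<in> \<R>" and C: "C \<in> \<R>"
  shows "region_pow \<H> B C = round_trip B C" "region_pow \<H> B C \<in> shard_monoid B"
    "H \<in> \<H> \<Longrightarrow> class_winding H (region_pow \<H> B C) > 0 \<longleftrightarrow> H \<in> Inv B C"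
proof -
  have *: "region_pow \<H> B C \<in> shard_monoid B" "region_pow \<H> B C \<odot> round_trip B B = round_trip B C"
    "\<forall>H\<in>\<H>. class_winding H (region_pow \<H> B C) > 0 \<longleftrightarrow> H \<in> Inv B C"
    using gallery_pow[OF B minimal_gallery_gal[OF B C]] sep_empty_iff[OF B B]
    by (auto simp: region_pow_def)
  have "round_trip B B = gallery_class [B]"
    using gal_class_unit(1)[OF B B] by (simp add: round_trip_def gal_class_refl[OF B])
  then show "region_pow \<H> B C = round_trip B C"
    using * sal_group_unit(2)[OF subsetD[OF shard_monoid_in_sal_group[OF B] *(1)]] by simp
  show "region_pow \<H> B C \<in> shard_monoid B" "H \<in> \<H> \<Longrightarrow> class_winding H (region_pow \<H> B C) > 0 \<longleftrightarrow> H \<in> Inv B C"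
    using * by auto
qed

text \<open>Since \<open>Inv C D\<close> is the difference of the two inversion sets, every step of
  a minimal gallery from \<open>C\<close> to \<open>D\<close> goes up in the poset and contributes
  one right factor.\<close>

lemma round_trip_mono:
  assumes B: "B \<in> \<R>"
  shows "C \<in> \<R> \<Longrightarrow> D \<in> \<R> \<Longrightarrow> Inv B C \<subseteq> Inv B D \<Longrightarrow>
    \<exists>q\<in>shard_monoid B. round_trip B D = round_trip B C \<odot> q"
proof (induction "card (Inv C D)" arbitrary: C rule: less_induct)
  case less
  note r = less.prems(1,2)
  have CD: "Inv C D = Inv B D - Inv B C"
    using sep_trans[OF r(1) B r(2)] sep_commute[OF B r(1)] less.prems(3) by auto
  from minimal_gallery_gal[OF r] show ?case
  proof (cases rule: minimal_gallery_cases)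
    case 1
    have "round_trip B C \<odot> gallery_class [B] = round_trip B C"
      using gal_class_unit(2)[OF r(1) B] by (simp add: round_trip_def path_mult_assoc)
    then show ?thesis using 1 one_in_shard_monoid by metis
  next
    case (2 E g' H)
    have H: "H \<notin> Inv B C" "H \<in> Inv B D" using 2(7) CD by auto
    have BE: "Inv B E = insert H (Inv B C)" using sep_trans[OF B 2(2,3)] 2(6) H by auto
    have "card (Inv E D) < card (Inv C D)" using 2(7,8) by (metis card_Diff1_less finite_sep)
    moreover have "Inv B E \<subseteq> Inv B D" unfolding BE using H less.prems(3) by simp
    ultimately obtain q where q: "q \<in> shard_monoid B" "round_trip B D = round_trip B E \<odot> q"
      using less.hyps[OF _ 2(3) r(2)] by blast
    note c = round_trip_cover[OF B 2(2,3,6) H(1)]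
    have "round_trip B D = round_trip B C \<odot> (edge_loop \<H> B (opp E) (opp C) \<odot> q)"
      unfolding q(2) c(1) by (rule path_mult_assoc)
    then show ?thesis
      using shard_monoid_mult_closed[OF B edge_loop_in_shard_monoid[OF c(2)] q(1)] by blast
  qed
qed

lemma full_twist_eq:
  assumes B: "B \<in> \<R>"
  shows "full_twist \<H> B = round_trip B (opp B)"
  unfolding full_twist_def opposite_region_eq[OF B] round_trip_def gal_class_def gallery_class_def
  using path_mult_class[OF path_in_gal path_in_gal] B opp(1)[OF B] by simp

section \<open>The interval and the order embedding\<close>

lemma le_pure_shard_poset:
  assumes B: "B \<in> \<R>" and p: "p \<in> shard_monoid B"
  shows "p \<sqsubseteq>\<^bsub>pure_shard_poset \<H> B\<^esub> p' \<longleftrightarrow> (\<exists>q\<in>shard_monoid B. p' = p \<odot> q)"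
proof -
  have "p \<otimes>\<^bsub>sal_group \<H> B\<^esub> q = p \<odot> q" if "q \<in> shard_monoid B" for q
    using sal_group_mult subsetD[OF shard_monoid_in_sal_group[OF B]] p that by simp
  then have "(\<exists>q\<in>shard_monoid B. p' = p \<otimes>\<^bsub>sal_group \<H> B\<^esub> q) \<longleftrightarrow> (\<exists>q\<in>shard_monoid B. p' = p \<odot> q)"
    by (simp cong: bex_cong)
  then show ?thesis by (simp add: pure_shard_poset_def Let_def shard_monoid_mult)
qed

lemma carrier_pure_shard_interval:
  "carrier (pure_shard_interval \<H> B) = {p \<in> shard_monoid B.
     \<one>\<^bsub>sal_group \<H> B\<^esub> \<sqsubseteq>\<^bsub>pure_shard_poset \<H> B\<^esub> p \<and> p \<sqsubseteq>\<^bsub>pure_shard_poset \<H> B\<^esub> full_twist \<H> B}"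
  by (simp add: pure_shard_interval_def at_least_at_most_def shard_monoid_one)
    (simp add: pure_shard_poset_def Let_def)

lemma le_pure_shard_interval:
  "p \<sqsubseteq>\<^bsub>pure_shard_interval \<H> B\<^esub> p' \<longleftrightarrow> p \<sqsubseteq>\<^bsub>pure_shard_poset \<H> B\<^esub> p'"
  and eq_pure_shard_interval: "p .=\<^bsub>pure_shard_interval \<H> B\<^esub> p' \<longleftrightarrow> p = p'"
  by (simp_all add: pure_shard_interval_def pure_shard_poset_def Let_def)

text \<open>For antisymmetry, let \<open>y\<close> be \<open>x\<close> times \<open>q\<close> and
  \<open>x\<close> be \<open>y\<close> times \<open>q'\<close>. The windings of \<open>q\<close> and
  \<open>q'\<close> are nonnegative and cancel, so those of \<open>q\<close> vanish and
  \<open>q\<close> is the unit.\<close>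

lemma weak_partial_order_pure_shard_interval:
  assumes B: "B \<in> \<R>"
  shows "weak_partial_order (pure_shard_interval \<H> B)"
proof
  let ?I = "pure_shard_interval \<H> B"
  note car = shard_monoid_in_sal_group[OF B]
  note le = le_pure_shard_poset[OF B]
  have sub: "p \<in> shard_monoid B" if "p \<in> carrier ?I" for p
    using that by (simp add: carrier_pure_shard_interval)
  fix x y z assume x: "x \<in> carrier ?I"
  show "x .=\<^bsub>?I\<^esub> x" by (simp add: eq_pure_shard_interval)
  show "x \<sqsubseteq>\<^bsub>?I\<^esub> x"
    unfolding le_pure_shard_interval le[OF sub[OF x]]
    using sal_group_unit(2)[OF subsetD[OF car sub[OF x]]]
    by (intro bexI[OF _ one_in_shard_monoid]) simp
  assume y: "y \<in> carrier ?I"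
  show "x .=\<^bsub>?I\<^esub> y \<Longrightarrow> y .=\<^bsub>?I\<^esub> x"
    by (simp add: eq_pure_shard_interval)
  show "x .=\<^bsub>?I\<^esub> y" if xy: "x \<sqsubseteq>\<^bsub>?I\<^esub> y" and yz: "y \<sqsubseteq>\<^bsub>?I\<^esub> x"
  proof -
    obtain q where q: "q \<in> shard_monoid B" "y = x \<odot> q"
      using xy unfolding le_pure_shard_interval le[OF sub[OF x]] by blast
    obtain q' where q': "q' \<in> shard_monoid B" "x = y \<odot> q'"
      using yz unfolding le_pure_shard_interval le[OF sub[OF y]] by blast
    have "class_winding H q = 0" if H: "H \<in> \<H>" for H
    proof -
      have "class_winding H y = class_winding H x + class_winding H q"
        unfolding q(2) by (rule class_winding_mult[OF H subsetD[OF car sub[OF x]] subsetD[OF car q(1)]])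
      moreover have "class_winding H x = class_winding H y + class_winding H q'"
        by (subst q'(2)) (rule class_winding_mult[OF H subsetD[OF car sub[OF y]] subsetD[OF car q'(1)]])
      ultimately show ?thesis
        using shard_monoid_winding(1)[OF B q(1) H] shard_monoid_winding(1)[OF B q'(1) H] by simp
    qed
    then have "q = gallery_class [B]" by (rule shard_monoid_winding(2)[OF B q(1)])
    then have "y = x" using q(2) sal_group_unit(2)[OF subsetD[OF car sub[OF x]]] by simp
    then show ?thesis by (simp add: eq_pure_shard_interval)
  qed
  assume z: "z \<in> carrier ?I"
  show "x .=\<^bsub>?I\<^esub> y \<Longrightarrow> y .=\<^bsub>?I\<^esub> z \<Longrightarrow> x .=\<^bsub>?I\<^esub> z"
    by (simp add: eq_pure_shard_interval)
  show "x \<sqsubseteq>\<^bsub>?I\<^esub> z"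
    if xy: "x \<sqsubseteq>\<^bsub>?I\<^esub> y" and yz: "y \<sqsubseteq>\<^bsub>?I\<^esub> z"
  proof -
    obtain q where q: "q \<in> shard_monoid B" "y = x \<odot> q"
      using xy unfolding le_pure_shard_interval le[OF sub[OF x]] by blast
    obtain q' where q': "q' \<in> shard_monoid B" "z = y \<odot> q'"
      using yz unfolding le_pure_shard_interval le[OF sub[OF y]] by blast
    have "z = x \<odot> (q \<odot> q')" by (simp add: q q' path_mult_assoc)
    then show ?thesis
      unfolding le_pure_shard_interval le[OF sub[OF x]] using shard_monoid_mult_closed[OF B q(1) q'(1)] by blast
  qed
next
  let ?I = "pure_shard_interval \<H> B"
  fix x y z w
  assume "x .=\<^bsub>?I\<^esub> y" "z .=\<^bsub>?I\<^esub> w"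
  then show "x \<sqsubseteq>\<^bsub>?I\<^esub> z \<longleftrightarrow> y \<sqsubseteq>\<^bsub>?I\<^esub> w"
    by (simp add: eq_pure_shard_interval)
qed

lemma weak_partial_order_weak_poset:
  assumes "B \<in> \<R>"
  shows "weak_partial_order (weak_poset \<H> B)"
  by unfold_locales (use region_eqI_sep[OF assms] in \<open>auto simp: weak_poset_def\<close>)

lemma region_pow_le_iff:
  assumes B: "B \<in> \<R>" and C: "C \<in> \<R>" and D: "D \<in> \<R>"
  shows "region_pow \<H> B C \<sqsubseteq>\<^bsub>pure_shard_poset \<H> B\<^esub> region_pow \<H> B D \<longleftrightarrow> Inv B C \<subseteq> Inv B D"
proof -
  note car = shard_monoid_in_sal_group[OF B]
  note le = le_pure_shard_poset[OF B region_pow(2)[OF B C]]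
  show ?thesis
  proof
    assume "region_pow \<H> B C \<sqsubseteq>\<^bsub>pure_shard_poset \<H> B\<^esub> region_pow \<H> B D"
    then obtain q where q: "q \<in> shard_monoid B" "region_pow \<H> B D = region_pow \<H> B C \<odot> q"
      unfolding le by blast
    show "Inv B C \<subseteq> Inv B D"
    proof
      fix H assume H: "H \<in> Inv B C"
      then have H': "H \<in> \<H>" using sep_subset by blast
      have "class_winding H (region_pow \<H> B D) = class_winding H (region_pow \<H> B C) + class_winding H q"
        unfolding q(2) using class_winding_mult[OF H'] q(1) region_pow(2)[OF B C] car by blast
      then have "class_winding H (region_pow \<H> B D) > 0"
        using region_pow(3)[OF B C H'] H shard_monoid_winding(1)[OF B q(1) H'] by linarith
      then show "H \<in> Inv B D" using region_pow(3)[OF B D H'] by simp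
    qed
  next
    assume "Inv B C \<subseteq> Inv B D"
    then show "region_pow \<H> B C \<sqsubseteq>\<^bsub>pure_shard_poset \<H> B\<^esub> region_pow \<H> B D"
      unfolding le using round_trip_mono[OF B C D] by (simp add: region_pow(1) B C D)
  qed
qed

text \<open>Both ends of the interval are values of Pow, at \<open>B\<close> and at
  \<open>opp B\<close>, so the bounds are instances of \<open>region_pow_le_iff\<close>.\<close>

lemma region_pow_in_interval:
  assumes B: "B \<in> \<R>" and C: "C \<in> \<R>"
  shows "region_pow \<H> B C \<in> carrier (pure_shard_interval \<H> B)"
proof -
  note ob = opp(1)[OF B]
  have full: "full_twist \<H> B = region_pow \<H> B (opp B)"
    using full_twist_eq[OF B] region_pow(1)[OF B ob] by simp
  have "round_trip B B = gallery_class [B]"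
    using gal_class_unit(1)[OF B B] by (simp add: round_trip_def gal_class_refl[OF B])
  then have one: "\<one>\<^bsub>sal_group \<H> B\<^esub> = region_pow \<H> B B"
    using region_pow(1)[OF B B] by (simp add: sal_group_one)
  have "Inv B B \<subseteq> Inv B C" "Inv B C \<subseteq> Inv B (opp B)"
    using sep_empty_iff[OF B B] sep_opp[OF B] sep_subset by auto
  then show ?thesis
    unfolding carrier_pure_shard_interval full one
    using region_pow_le_iff[OF B B C] region_pow_le_iff[OF B C ob] region_pow(2)[OF B C] by simp
qed

end

theorem theorem1p7:
  fixes \<H> :: "'a::euclidean_space set set" and B :: "'a set"
  assumes "central_arrangement \<H>"
    and "irreducible_arrangement \<H>"
    and "B \<in> regions \<H>"
  shows "region_pow \<H> B \<in> carrier (weak_poset \<H> B) \<rightarrow> carrier (pure_shard_interval \<H> B) \<and>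
         inj_on (region_pow \<H> B) (carrier (weak_poset \<H> B)) \<and>
         order_emb (weak_poset \<H> B) (pure_shard_interval \<H> B) (region_pow \<H> B)"
proof -
  interpret arrangement \<H> by unfold_locales (rule assms(1))
  note B = assms(3)
  have car: "carrier (weak_poset \<H> B) = regions \<H>" by (simp add: weak_poset_def)
  have "inj_on (region_pow \<H> B) (regions \<H>)"
  proof (rule inj_onI)
    fix C D assume r: "C \<in> regions \<H>" "D \<in> regions \<H>" and eq: "region_pow \<H> B C = region_pow \<H> B D"
    \<comment> \<open>Equal values are comparable both ways by reflexivity, so the two inversion
      sets contain each other.\<close>
    have "sep \<H> B C = sep \<H> B D"
      using region_pow_le_iff[OF B r] region_pow_le_iff[OF B r(2,1)] region_pow_le_iff[OF B r(1,1)]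
        region_pow_le_iff[OF B r(2,2)] eq by auto
    then show "C = D" using region_eqI_sep[OF B r] by simp
  qed
  moreover have "order_emb (weak_poset \<H> B) (pure_shard_interval \<H> B) (region_pow \<H> B)"
    unfolding order_emb_def car
    using weak_partial_order_weak_poset[OF B] weak_partial_order_pure_shard_interval[OF B]
      region_pow_le_iff[OF B]
    by (simp add: le_pure_shard_interval) (simp add: weak_poset_def)
  ultimately show ?thesis
    unfolding car using region_pow_in_interval[OF B] by blast
qed

end
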